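(* Let $\mathcal F$ be the canonical polygon for a signature $(g;m_1,\dots,m_r;t)$, $t\ge1$, let $\mathcal A=\{A_1,\dots,A_N\}$ be a partition of $\mathbb S$ with $A_k=V_k$ for ideal $V_k$ and $A_k\in(V_{k-1},V_{k+1})$ for elliptic $V_k$, and let $F_{\mathcal A}$ be the associated natural extension map. Then $F_{\mathcal A}$ is bijective on the set $\Omega_{\mathcal A}$ defined in the context.
   Context: $\mathbb D$ is the unit disk model of the hyperbolic plane, $\mathbb S=\partial\mathbb D$; $[x,y]\subset\mathbb S$ denotes the counter-clockwise arc from $x$ to $y$. A signature $(g;m_1,\dots,m_r;t)$ consists of $g\ge0$, $2\le m_1\le\dots\le m_r$, and $t$, with $2g-2+\sum(1-1/m_i)+t>0$. Canonical polygon $\mathcal F$ for a signature with $t\ge1$. Put $\ell=g+r+t-1$, $N=4g+2r+2(t-1)$. It is a convex polygon with vertices $V_0=1,V_1,\dots,V_N=V_0$ counter-clockwise and sides $V_{k-1}V_k$, all of infinite length. The first $4g$ sides form $g$ quadruples of adjacent complete geodesics; in the $k$-th quadruple (from $V_{4k-4}$ to $V_{4k}$) the first side is glued to the third by a hyperbolic $a_k$ ($V_{4k-4}\mapsto V_{4k-1}$, $V_{4k-3}\mapsto V_{4k-2}$) and the fourth to the second by a hyperbolic $b_k$ ($V_{4k-1}\mapsto V_{4k-2}$, $V_{4k}\mapsto V_{4k-3}$). The next $2r$ sides are geodesic rays in $r$ adjacent pairs; the $i$-th pair meets at a vertex in $\mathbb D$ (an elliptic vertex of order $m_i$) with angle $2\pi/m_i$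 and is glued by an elliptic transformation fixing that vertex. The last $2(t-1)$ sides form $t-1$ adjacent pairs of complete geodesics meeting at a point of $\mathbb S$, each glued by a parabolic transformation fixing that point. Each glued side is an arc of an isometric circle of its side-pairing transformation (if $\ell=2$, $m_i=2$, the pair lies on a diameter with vertex $0$ and is glued by $z\mapsto-z$). Further, $\arg V_{4k}=\frac{2\pi}{\ell}k$ ($0\le k\le g$), $\arg V_{4g+2j}=\frac{2\pi}{\ell}(g+j)$ ($1\le j\le r+t-1$), and the vertices of each quadruple are equally spaced on $\mathbb S$. $\gamma_k$ denotes the side-pairing mapping side $V_{k-1}V_k$ to its paired side. Vertices on $\mathbb S$ are called ideal. Natural extension: $F_{\mathcal A}(u,w)=(\gamma_k(u),\gamma_k(w))$ for $w\in[A_{k-1},A_k)$ (with $A_0=A_N$), on $\{(u,w)\in\mathbb S\times\mathbb S:u\ne w\}$. The set $\Omega_{\mathcal A}$. Let $v=e^{\pi i/\ell}$, $v^{\alpha}=e^{\alpha\pi i/\ell}$, $R(z)=e^{2\pi i/\ell}z$, and let $(s_1,\dots,s_\ell)=(\square,\dots,\square,m_1,\dots,m_r,\infty,\dots,\infty)$ with $g$ symbols $\square$ and $t-1$ symbols $\infty$. Then $$\Omega_{\mathcal A}=\bigcup_{n=1}^{\ell}(R^{n-1}\times R^{n-1})\,\Omega_n,$$ where $\Omega_n\subset\mathbb S\times[1,v^2]$ is as follows. If $s_n=\square$: $\Omega_n=([v^{1/2},1]\times[1,v^{1/2}])\cup([v,v^{1/2}]\times[v^{1/2},v])\cup([v^{3/2},v]\times[v,v^{3/2}])\cup([v^2,v^{3/2}]\times[v^{3/2},v^2])$.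 If $s_n=2$: $\Omega_n=[v^2,1]\times[1,v^2]$. If $s_n=\infty$: $\Omega_n=([v,1]\times[1,v])\cup([v^2,v]\times[v,v^2])$. If $s_n=m$ with $3\le m<\infty$: let $k=4g+2(n-g)-1$ (so $V_k$ is the elliptic vertex in the $n$-th sector), let $a=R^{-(n-1)}(A_k)\in(1,v^2)$, and let $c_m=R^{-(n-1)}\circ\gamma_k\circ R^{n-1}$, which is the clockwise hyperbolic rotation by $2\pi/m$ about the point $R^{-(n-1)}(V_k)$ and satisfies $c_m(1)=v^2$. The integers $I,J$ are defined as follows. If $c_m^j(a)\ne1$ for all integers $j$, then $J$ is the smallest non-negative integer such that $c_m^{J+1}(a)$ is not in the open arc $(1,v^2)$, and $I=m-J-2$. In the special case that $c_m^{j}(a)=1$ for some $j$ (take the least positive such $j$), put $i=m-j-2$ and then $I=i-1$, $J=j$. Then $\Omega_n=\bigcup_{i=1}^{I+1}\mathcal U_m(i)\cup\bigcup_{j=1}^{J+1}\mathcal L_m(j)$ with $\mathcal U_m(i)=[v^2,c_m^{-i+1}(1)]\times[c_m^{-i+1}(a),c_m^{-i}(a)]$ for $1\le i\le I$, $\mathcal U_m(I+1)=[v^2,c_m^{-I}(1)]\times[c_m^{-I}(a),v^2]$, $\mathcal L_m(j)=[c_m^{j-1}(v^2),1]\times[c_m^{j}(a),c_m^{j-1}(a)]$ for $1\le j\le J$, $\mathcal L_m(J+1)=[c_m^{J}(v^2),1]\times[1,c_m^{J}(a)]$.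
   Formalization: Bijectivity is proved for Ω_A with half-open arcs [x,y), which contains the interior of the closed Ω_A and is dense in it, as it fails on the closed set's boundary. In the special case c_m^j(a)=1, i=m−j−2 is corrected to i=m−j−1 (so I=m−j−2); the printed index makes the claim false. *)

theory Defs
  imports "HOL-Analysis.Analysis"
begin

section \<open>Isometries of the disk model\<close>

definition su11_map :: "complex \<Rightarrow> complex \<Rightarrow> complex \<Rightarrow> complex" where
  "su11_map \<alpha> \<beta> z = (\<alpha> * z + \<beta>) / (cnj \<beta> * z + cnj \<alpha>)"

definition su11 :: "complex \<Rightarrow> complex \<Rightarrow> bool" where
  "su11 \<alpha> \<beta> \<longleftrightarrow> (cmod \<alpha>)\<^sup>2 - (cmod \<beta>)\<^sup>2 = 1"

definition disk_isometry :: "(complex \<Rightarrow> complex) \<Rightarrow> bool" where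
  "disk_isometry f \<longleftrightarrow> (\<exists>\<alpha> \<beta>. su11 \<alpha> \<beta> \<and> f = su11_map \<alpha> \<beta>)"

text \<open>The trace of the matrix of \<^term>\<open>su11_map \<alpha> \<beta>\<close> is \<^term>\<open>2 * Re \<alpha>\<close>; the matrix is determined
  by the map up to sign.\<close>

definition hyperbolic :: "(complex \<Rightarrow> complex) \<Rightarrow> bool" where
  "hyperbolic f \<longleftrightarrow> (\<exists>\<alpha> \<beta>. su11 \<alpha> \<beta> \<and> f = su11_map \<alpha> \<beta> \<and> \<bar>2 * Re \<alpha>\<bar> > 2)"

definition elliptic :: "(complex \<Rightarrow> complex) \<Rightarrow> bool" where
  "elliptic f \<longleftrightarrow> (\<exists>\<alpha> \<beta>. su11 \<alpha> \<beta> \<and> f = su11_map \<alpha> \<beta> \<and> \<bar>2 * Re \<alpha>\<bar> < 2)"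

definition parabolic :: "(complex \<Rightarrow> complex) \<Rightarrow> bool" where
  "parabolic f \<longleftrightarrow> (\<exists>\<alpha> \<beta>. su11 \<alpha> \<beta> \<and> f = su11_map \<alpha> \<beta> \<and> \<bar>2 * Re \<alpha>\<bar> = 2 \<and> \<beta> \<noteq> 0)"

text \<open>This is a Euclidean circle whenever the disk isometry \<open>f\<close> does not fix \<open>0\<close> (equivalently, does
  not fix \<open>\<infinity>\<close>); for a rotation about \<open>0\<close> it is the whole plane.\<close>

definition isometric_circle :: "(complex \<Rightarrow> complex) \<Rightarrow> complex set" where
  "isometric_circle f = {z. f field_differentiable (at z) \<and> cmod (deriv f z) = 1}"


section \<open>Hyperbolic polygons\<close>

text \<open>Geodesics are the images of the real diameter \<open>[-1,1]\<close> under disk isometries. The end points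
  \<open>x\<close>, \<open>y\<close> may be ideal; they belong to the segment.\<close>

definition geodesic_segment :: "complex \<Rightarrow> complex \<Rightarrow> complex set" where
  "geodesic_segment x y = {z. \<exists>f p q s. disk_isometry f \<and> -1 \<le> p \<and> p < q \<and> q \<le> 1
      \<and> f (complex_of_real p) = x \<and> f (complex_of_real q) = y
      \<and> p \<le> s \<and> s \<le> q \<and> z = f (complex_of_real s)}"

text \<open>The closed half-plane, with its boundary at infinity, to the left of the complete geodesic
  through \<open>x\<close> and \<open>y\<close> directed from \<open>x\<close> to \<open>y\<close>.\<close>

definition left_half_plane :: "complex \<Rightarrow> complex \<Rightarrow> complex set" where
  "left_half_plane x y = {z. \<exists>f p q \<zeta>. disk_isometry f \<and> -1 \<le> p \<and> p < q \<and> q \<le> 1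
      \<and> f (complex_of_real p) = x \<and> f (complex_of_real q) = y
      \<and> cmod \<zeta> \<le> 1 \<and> Im \<zeta> \<ge> 0 \<and> z = f \<zeta>}"

definition convex_polygon :: "nat \<Rightarrow> (nat \<Rightarrow> complex) \<Rightarrow> bool" where
  "convex_polygon N V \<longleftrightarrow> V N = V 0 \<and> inj_on V {0..<N} \<and> V ` {0..N} \<subseteq> cball 0 1
     \<and> (\<forall>k\<in>{1..N}. \<forall>j\<in>{0..N}. V j \<in> left_half_plane (V (k - 1)) (V k))"

text \<open>The interior angle at \<open>p\<close> of a counter-clockwise polygon whose sides adjacent to \<open>p\<close> are rays,
  coming from the ideal point \<open>x\<close> and leading to the ideal point \<open>y\<close>: move \<open>p\<close> to \<open>0\<close> and rotate \<open>y\<close>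
  to \<open>1\<close>; the rays become radii.\<close>

definition has_interior_angle :: "complex \<Rightarrow> complex \<Rightarrow> complex \<Rightarrow> real \<Rightarrow> bool" where
  "has_interior_angle x p y \<theta> \<longleftrightarrow> 0 < \<theta> \<and> \<theta> < 2 * pi
     \<and> (\<exists>f. disk_isometry f \<and> f 0 = p \<and> f 1 = y \<and> f (cis \<theta>) = x)"


section \<open>The canonical polygon of a signature\<close>

text \<open>A signature \<open>(g; m\<^sub>1, \<dots>, m\<^sub>r; t)\<close> is given by \<open>g\<close>, the list \<open>ms = [m\<^sub>1, \<dots>, m\<^sub>r]\<close> and \<open>t\<close>;
  thus \<open>m\<^sub>i\<close> is \<^term>\<open>ms ! (i - 1)\<close>.\<close>

definition signature :: "nat \<Rightarrow> nat list \<Rightarrow> nat \<Rightarrow> bool" where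
  "signature g ms t \<longleftrightarrow> sorted ms \<and> (\<forall>m\<in>set ms. 2 \<le> m)
     \<and> 2 * real g - 2 + (\<Sum>m\<leftarrow>ms. 1 - 1 / real m) + real t > 0"

definition num_sectors :: "nat \<Rightarrow> nat list \<Rightarrow> nat \<Rightarrow> nat" where
  "num_sectors g ms t = g + length ms + t - 1"

definition num_sides :: "nat \<Rightarrow> nat list \<Rightarrow> nat \<Rightarrow> nat" where
  "num_sides g ms t = 4 * g + 2 * length ms + 2 * (t - 1)"

definition inverse_on_disk :: "(complex \<Rightarrow> complex) \<Rightarrow> (complex \<Rightarrow> complex) \<Rightarrow> bool" where
  "inverse_on_disk f h \<longleftrightarrow> (\<forall>z\<in>cball 0 1. f (h z) = z \<and> h (f z) = z)"

text \<open>\<open>V k\<close> (\<open>0 \<le> k \<le> N\<close>) are the vertices and \<open>\<gamma> k\<close> (\<open>1 \<le> k \<le> N\<close>) is the side pairing map of the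
  side from \<open>V (k - 1)\<close> to \<open>V k\<close>. In the \<open>k\<close>-th quadruple, with \<open>q = 4 * k - 4\<close>, the maps \<open>a\<^sub>k\<close> and
  \<open>b\<^sub>k\<close> are \<open>\<gamma> (q + 1)\<close> and \<open>\<gamma> (q + 4)\<close>.\<close>

definition canonical_polygon ::
  "nat \<Rightarrow> nat list \<Rightarrow> nat \<Rightarrow> (nat \<Rightarrow> complex) \<Rightarrow> (nat \<Rightarrow> complex \<Rightarrow> complex) \<Rightarrow> bool" where
  "canonical_polygon g ms t V \<gamma> \<longleftrightarrow>
    (let r = length ms; l = num_sectors g ms t; N = num_sides g ms t in
      convex_polygon N V \<and> V 0 = 1
    \<comment> \<open>positions of the vertices\<close>
    \<and> (\<forall>k\<le>g. V (4 * k) = cis (2 * pi / real l * real k))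
    \<and> (\<forall>j\<in>{1..r + t - 1}. V (4 * g + 2 * j) = cis (2 * pi / real l * real (g + j)))
    \<and> (\<forall>k<g. \<forall>i\<le>4. V (4 * k + i) = cis (2 * pi / real l * (real k + real i / 4)))
    \<comment> \<open>quadruples\<close>
    \<and> (\<forall>k\<in>{1..g}. let q = 4 * k - 4 in
          hyperbolic (\<gamma> (q + 1)) \<and> \<gamma> (q + 1) (V q) = V (q + 3) \<and> \<gamma> (q + 1) (V (q + 1)) = V (q + 2)
        \<and> hyperbolic (\<gamma> (q + 4)) \<and> \<gamma> (q + 4) (V (q + 3)) = V (q + 2) \<and> \<gamma> (q + 4) (V (q + 4)) = V (q + 1)
        \<and> disk_isometry (\<gamma> (q + 3)) \<and> inverse_on_disk (\<gamma> (q + 3)) (\<gamma> (q + 1))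
        \<and> disk_isometry (\<gamma> (q + 2)) \<and> inverse_on_disk (\<gamma> (q + 2)) (\<gamma> (q + 4)))
    \<comment> \<open>elliptic pairs\<close>
    \<and> (\<forall>i\<in>{1..r}. let k = 4 * g + 2 * i - 1 in
          V k \<in> ball 0 1
        \<and> has_interior_angle (V (k - 1)) (V k) (V (k + 1)) (2 * pi / real (ms ! (i - 1)))
        \<and> elliptic (\<gamma> k) \<and> \<gamma> k (V k) = V k \<and> \<gamma> k (V (k - 1)) = V (k + 1)
        \<and> disk_isometry (\<gamma> (k + 1)) \<and> inverse_on_disk (\<gamma> (k + 1)) (\<gamma> k)
        \<and> (l = 2 \<and> ms ! (i - 1) = 2 \<longrightarrow> V k = 0 \<and> (\<forall>z\<in>cball 0 1. \<gamma> k z = - z)))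
    \<comment> \<open>parabolic pairs\<close>
    \<and> (\<forall>j\<in>{1..t - 1}. let k = 4 * g + 2 * r + 2 * j - 1 in
          V k \<in> sphere 0 1
        \<and> parabolic (\<gamma> k) \<and> \<gamma> k (V k) = V k \<and> \<gamma> k (V (k - 1)) = V (k + 1)
        \<and> disk_isometry (\<gamma> (k + 1)) \<and> inverse_on_disk (\<gamma> (k + 1)) (\<gamma> k))
    \<comment> \<open>sides lie on isometric circles, apart from the pairs on a diameter\<close>
    \<and> (\<forall>k\<in>{1..N}.
          (l = 2 \<and> (\<exists>i\<in>{1..r}. ms ! (i - 1) = 2 \<and> k \<in> {4 * g + 2 * i - 1, 4 * g + 2 * i}))
        \<or> (\<gamma> k 0 \<noteq> 0 \<and> geodesic_segment (V (k - 1)) (V k) \<subseteq> isometric_circle (\<gamma> k))))"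


section \<open>Arcs, partitions and the natural extension\<close>

text \<open>Counter-clockwise arcs from \<open>x\<close> to \<open>y\<close> on the unit circle: \<open>[x,y]\<close>, \<open>[x,y)\<close> and \<open>(x,y)\<close>. For
  \<open>x = y\<close> they are \<open>{x}\<close>, empty and empty, never the full circle.\<close>

definition closed_arc :: "complex \<Rightarrow> complex \<Rightarrow> complex set" where
  "closed_arc x y = {x * cis s | s. 0 \<le> s \<and> s \<le> Arg2pi (y / x)}"

definition half_open_arc :: "complex \<Rightarrow> complex \<Rightarrow> complex set" where
  "half_open_arc x y = {x * cis s | s. 0 \<le> s \<and> s < Arg2pi (y / x)}"

definition open_arc :: "complex \<Rightarrow> complex \<Rightarrow> complex set" where
  "open_arc x y = {x * cis s | s. 0 < s \<and> s < Arg2pi (y / x)}"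

definition admissible_partition :: "nat \<Rightarrow> (nat \<Rightarrow> complex) \<Rightarrow> (nat \<Rightarrow> complex) \<Rightarrow> bool" where
  "admissible_partition N V A \<longleftrightarrow> A 0 = A N
     \<and> (\<forall>k\<in>{1..N}. (V k \<in> sphere 0 1 \<longrightarrow> A k = V k)
                  \<and> (V k \<in> ball 0 1 \<longrightarrow> A k \<in> open_arc (V (k - 1)) (V (k + 1))))"

definition nat_ext ::
  "nat \<Rightarrow> (nat \<Rightarrow> complex) \<Rightarrow> (nat \<Rightarrow> complex \<Rightarrow> complex) \<Rightarrow> complex \<times> complex \<Rightarrow> complex \<times> complex" where
  "nat_ext N A \<gamma> = (\<lambda>(u, w).
     let k = (THE k. 1 \<le> k \<and> k \<le> N \<and> w \<in> half_open_arc (A (k - 1)) (A k)) in (\<gamma> k u, \<gamma> k w))"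


section \<open>The set Omega\<close>

text \<open>All sets below take the arc constructor \<open>ar\<close> as a parameter. With \<^const>\<open>closed_arc\<close> one gets
  the finite union of closed rectangles \<open>[x,y] \<times> [z,z']\<close>; with \<^const>\<open>half_open_arc\<close> one gets the
  same rectangles taken as \<open>[x,y) \<times> [z,z')\<close>, following the convention \<open>[A\<^sub>k\<^sub>-\<^sub>1, A\<^sub>k)\<close> in
  \<^const>\<open>nat_ext\<close>. The closed rectangles overlap along edges and meet the diagonal, and the natural
  extension is bijective on their union only up to its boundary; for instance, the fibre of the
  union over an ideal vertex is the whole circle, which makes some boundary points have two preimages.
  On the half-open rectangles it is an exact bijection.\<close>

definition vpow :: "nat \<Rightarrow> real \<Rightarrow> complex" where
  "vpow l \<alpha> = cis (\<alpha> * pi / real l)"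

definition rot :: "nat \<Rightarrow> nat \<Rightarrow> complex \<Rightarrow> complex" where
  "rot l n z = cis (2 * pi / real l * (real n - 1)) * z"

definition rot_inv :: "nat \<Rightarrow> nat \<Rightarrow> complex \<Rightarrow> complex" where
  "rot_inv l n z = cis (- (2 * pi / real l * (real n - 1))) * z"

definition circle_iterate :: "(complex \<Rightarrow> complex) \<Rightarrow> int \<Rightarrow> complex \<Rightarrow> complex" where
  "circle_iterate c j = (if 0 \<le> j then c ^^ nat j else (inv_into (sphere 0 1) c) ^^ nat (- j))"

definition Omega_square :: "(complex \<Rightarrow> complex \<Rightarrow> complex set) \<Rightarrow> nat \<Rightarrow> (complex \<times> complex) set" where
  "Omega_square ar l = (let v = vpow l in
       ar (v (1/2)) 1 \<times> ar 1 (v (1/2))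
     \<union> ar (v 1) (v (1/2)) \<times> ar (v (1/2)) (v 1)
     \<union> ar (v (3/2)) (v 1) \<times> ar (v 1) (v (3/2))
     \<union> ar (v 2) (v (3/2)) \<times> ar (v (3/2)) (v 2))"

definition Omega_two :: "(complex \<Rightarrow> complex \<Rightarrow> complex set) \<Rightarrow> nat \<Rightarrow> (complex \<times> complex) set" where
  "Omega_two ar l = ar (vpow l 2) 1 \<times> ar 1 (vpow l 2)"

definition Omega_cusp :: "(complex \<Rightarrow> complex \<Rightarrow> complex set) \<Rightarrow> nat \<Rightarrow> (complex \<times> complex) set" where
  "Omega_cusp ar l = (let v = vpow l in
       ar (v 1) 1 \<times> ar 1 (v 1) \<union> ar (v 2) (v 1) \<times> ar (v 1) (v 2))"

text \<open>If \<open>1\<close> is not in the orbit of \<open>a\<close>, then \<open>J\<close> and \<open>I\<close> count the points \<open>c\<^sup>j(a)\<close> and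
  \<open>c\<^sup>-\<^sup>i(a)\<close> with \<open>i, j > 0\<close> before the orbit leaves the open arc \<open>(1, v\<^sup>2)\<close>. If \<open>c\<^sup>j(a) = 1\<close> with \<open>j\<close>
  least positive, let \<open>i\<close> be the index with \<open>c\<^sup>-\<^sup>i(a) = v\<^sup>2\<close>. As \<open>c\<close> has order \<open>m\<close> and \<open>c 1 = v\<^sup>2\<close>, it
  is \<open>i = m - j - 1\<close>; then \<open>J = j\<close> and \<open>I = i - 1\<close>. So \<open>I = m - J - 2\<close> in both cases. (Taking
  \<open>i = m - j - 2\<close> in the second case would be off by one: for \<open>m = 3\<close> it gives \<open>I = -1\<close>, and
  nothing would be left above \<open>a\<close>.)\<close>

definition index_J :: "(complex \<Rightarrow> complex) \<Rightarrow> nat \<Rightarrow> complex \<Rightarrow> int" where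
  "index_J c l a =
     (if \<exists>j. circle_iterate c j a = 1
      then int (LEAST j::nat. 0 < j \<and> circle_iterate c (int j) a = 1)
      else int (LEAST J::nat. circle_iterate c (int J + 1) a \<notin> open_arc 1 (vpow l 2)))"

definition index_I :: "(complex \<Rightarrow> complex) \<Rightarrow> nat \<Rightarrow> nat \<Rightarrow> complex \<Rightarrow> int" where
  "index_I c l m a =
     (if \<exists>j. circle_iterate c j a = 1
      then (let i = int m - index_J c l a - 1 in i - 1)
      else int m - index_J c l a - 2)"

definition Omega_elliptic ::
  "(complex \<Rightarrow> complex \<Rightarrow> complex set) \<Rightarrow> nat \<Rightarrow> nat \<Rightarrow> (complex \<Rightarrow> complex) \<Rightarrow> complex
     \<Rightarrow> (complex \<times> complex) set" where
  "Omega_elliptic ar l m c a =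
    (let it = circle_iterate c; v2 = vpow l 2; I = index_I c l m a; J = index_J c l a;
         U = (\<lambda>i. if i \<le> I then ar v2 (it (1 - i) 1) \<times> ar (it (1 - i) a) (it (- i) a)
                  else ar v2 (it (- I) 1) \<times> ar (it (- I) a) v2);
         L = (\<lambda>j. if j \<le> J then ar (it (j - 1) v2) 1 \<times> ar (it j a) (it (j - 1) a)
                  else ar (it J v2) 1 \<times> ar 1 (it J a))
     in (\<Union>i\<in>{1..I + 1}. U i) \<union> (\<Union>j\<in>{1..J + 1}. L j))"

definition Omega_sector ::
  "(complex \<Rightarrow> complex \<Rightarrow> complex set) \<Rightarrow> nat \<Rightarrow> nat list \<Rightarrow> nat \<Rightarrow> (nat \<Rightarrow> complex)
     \<Rightarrow> (nat \<Rightarrow> complex \<Rightarrow> complex) \<Rightarrow> nat \<Rightarrow> (complex \<times> complex) set" where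
  "Omega_sector ar g ms t A \<gamma> n =
    (let l = num_sectors g ms t in
     if n \<le> g then Omega_square ar l
     else if n \<le> g + length ms then
       (let m = ms ! (n - g - 1); k = 4 * g + 2 * (n - g) - 1 in
        if m = 2 then Omega_two ar l
        else Omega_elliptic ar l m (rot_inv l n \<circ> \<gamma> k \<circ> rot l n) (rot_inv l n (A k)))
     else Omega_cusp ar l)"

definition Omega ::
  "(complex \<Rightarrow> complex \<Rightarrow> complex set) \<Rightarrow> nat \<Rightarrow> nat list \<Rightarrow> nat \<Rightarrow> (nat \<Rightarrow> complex)
     \<Rightarrow> (nat \<Rightarrow> complex \<Rightarrow> complex) \<Rightarrow> (complex \<times> complex) set" where
  "Omega ar g ms t A \<gamma> =
     (let l = num_sectors g ms t in
      \<Union>n\<in>{1..l}. map_prod (rot l n) (rot l n) ` Omega_sector ar g ms t A \<gamma> n)"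

end

(*
Cut the circle into the l sectors of angle 2 pi / l, and let D_n be the part of Omega over the n-th
sector S_n (in the second coordinate). D_n contains all of (S - S_n) x S_n, where S is the circle,
so D_n = (S - S_n) x S_n + X_n with X_n inside S_n x S_n. The side pairings of the n-th sector map
D_n bijectively onto S_n x (S - S_n) + X_n. The unions over n of (S - S_n) x S_n and of
S_n x (S - S_n) are both the set of pairs in different sectors, so the images of the D_n again
tile Omega.

In a sector of a quadruple or of a cusp, a side map takes the arc cut off by its side to the
complement of the arc cut off by the paired side, and D_n consists of the products (complement of
a side arc) x (side arc). That a cusp lies in the middle of its sector follows from the isometric
circle condition: the derivative of the pairing has modulus 1 at the cusp and at the other end of
the side, so the two neighbours of the cusp are equidistant from it. In an elliptic sector of
order m, conjugation with a disk isometry turns the pairing into the unit shift s |-> s - 1 of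
R / m Z, with the sector as [0, m - 1) and the partition point at alpha. Then the fibre of D_n over t
is [-1, k) or [k, 0) modulo m according to the sign of k = floor (t - alpha), and J = floor alpha
whether or not alpha is an integer.
*)

theory Submission
  imports Defs "HOL-Library.Disjoint_Sets"
begin

text \<open>Tiling needs exact set equalities, and half-open arcs provide them: the complement of a
  proper half-open arc is again one, and the side arcs partition the circle. The closed set is tied
  to the half-open one by two inclusions: it lies in the closure of the half-open set, and its
  interior relative to the torus lies inside that set. So the two differ by boundary points only.
  Two degenerations shape the details. When the orbit of the partition point meets 1, the last lower
  rectangle collapses to a segment whose half-open version is empty; its points are reached as
  limits from the preceding sector, and the signature condition guarantees a second sector as soon
  as one sector is elliptic or parabolic. When a single quadruple is the whole polygon, its sector
  is the full circle with coinciding ends, so sectors are described by intervals of angles. Arcs are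
  carried along by disk isometries through the sign of the area of inscribed triangles, which such a
  map rescales by a positive factor; this avoids lifting isometries to the line.\<close>

abbreviation (input) unit_circle :: "complex set" where
  "unit_circle \<equiv> sphere 0 1"

lemma Arg2pi_cis: "0 \<le> s \<Longrightarrow> s < 2 * pi \<Longrightarrow> Arg2pi (cis s) = s"
  by (rule Arg2pi_unique[of 1]) (auto simp: cis_conv_exp)

lemma cis_distinct: "a < b \<Longrightarrow> b < a + 2 * pi \<Longrightarrow> cis a \<noteq> cis b"
proof
  assume *: "a < b" "b < a + 2 * pi" "cis a = cis b"
  then have "cis (b - a) = cis 0"
    by (simp flip: cis_divide)
  then show False
    using Arg2pi_cis[of "b - a"] Arg2pi_cis[of 0] * by simp
qed

lemma unit_circleE:
  assumes "x \<in> unit_circle"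
  obtains s where "x = cis s" "0 \<le> s" "s < 2 * pi"
proof (rule that[of "Arg2pi x"])
  show "x = cis (Arg2pi x)"
    using assms by (metis cis_conv_exp complex_norm_eq_1_exp mem_sphere_0)
qed (use Arg2pi in auto)

lemma cis_in_unit_circle [simp]: "cis s \<in> unit_circle"
  by simp

section \<open>Arcs and the cyclic order of the circle\<close>

text \<open>Twice the signed area of the triangle with vertices \<open>x\<close>, \<open>y\<close>, \<open>z\<close> inscribed in the circle.\<close>

definition orient :: "complex \<Rightarrow> complex \<Rightarrow> complex \<Rightarrow> real" where
  "orient x y z = Im (cnj x * y + cnj y * z + cnj z * x)"

lemma orient_cis_sum: "orient (cis a) (cis b) (cis c) = sin (b - a) + sin (c - b) + sin (a - c)"
  by (simp add: orient_def cis_cnj cis_mult)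

text \<open>In half-angles the sum of three sines factors, by
  \<open>sin 2x + sin 2y - sin 2(x + y) = 4 sin x sin y sin (x + y)\<close>. The product form makes
  the sign readable.\<close>

lemma orient_cis:
  "orient (cis a) (cis b) (cis c) = 4 * sin ((b - a) / 2) * sin ((c - b) / 2) * sin ((c - a) / 2)"
proof -
  have *: "sin (2 * x) + sin (2 * y) - sin (2 * (x + y)) = 4 * sin x * sin y * sin (x + y)" for x y :: real
  proof -
    have "sin (2 * x) + sin (2 * y) - sin (2 * (x + y))
      = 2 * sin x * cos x * (1 - (cos y * cos y - sin y * sin y)) + 2 * sin y * cos y * (1 - (cos x * cos x - sin x * sin x))"
      unfolding distrib_left sin_add[of "2 * x"] sin_double cos_double power2_eq_square by algebra
    also have "\<dots> = 2 * sin x * cos x * (2 * (sin y * sin y)) + 2 * sin y * cos y * (2 * (sin x * sin x))"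
      using sin_cos_squared_add[of x] sin_cos_squared_add[of y] unfolding power2_eq_square by algebra
    also have "\<dots> = 4 * sin x * sin y * sin (x + y)"
      by (simp add: sin_add algebra_simps)
    finally show ?thesis .
  qed
  define p q where "p = (b - a) / 2" and "q = (c - b) / 2"
  then have bc: "b = a + 2 * p" "c = a + 2 * (p + q)"
    by (auto simp: field_simps)
  have e: "a + 2 * p - a = 2 * p" "a + 2 * (p + q) - (a + 2 * p) = 2 * q" "a - (a + 2 * (p + q)) = - (2 * (p + q))"
    "a + 2 * (p + q) - a = 2 * (p + q)"
    by auto
  have h: "2 * x / 2 = x" for x :: real
    by simp
  show ?thesis
    unfolding orient_cis_sum bc e sin_minus h using *[of p q] by simp
qed

text \<open>Angles are measured within one turn from \<open>a\<close>, so the half-differences from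
  \<open>a\<close> lie in \<open>[0, pi)\<close> and have nonnegative sine. Only the sine of
  \<open>(c - b) / 2\<close> can make the product negative.\<close>

lemma orient_cis_pos_iff:
  assumes "a \<le> b" "b < a + 2 * pi" "a \<le> c" "c < a + 2 * pi"
  shows "orient (cis a) (cis b) (cis c) > 0 \<longleftrightarrow> a < b \<and> b < c"
proof -
  have p: "sin ((y - x) / 2) > 0" if "x < y" "y < x + 2 * pi" for x y :: real
    using that by (intro sin_gt_zero) auto
  have n: "sin ((y - x) / 2) \<le> 0" if "y \<le> x" "x < y + 2 * pi" for x y :: real
  proof -
    have "sin ((x - y) / 2) \<ge> 0"
      using that by (intro sin_ge_zero) auto
    then show ?thesis
      using sin_minus[of "(x - y) / 2"] unfolding minus_divide_left minus_diff_eq by linarith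
  qed
  show ?thesis
  proof (cases "a < b \<and> b < c")
    case True
    then show ?thesis
      unfolding orient_cis using assms p[of a b] p[of b c] p[of a c] by simp
  next
    case False
    have ab: "sin ((b - a) / 2) \<ge> 0" and ac: "sin ((c - a) / 2) \<ge> 0"
      using assms by (intro sin_ge_zero; simp)+
    have "sin ((b - a) / 2) = 0 \<or> sin ((c - b) / 2) \<le> 0"
      using False n[of c b] assms by auto
    then have "sin ((b - a) / 2) * sin ((c - b) / 2) \<le> 0"
      using ab by (auto intro: mult_nonneg_nonpos)
    then have "sin ((b - a) / 2) * sin ((c - b) / 2) * sin ((c - a) / 2) \<le> 0"
      using ac by (rule mult_nonpos_nonneg)
    then show ?thesis
      unfolding orient_cis using False by linarith
  qed
qed

lemma Arg2pi_divide_cis: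
  assumes "a \<le> b" "b < a + 2 * pi"
  shows "Arg2pi (cis b / cis a) = b - a"
  using assms by (simp add: cis_divide Arg2pi_cis)

lemma arc_cis:
  assumes "a \<le> b" "b < a + 2 * pi"
  shows closed_arc_cis: "closed_arc (cis a) (cis b) = cis ` {a..b}"
    and half_open_arc_cis: "half_open_arc (cis a) (cis b) = cis ` {a..<b}"
    and open_arc_cis: "open_arc (cis a) (cis b) = cis ` {a<..<b}"
proof -
  have *: "\<exists>s. cis x = cis a * cis s \<and> P s" if "P (x - a)" for x P
    using that by (intro exI[of _ "x - a"]) (simp add: cis_mult)
  show "closed_arc (cis a) (cis b) = cis ` {a..b}"
    unfolding closed_arc_def Arg2pi_divide_cis[OF assms] by (auto simp: cis_mult intro!: *[unfolded cis_mult])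
  show "half_open_arc (cis a) (cis b) = cis ` {a..<b}"
    unfolding half_open_arc_def Arg2pi_divide_cis[OF assms] by (auto simp: cis_mult intro!: *[unfolded cis_mult])
  show "open_arc (cis a) (cis b) = cis ` {a<..<b}"
    unfolding open_arc_def Arg2pi_divide_cis[OF assms] by (auto simp: cis_mult intro!: *[unfolded cis_mult])
qed

lemma unit_circle_cis_from:
  assumes "x \<in> unit_circle"
  obtains s where "x = cis s" "a \<le> s" "s < a + 2 * pi"
proof -
  have "x / cis a \<in> unit_circle"
    using assms by (simp add: norm_divide)
  then obtain s where "x / cis a = cis s" "0 \<le> s" "s < 2 * pi"
    by (rule unit_circleE)
  then show thesis
    by (intro that[of "a + s"]) (auto simp: field_simps simp flip: cis_mult)
qed

lemma arc_subset_unit_circle: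
  assumes "x \<in> unit_circle"
  shows "closed_arc x y \<subseteq> unit_circle" "half_open_arc x y \<subseteq> unit_circle" "open_arc x y \<subseteq> unit_circle"
  using assms by (auto simp: closed_arc_def half_open_arc_def open_arc_def norm_mult)

text \<open>This turns membership in an arc into the sign of \<open>orient\<close>, whose behaviour
  under disk isometries can be computed. For \<open>x = y\<close> both sides fail: the arc is empty
  and the triangle degenerate.\<close>

lemma open_arc_iff:
  assumes "x \<in> unit_circle" "y \<in> unit_circle"
  shows "u \<in> open_arc x y \<longleftrightarrow> u \<in> unit_circle \<and> orient x u y > 0"
proof (cases "u \<in> unit_circle")
  case True
  obtain a where a: "x = cis a" using assms(1) by (rule unit_circleE)
  obtain b where b: "y = cis b" "a \<le> b" "b < a + 2 * pi" using assms(2) by (rule unit_circle_cis_from)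
  obtain c where c: "u = cis c" "a \<le> c" "c < a + 2 * pi" using True by (rule unit_circle_cis_from)
  have "u \<in> open_arc x y \<longleftrightarrow> (\<exists>s. a < s \<and> s < b \<and> cis c = cis s)"
    unfolding a b c using open_arc_cis[OF b(2,3)] by auto
  also have "\<dots> \<longleftrightarrow> a < c \<and> c < b"
  proof -
    have "s = c" if s: "a < s" "s < b" "cis c = cis s" for s
    proof (rule ccontr)
      assume "s \<noteq> c"
      then consider "c < s" "s < c + 2 * pi" | "s < c" "c < s + 2 * pi"
        using s b c by linarith
      then show False
        using cis_distinct s(3) by cases metis+
    qed
    then show ?thesis
      by auto
  qed
  finally show ?thesis
    unfolding a b c using orient_cis_pos_iff[of a c b] b c by simp
next
  case False
  then show ?thesis
    using arc_subset_unit_circle(3)[OF assms(1)] by blast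
qed

lemma half_open_arc_eq:
  assumes "x \<in> unit_circle" "y \<in> unit_circle"
  shows "half_open_arc x y = (if x = y then {} else insert x (open_arc x y))"
proof -
  obtain a where a: "x = cis a" using assms(1) by (rule unit_circleE)
  obtain b where b: "y = cis b" "a \<le> b" "b < a + 2 * pi" using assms(2) by (rule unit_circle_cis_from)
  have "x \<noteq> y \<longleftrightarrow> a < b"
    using cis_distinct[of a b] a b by (cases "a = b") auto
  moreover have "{a..<b} = (if a < b then insert a {a<..<b} else {})"
    by auto
  ultimately show ?thesis
    unfolding a b half_open_arc_cis[OF b(2,3)] open_arc_cis[OF b(2,3)] by auto
qed

lemma closed_arc_eq:
  assumes "x \<in> unit_circle" "y \<in> unit_circle"
  shows "closed_arc x y = insert x (insert y (open_arc x y))"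
proof -
  obtain a where a: "x = cis a" using assms(1) by (rule unit_circleE)
  obtain b where b: "y = cis b" "a \<le> b" "b < a + 2 * pi" using assms(2) by (rule unit_circle_cis_from)
  have "{a..b} = insert a (insert b {a<..<b})"
    using b by auto
  then show ?thesis
    unfolding a b closed_arc_cis[OF b(2,3)] open_arc_cis[OF b(2,3)] by auto
qed

lemma half_open_subset_closed_arc: "half_open_arc x y \<subseteq> closed_arc x y"
  by (force simp: half_open_arc_def closed_arc_def)

lemma inj_on_cis: "inj_on cis {a..<a + 2 * pi}"
proof (rule inj_onI)
  fix s t assume "s \<in> {a..<a + 2 * pi}" "t \<in> {a..<a + 2 * pi}" "cis s = cis t"
  then show "s = t"
    using cis_distinct[of s t] cis_distinct[of t s] by (cases s t rule: linorder_cases) auto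
qed

text \<open>Each end point belongs to exactly one of the two arcs, an exactness that closed arcs
  lack. For \<open>x = y\<close> both arcs would be empty.\<close>

lemma half_open_arc_compl:
  assumes "x \<in> unit_circle" "y \<in> unit_circle" "x \<noteq> y"
  shows "half_open_arc y x = unit_circle - half_open_arc x y"
proof -
  obtain a where a: "x = cis a" using assms(1) by (rule unit_circleE)
  obtain b where b: "y = cis b" "a \<le> b" "b < a + 2 * pi" using assms(2) by (rule unit_circle_cis_from)
  have ab: "a < b"
    using assms a b by (cases "a = b") auto
  \<comment> \<open>A second angle for \<open>x\<close>, one turn later, so that the arc from
    \<open>y\<close> to \<open>x\<close> is the image of an interval.\<close>
  have a': "x = cis (a + 2 * pi)"
    unfolding a by (simp flip: cis_mult)
  have C: "unit_circle = cis ` {a..<a + 2 * pi}"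
    by (force elim: unit_circle_cis_from[of _ a])
  have "half_open_arc y x = cis ` {b..<a + 2 * pi}"
    unfolding a' b(1) using ab b by (intro half_open_arc_cis) auto
  also have "{b..<a + 2 * pi} = {a..<a + 2 * pi} - {a..<b}"
    using ab b by auto
  also have "cis ` \<dots> = cis ` {a..<a + 2 * pi} - cis ` {a..<b}"
    by (rule inj_on_image_set_diff[OF inj_on_cis]) (use b in auto)
  finally show ?thesis
    unfolding C[symmetric] a b(1) half_open_arc_cis[OF b(2,3)] .
qed

section \<open>Orientation preserving maps of the circle\<close>

text \<open>Only the sign of \<open>orient\<close> has to be kept, since arcs depend on nothing
  else; its value does change under disk isometries.\<close>

definition circle_auto :: "(complex \<Rightarrow> complex) \<Rightarrow> bool" where
  "circle_auto h \<longleftrightarrow> bij_betw h unit_circle unit_circle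
     \<and> (\<forall>x\<in>unit_circle. \<forall>y\<in>unit_circle. \<forall>z\<in>unit_circle. orient (h x) (h y) (h z) > 0 \<longleftrightarrow> orient x y z > 0)"

lemma circle_auto_mem: "circle_auto h \<Longrightarrow> x \<in> unit_circle \<Longrightarrow> h x \<in> unit_circle"
  unfolding circle_auto_def using bij_betwE by blast

lemma circle_auto_bij: "circle_auto h \<Longrightarrow> bij_betw h unit_circle unit_circle"
  unfolding circle_auto_def by blast

lemma circle_auto_eq_iff:
  "circle_auto h \<Longrightarrow> x \<in> unit_circle \<Longrightarrow> y \<in> unit_circle \<Longrightarrow> h x = h y \<longleftrightarrow> x = y"
  using circle_auto_bij bij_betw_imp_inj_on inj_on_eq_iff by metis

lemma circle_auto_comp: "circle_auto f \<Longrightarrow> circle_auto h \<Longrightarrow> circle_auto (f \<circ> h)"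
  using circle_auto_mem[of h] bij_betw_trans unfolding circle_auto_def by (simp add: o_def) blast

lemma circle_auto_arc:
  assumes h: "circle_auto h" and xy: "x \<in> unit_circle" "y \<in> unit_circle"
  shows "h ` open_arc x y = open_arc (h x) (h y)"
    and "h ` half_open_arc x y = half_open_arc (h x) (h y)"
    and "h ` closed_arc x y = closed_arc (h x) (h y)"
proof -
  have hxy: "h x \<in> unit_circle" "h y \<in> unit_circle"
    using circle_auto_mem[OF h] xy by auto
  show *: "h ` open_arc x y = open_arc (h x) (h y)"
  proof (intro equalityI subsetI)
    fix u assume "u \<in> h ` open_arc x y"
    then show "u \<in> open_arc (h x) (h y)"
      using h xy hxy unfolding circle_auto_def
      by (auto simp: open_arc_iff[OF xy] open_arc_iff[OF hxy] dest: bij_betwE)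
  next
    fix u assume u: "u \<in> open_arc (h x) (h y)"
    then obtain u' where u': "u' \<in> unit_circle" "u = h u'"
      using open_arc_iff[OF hxy] circle_auto_bij[OF h] unfolding bij_betw_def by blast
    have "orient x u' y > 0"
      using u h xy u' unfolding open_arc_iff[OF hxy] u'(2) circle_auto_def by blast
    then show "u \<in> h ` open_arc x y"
      using u' open_arc_iff[OF xy] by blast
  qed
  show "h ` half_open_arc x y = half_open_arc (h x) (h y)"
    unfolding half_open_arc_eq[OF xy] half_open_arc_eq[OF hxy] circle_auto_eq_iff[OF h xy] *[symmetric] by simp
  show "h ` closed_arc x y = closed_arc (h x) (h y)"
    unfolding closed_arc_eq[OF xy] closed_arc_eq[OF hxy] *[symmetric] by simp
qed

lemma circle_auto_mult:
  assumes "k \<in> unit_circle"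
  shows "circle_auto ((*) k)"
proof -
  have kk: "cnj k * k = 1"
    using assms complex_norm_square[of k] by (simp add: mult.commute)
  have "orient (k * x) (k * y) (k * z) = orient x y z" for x y z
  proof -
    have "cnj (k * a) * (k * b) = (cnj k * k) * (cnj a * b)" for a b
      by simp
    then show ?thesis
      unfolding orient_def by (simp only: kk mult_1)
  qed
  moreover have "bij_betw ((*) k) unit_circle unit_circle"
  proof (rule bij_betw_byWitness[where f' = "(*) (cnj k)"])
    show "\<forall>a\<in>unit_circle. cnj k * (k * a) = a" "\<forall>a\<in>unit_circle. k * (cnj k * a) = a"
      using kk by (simp_all add: mult.assoc[symmetric] mult.commute[of k])
  qed (use assms in \<open>auto simp: norm_mult\<close>)
  ultimately show ?thesis
    unfolding circle_auto_def by simp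
qed

section \<open>The action of disk isometries on the circle\<close>

text \<open>As the determinant is 1, the derivative of the map is the inverse square of this
  denominator; it measures the local scaling and, by its modulus, the isometric circle.\<close>

definition su11_denom :: "complex \<Rightarrow> complex \<Rightarrow> complex \<Rightarrow> complex" where
  "su11_denom \<alpha> \<beta> z = cnj \<beta> * z + cnj \<alpha>"

lemma su11_denom_nz:
  assumes "su11 \<alpha> \<beta>" "cmod z \<le> 1"
  shows "su11_denom \<alpha> \<beta> z \<noteq> 0"
proof
  assume "su11_denom \<alpha> \<beta> z = 0"
  then have "cnj \<alpha> = - (cnj \<beta> * z)"
    unfolding su11_denom_def using add_eq_0_iff by blast
  then have "cmod \<alpha> = cmod \<beta> * cmod z"
    by (metis complex_mod_cnj norm_minus_cancel norm_mult)
  then have "cmod \<alpha> \<le> cmod \<beta>"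
    using assms(2) by (simp add: mult_left_le)
  then have "(cmod \<alpha>)\<^sup>2 \<le> (cmod \<beta>)\<^sup>2"
    by (intro power_mono) auto
  then show False
    using assms(1) unfolding su11_def by linarith
qed

lemma su11_det: "su11 \<alpha> \<beta> \<Longrightarrow> \<alpha> * cnj \<alpha> - \<beta> * cnj \<beta> = 1"
  unfolding su11_def complex_norm_square[symmetric] by (metis of_real_1 of_real_diff)

text \<open>The numerators combine to the determinant times \<open>x - y\<close>. The formula serves
  twice: for the change of \<open>orient\<close>, and for distances to a fixed point on the
  circle.\<close>

lemma su11_map_diff:
  assumes "su11 \<alpha> \<beta>" "cmod x \<le> 1" "cmod y \<le> 1"
  shows "su11_map \<alpha> \<beta> x - su11_map \<alpha> \<beta> y = (x - y) / (su11_denom \<alpha> \<beta> x * su11_denom \<alpha> \<beta> y)"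
proof -
  have nz: "su11_denom \<alpha> \<beta> x \<noteq> 0" "su11_denom \<alpha> \<beta> y \<noteq> 0"
    using su11_denom_nz assms by auto
  have "(\<alpha> * x + \<beta>) * su11_denom \<alpha> \<beta> y - (\<alpha> * y + \<beta>) * su11_denom \<alpha> \<beta> x
      = (\<alpha> * cnj \<alpha> - \<beta> * cnj \<beta>) * (x - y)"
    unfolding su11_denom_def by (simp add: algebra_simps)
  then show ?thesis
    unfolding su11_map_def su11_denom_def[symmetric] su11_det[OF assms(1)]
    using nz by (simp add: diff_frac_eq)
qed

lemma unit_circle_cnj: "x \<in> unit_circle \<Longrightarrow> cnj x * x = 1"
  using complex_norm_square[of x] by (simp add: mult.commute)

text \<open>On the circle \<open>cnj x\<close> is the inverse of \<open>x\<close>, which makes the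
  numerator \<open>x\<close> times the conjugate of the denominator.\<close>

lemma su11_map_circle:
  assumes "su11 \<alpha> \<beta>" "x \<in> unit_circle"
  shows "su11_map \<alpha> \<beta> x = x * cnj (su11_denom \<alpha> \<beta> x) / su11_denom \<alpha> \<beta> x"
proof -
  have "x * cnj (su11_denom \<alpha> \<beta> x) = \<beta> * (cnj x * x) + \<alpha> * x"
    unfolding su11_denom_def by (simp add: algebra_simps)
  then show ?thesis
    unfolding unit_circle_cnj[OF assms(2)] by (simp add: su11_map_def su11_denom_def algebra_simps)
qed

lemma su11_map_unit_circle:
  assumes "su11 \<alpha> \<beta>" "x \<in> unit_circle"
  shows "su11_map \<alpha> \<beta> x \<in> unit_circle"
  using su11_map_circle[OF assms] su11_denom_nz[OF assms(1), of x] assms(2)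
  by (simp add: norm_mult norm_divide)

text \<open>Replacing conjugates by inverses turns the imaginary part into a rational function whose
  numerator is a product of differences, ready for \<open>su11_map_diff\<close>.\<close>

lemma orient_factor:
  assumes "x \<in> unit_circle" "y \<in> unit_circle" "z \<in> unit_circle"
  shows "2 * \<i> * of_real (orient x y z) = (y - x) * (z - y) * (x - z) / (x * y * z)"
proof -
  have nz: "x \<noteq> 0" "y \<noteq> 0" "z \<noteq> 0"
    using assms by auto
  have c: "cnj x = 1 / x" "cnj y = 1 / y" "cnj z = 1 / z"
    using unit_circle_cnj assms nz by (simp_all add: eq_divide_eq)
  let ?w = "cnj x * y + cnj y * z + cnj z * x"
  have "2 * \<i> * of_real (orient x y z) = ?w - cnj ?w"
    unfolding orient_def complex_diff_cnj by (simp only: of_real_mult of_real_numeral mult_ac)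
  also have "\<dots> = (y - x) * (z - y) * (x - z) / (x * y * z)"
    unfolding complex_cnj_add complex_cnj_mult complex_cnj_cnj c complex_cnj_divide complex_cnj_one
    using nz by (simp add: field_simps)
  finally show ?thesis .
qed

text \<open>Each denominator \<open>q\<close> occurs in two of the three differences, contributing
  \<open>1 / q^2\<close>, and in the image of one point, contributing \<open>cnj q / q\<close>. The
  quotient is \<open>1 / (q * cnj q)\<close>, a positive real.\<close>

lemma orient_su11_map:
  assumes "su11 \<alpha> \<beta>" "x \<in> unit_circle" "y \<in> unit_circle" "z \<in> unit_circle"
  shows "orient x y z = orient (su11_map \<alpha> \<beta> x) (su11_map \<alpha> \<beta> y) (su11_map \<alpha> \<beta> z)
      * (cmod (su11_denom \<alpha> \<beta> x * su11_denom \<alpha> \<beta> y * su11_denom \<alpha> \<beta> z))\<^sup>2"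
proof -
  let ?f = "su11_map \<alpha> \<beta>" and ?q = "su11_denom \<alpha> \<beta>"
  let ?Q = "?q x * ?q y * ?q z"
  have le: "cmod x \<le> 1" "cmod y \<le> 1" "cmod z \<le> 1"
    using assms by auto
  have xyz: "x \<noteq> 0" "y \<noteq> 0" "z \<noteq> 0"
    using assms by auto
  have nz: "?q x \<noteq> 0" "?q y \<noteq> 0" "?q z \<noteq> 0"
    using su11_denom_nz assms le by auto
  have "2 * \<i> * of_real (orient (?f x) (?f y) (?f z))
      = (?f y - ?f x) * (?f z - ?f y) * (?f x - ?f z) / (?f x * ?f y * ?f z)"
    using assms by (intro orient_factor su11_map_unit_circle)
  also have "\<dots> = (y - x) * (z - y) * (x - z) / (x * y * z) / (?Q * cnj ?Q)"
    unfolding su11_map_diff[OF assms(1) le(2) le(1)] su11_map_diff[OF assms(1) le(3) le(2)]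
      su11_map_diff[OF assms(1) le(1) le(3)]
    unfolding su11_map_circle[OF assms(1,2)] su11_map_circle[OF assms(1,3)] su11_map_circle[OF assms(1,4)]
    using nz xyz by (simp add: field_simps)
  also have "?Q * cnj ?Q = of_real ((cmod ?Q)\<^sup>2)"
    by (rule complex_norm_square[symmetric])
  also have "(y - x) * (z - y) * (x - z) / (x * y * z) = 2 * \<i> * of_real (orient x y z)"
    using orient_factor assms by simp
  finally have "2 * \<i> * of_real (orient (?f x) (?f y) (?f z)) = 2 * \<i> * of_real (orient x y z / (cmod ?Q)\<^sup>2)"
    unfolding of_real_divide times_divide_eq_right .
  then have "complex_of_real (orient (?f x) (?f y) (?f z)) = of_real (orient x y z / (cmod ?Q)\<^sup>2)"
    unfolding mult_cancel_left by simp
  then have "orient (?f x) (?f y) (?f z) = orient x y z / (cmod ?Q)\<^sup>2"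
    by (simp only: of_real_eq_iff)
  then show ?thesis
    using nz by simp
qed

lemma su11_map_inverse:
  assumes "su11 \<alpha> \<beta>" "cmod z \<le> 1"
  shows "su11_map (cnj \<alpha>) (- \<beta>) (su11_map \<alpha> \<beta> z) = z"
proof -
  let ?q = "su11_denom \<alpha> \<beta> z"
  have nz: "?q \<noteq> 0"
    using su11_denom_nz assms by auto
  have f: "su11_map \<alpha> \<beta> z = (\<alpha> * z + \<beta>) / ?q"
    by (simp add: su11_map_def su11_denom_def)
  have "cnj \<alpha> * (\<alpha> * z + \<beta>) - \<beta> * ?q = (\<alpha> * cnj \<alpha> - \<beta> * cnj \<beta>) * z"
    unfolding su11_denom_def by (simp add: algebra_simps)
  then have 1: "cnj \<alpha> * ((\<alpha> * z + \<beta>) / ?q) + - \<beta> = z / ?q"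
    unfolding su11_det[OF assms(1)] using nz by (simp add: divide_simps)
  have "\<alpha> * ?q - cnj \<beta> * (\<alpha> * z + \<beta>) = \<alpha> * cnj \<alpha> - \<beta> * cnj \<beta>"
    unfolding su11_denom_def by (simp add: algebra_simps)
  then have 2: "cnj (- \<beta>) * ((\<alpha> * z + \<beta>) / ?q) + cnj (cnj \<alpha>) = 1 / ?q"
    unfolding su11_det[OF assms(1)] using nz by (simp add: divide_simps mult.commute)
  show ?thesis
    unfolding f su11_map_def[of "cnj \<alpha>"] 1 2 using nz by simp
qed

lemma su11_inverse: "su11 \<alpha> \<beta> \<Longrightarrow> su11 (cnj \<alpha>) (- \<beta>)"
  by (simp add: su11_def)

lemma circle_auto_disk_isometry:
  assumes "disk_isometry f"
  shows "circle_auto f"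
proof -
  obtain \<alpha> \<beta> where *: "su11 \<alpha> \<beta>" "f = su11_map \<alpha> \<beta>"
    using assms unfolding disk_isometry_def by blast
  have "bij_betw f unit_circle unit_circle"
  proof (rule bij_betw_byWitness[where f' = "su11_map (cnj \<alpha>) (- \<beta>)"])
    show "\<forall>a\<in>unit_circle. su11_map (cnj \<alpha>) (- \<beta>) (f a) = a"
      using su11_map_inverse[OF *(1)] *(2) by auto
    show "\<forall>a\<in>unit_circle. f (su11_map (cnj \<alpha>) (- \<beta>) a) = a"
      using su11_map_inverse[OF su11_inverse[OF *(1)]] *(2) by auto
  qed (use * su11_map_unit_circle su11_inverse in \<open>auto simp del: mem_sphere_0\<close>)
  moreover have "orient (f x) (f y) (f z) > 0 \<longleftrightarrow> orient x y z > 0"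
    if "x \<in> unit_circle" "y \<in> unit_circle" "z \<in> unit_circle" for x y z
  proof -
    have "cmod (su11_denom \<alpha> \<beta> x * su11_denom \<alpha> \<beta> y * su11_denom \<alpha> \<beta> z) \<noteq> 0"
      using that su11_denom_nz[OF *(1)] by auto
    then show ?thesis
      unfolding orient_su11_map[OF *(1) that] *(2) by (simp add: zero_less_mult_iff)
  qed
  ultimately show ?thesis
    unfolding circle_auto_def by blast
qed

section \<open>Bijectivity from a sector decomposition\<close>

text \<open>A sector \<open>S\<close> carries the pairs \<open>(u, w)\<close> with \<open>w \<in> S\<close>. The map moves the part with \<open>u \<notin> S\<close> onto
  the part of the image with \<open>w \<notin> S\<close>, \<open>u \<in> S\<close>. Over all sectors, either part is the set of
  pairs lying in different sectors, so domain and image agree.\<close>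

definition sector_bij ::
  "'a set \<Rightarrow> 'a set \<Rightarrow> ('a \<times> 'a \<Rightarrow> 'a \<times> 'a) \<Rightarrow> ('a \<times> 'a) set \<Rightarrow> bool" where
  "sector_bij C S F D \<longleftrightarrow> (C - S) \<times> S \<subseteq> D \<and> D \<subseteq> C \<times> S
     \<and> bij_betw F D (S \<times> (C - S) \<union> D \<inter> S \<times> S)"

lemma bij_betw_Union_sectors:
  assumes disj: "disjoint_family_on S I" and C: "(\<Union>n\<in>I. S n) = C"
    and sec: "\<And>n. n \<in> I \<Longrightarrow> sector_bij C (S n) F (D n)"
  shows "bij_betw F (\<Union>n\<in>I. D n) (\<Union>n\<in>I. D n)"
proof -
  let ?E = "\<lambda>n. S n \<times> (C - S n) \<union> D n \<inter> S n \<times> S n"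
  have D: "D n = (C - S n) \<times> S n \<union> D n \<inter> S n \<times> S n" if "n \<in> I" for n
    using sec[OF that] unfolding sector_bij_def by blast
  \<comment> \<open>All first coordinates of \<open>?E n\<close> lie in \<open>S n\<close>. Disjoint
    images are what makes the union of the bijections injective.\<close>
  have "disjoint_family_on ?E I"
    using disj unfolding disjoint_family_on_def by blast
  then have bij: "bij_betw F (\<Union>n\<in>I. D n) (\<Union>n\<in>I. ?E n)"
    by (rule bij_betw_UNION_disjoint) (use sec in \<open>simp add: sector_bij_def\<close>)
  have "(\<Union>n\<in>I. S n \<times> (C - S n)) = (\<Union>n\<in>I. (C - S n) \<times> S n)"
  proof -
    have "i = j" if "i \<in> I" "j \<in> I" "x \<in> S i" "x \<in> S j" for i j x
      using disj that unfolding disjoint_family_on_def by blast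
    then show ?thesis
      unfolding C[symmetric] by auto
  qed
  then have "(\<Union>n\<in>I. ?E n) = (\<Union>n\<in>I. (C - S n) \<times> S n \<union> D n \<inter> S n \<times> S n)"
    unfolding UN_Un_distrib by simp
  also have "\<dots> = (\<Union>n\<in>I. D n)"
    using D by simp
  finally show ?thesis
    using bij by simp
qed

text \<open>As \<open>c i\<close> permutes \<open>C\<close>, it takes the complement of
  \<open>B i\<close> onto \<open>B (\<sigma> i)\<close>. So the rectangle of index \<open>i\<close>
  lands on that of index \<open>\<sigma> i\<close> with its two factors exchanged, and reindexing
  along \<open>\<sigma>\<close> gives the whole image.\<close>

lemma sector_bij_pairing:
  assumes disj: "disjoint_family_on B I" and C: "\<And>i. i \<in> I \<Longrightarrow> B i \<subseteq> C"
    and \<sigma>: "bij_betw \<sigma> I I"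
    and bij: "\<And>i. i \<in> I \<Longrightarrow> bij_betw (c i) C C"
    and pair: "\<And>i. i \<in> I \<Longrightarrow> c i ` B i = C - B (\<sigma> i)"
    and F: "\<And>i u w. i \<in> I \<Longrightarrow> w \<in> B i \<Longrightarrow> F (u, w) = (c i u, c i w)"
  shows "sector_bij C (\<Union>i\<in>I. B i) F (\<Union>i\<in>I. (C - B i) \<times> B i)"
proof -
  let ?S = "\<Union>i\<in>I. B i"
  have \<sigma>I: "\<sigma> i \<in> I" if "i \<in> I" for i
    using \<sigma> that bij_betwE by blast
  have *: "bij_betw F ((C - B i) \<times> B i) (B (\<sigma> i) \<times> (C - B (\<sigma> i)))" if i: "i \<in> I" for i
  proof -
    have inj: "inj_on (c i) C" and surj: "c i ` C = C"
      using bij[OF i] unfolding bij_betw_def by auto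
    have "c i ` (C - B i) = B (\<sigma> i)"
      using inj_on_image_set_diff[OF inj, of C "B i"] C[OF i] C[OF \<sigma>I[OF i]] pair[OF i] surj by auto
    then have "bij_betw (c i) (C - B i) (B (\<sigma> i))" "bij_betw (c i) (B i) (C - B (\<sigma> i))"
      using pair[OF i] inj C[OF i] unfolding bij_betw_def by (auto intro: inj_on_subset)
    then have "bij_betw (map_prod (c i) (c i)) ((C - B i) \<times> B i) (B (\<sigma> i) \<times> (C - B (\<sigma> i)))"
      by (rule bij_betw_map_prod)
    then show ?thesis
      by (rule bij_betw_cong[THEN iffD1, rotated]) (use F[OF i] in auto)
  qed
  have "disjoint_family_on (\<lambda>i. B (\<sigma> i) \<times> (C - B (\<sigma> i))) I"
    unfolding disjoint_family_on_def
  proof (intro ballI impI)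
    fix i j assume "i \<in> I" "j \<in> I" "i \<noteq> j"
    then have "\<sigma> i \<noteq> \<sigma> j"
      using bij_betw_imp_inj_on[OF \<sigma>] inj_on_eq_iff by metis
    then have "B (\<sigma> i) \<inter> B (\<sigma> j) = {}"
      using disj \<sigma>I \<open>i \<in> I\<close> \<open>j \<in> I\<close> unfolding disjoint_family_on_def by metis
    then show "B (\<sigma> i) \<times> (C - B (\<sigma> i)) \<inter> B (\<sigma> j) \<times> (C - B (\<sigma> j)) = {}"
      by blast
  qed
  then have "bij_betw F (\<Union>i\<in>I. (C - B i) \<times> B i) (\<Union>i\<in>I. B (\<sigma> i) \<times> (C - B (\<sigma> i)))"
    by (rule bij_betw_UNION_disjoint) (rule *)
  also have "(\<Union>i\<in>I. B (\<sigma> i) \<times> (C - B (\<sigma> i))) = (\<Union>i\<in>\<sigma> ` I. B i \<times> (C - B i))"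
    by simp
  also have "\<sigma> ` I = I"
    using \<sigma> by (rule bij_betw_imp_surj_on)
  \<comment> \<open>The products \<open>B i \<times> B j\<close> with \<open>i \<noteq> j\<close>
    lie in both unions; the remaining pairs on the left have their second coordinate outside
    \<open>?S\<close>.\<close>
  also have "(\<Union>i\<in>I. B i \<times> (C - B i)) = ?S \<times> (C - ?S) \<union> (\<Union>i\<in>I. (C - B i) \<times> B i) \<inter> ?S \<times> ?S"
  proof -
    have "i = j" if "i \<in> I" "j \<in> I" "x \<in> B i" "x \<in> B j" for i j x
      using disj that unfolding disjoint_family_on_def by blast
    then show ?thesis
      using C by auto (metis subsetD)+
  qed
  finally have "bij_betw F (\<Union>i\<in>I. (C - B i) \<times> B i)
      (?S \<times> (C - ?S) \<union> (\<Union>i\<in>I. (C - B i) \<times> B i) \<inter> ?S \<times> ?S)" .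
  moreover have "(C - ?S) \<times> ?S \<subseteq> (\<Union>i\<in>I. (C - B i) \<times> B i)" "(\<Union>i\<in>I. (C - B i) \<times> B i) \<subseteq> C \<times> ?S"
    by auto
  ultimately show ?thesis
    unfolding sector_bij_def by simp
qed

text \<open>The circle is cut at a point and measured by \<open>[0, m)\<close>, so that a rotation by \<open>2\<pi>/m\<close> becomes a unit
  shift.\<close>

definition shift_down :: "real \<Rightarrow> real \<Rightarrow> real" where
  "shift_down m s = (if s < 1 then s - 1 + m else s - 1)"

definition shift_up :: "real \<Rightarrow> real \<Rightarrow> real" where
  "shift_up m s = (if s < m - 1 then s + 1 else s + 1 - m)"

text \<open>With \<open>k\<close> the floor of \<open>t - \<alpha>\<close>, the fibre
  \<open>[k, 0)\<close> of a negative \<open>k\<close> is represented in \<open>[0, m)\<close> by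
  \<open>[m + k, m)\<close>, and the fibre \<open>[-1, k)\<close> of the other \<open>k\<close> by
  \<open>[0, k)\<close> together with \<open>[m - 1, m)\<close>.\<close>

definition elliptic_region :: "nat \<Rightarrow> real \<Rightarrow> (real \<times> real) set" where
  "elliptic_region m \<alpha> = {(s, t). 0 \<le> s \<and> s < m \<and> 0 \<le> t \<and> t < real m - 1
     \<and> (if t < \<alpha> then real m + \<lfloor>t - \<alpha>\<rfloor> \<le> s else s < \<lfloor>t - \<alpha>\<rfloor> \<or> real m - 1 \<le> s)}"

lemma sector_bij_shift:
  fixes m :: nat and \<alpha> :: real
  assumes m: "m \<ge> 2" and \<alpha>: "0 < \<alpha>" "\<alpha> < real m - 1"
  defines "G \<equiv> \<lambda>(s, t). if t < \<alpha> then (shift_down m s, shift_down m t) else (shift_up m s, shift_up m t)"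
  shows "sector_bij {0..<real m} {0..<real m - 1} G (elliptic_region m \<alpha>)"
proof -
  define Q where "Q = {0..<real m - 1} \<times> {real m - 1..<real m} \<union> elliptic_region m \<alpha> \<inter> {0..<real m - 1} \<times> {0..<real m - 1}"
  \<comment> \<open>\<open>up\<close> recognises the images of the downward shift. Below
    \<open>m - 1\<close> the comparison of \<open>t\<close> with \<open>\<alpha>\<close> settles the
    matter. Both shifts can land at \<open>t \<ge> m - 1\<close>; there the downward one gives
    \<open>s\<close> at least the floor of \<open>t - \<alpha>\<close> and the upward one gives
    \<open>s\<close> below it.\<close>
  define up where "up = (\<lambda>s t. real m - 1 \<le> t \<and> t < real m - 1 + \<alpha> \<and> real_of_int \<lfloor>t - \<alpha>\<rfloor> \<le> s \<or> t < \<alpha>)"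
  define G' where "G' = (\<lambda>(s, t). if up s t then (shift_up m s, shift_up m t) else (shift_down m s, shift_down m t))"
  have flm: "\<lfloor>t - 1 - \<alpha>\<rfloor> = \<lfloor>t - \<alpha>\<rfloor> - 1" "\<lfloor>t + 1 - \<alpha>\<rfloor> = \<lfloor>t - \<alpha>\<rfloor> + 1"
    "\<lfloor>t - 1 + real m - \<alpha>\<rfloor> = \<lfloor>t - \<alpha>\<rfloor> - 1 + int m" "\<lfloor>t + 1 - real m - \<alpha>\<rfloor> = \<lfloor>t - \<alpha>\<rfloor> + 1 - int m" for t
    by linarith+
  have bnd: "of_int \<lfloor>t - \<alpha>\<rfloor> \<le> t - \<alpha>" "t - \<alpha> < of_int \<lfloor>t - \<alpha>\<rfloor> + 1" for t
    by linarith+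
  have Qmem: "(s, t) \<in> Q \<longleftrightarrow> 0 \<le> s \<and> s < real m - 1 \<and> 0 \<le> t \<and> t < real m \<and>
      (t < real m - 1 \<longrightarrow> (if t < \<alpha> then real m + \<lfloor>t - \<alpha>\<rfloor> \<le> s else s < \<lfloor>t - \<alpha>\<rfloor>))" for s t :: real
    unfolding Q_def elliptic_region_def by auto
  have 1: "G p \<in> Q \<and> G' (G p) = p" if p: "p \<in> elliptic_region m \<alpha>" for p
  proof -
    obtain s t where st: "p = (s, t)" by force
    have r: "0 \<le> s" "s < real m" "0 \<le> t" "t < real m - 1"
      using p unfolding st elliptic_region_def by auto
    note b = bnd[of t]
    show ?thesis
    proof (cases "t < \<alpha>")
      case True
      have "real_of_int (int m + \<lfloor>t - \<alpha>\<rfloor>) > 0"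
        unfolding of_int_add of_int_of_nat_eq using r b \<alpha> by linarith
      then have "1 \<le> int m + \<lfloor>t - \<alpha>\<rfloor>"
        by linarith
      then have k: "1 \<le> real m + \<lfloor>t - \<alpha>\<rfloor>"
        by linarith
      have s: "real m + \<lfloor>t - \<alpha>\<rfloor> \<le> s"
        using p True unfolding st elliptic_region_def by auto
      have G: "G p = (s - 1, shift_down m t)"
        unfolding st G_def shift_down_def using True s k by simp
      have "up (s - 1) (shift_down m t)" "shift_up m (shift_down m t) = t"
        unfolding up_def shift_down_def shift_up_def using True r s \<alpha> by (auto simp: flm)
      moreover have "(s - 1, shift_down m t) \<in> Q"
        unfolding Qmem shift_down_def using True r s k \<alpha> by (auto simp: flm)
      ultimately show ?thesis
        unfolding G unfolding G'_def st shift_up_def using r by simp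
    next
      case False
      have s: "s < \<lfloor>t - \<alpha>\<rfloor> \<or> real m - 1 \<le> s"
        using p False unfolding st elliptic_region_def by auto
      have "\<lfloor>t - \<alpha>\<rfloor> < int m - 1"
        using b r \<alpha> by linarith
      then have k: "\<lfloor>t - \<alpha>\<rfloor> \<le> real m - 2"
        by linarith
      have k0: "0 \<le> real_of_int \<lfloor>t - \<alpha>\<rfloor>"
        using False by simp
      have G: "G p = (shift_up m s, t + 1)"
        unfolding st G_def shift_up_def using False r by simp
      have l: "shift_up m s < \<lfloor>t - \<alpha>\<rfloor> + 1"
        unfolding shift_up_def using s k k0 r
        by (cases "s < real m - 1"; simp only: if_True if_False) linarith+
      then have "\<not> up (shift_up m s) (t + 1)"
        unfolding up_def using False by (auto simp: flm)
      moreover have "shift_down m (shift_up m s) = s" "shift_down m (t + 1) = t"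
        unfolding shift_down_def shift_up_def using r by auto
      moreover have "(shift_up m s, t + 1) \<in> Q"
        using False r l k unfolding Qmem by (auto simp: flm shift_up_def)
      ultimately show ?thesis
        unfolding G unfolding G'_def st by simp
    qed
  qed
  have 2: "G' p \<in> elliptic_region m \<alpha> \<and> G (G' p) = p" if p: "p \<in> Q" for p
  proof -
    obtain s t where st: "p = (s, t)" by force
    have r: "0 \<le> s" "s < real m - 1" "0 \<le> t" "t < real m"
      and s: "t < real m - 1 \<Longrightarrow> if t < \<alpha> then real m + \<lfloor>t - \<alpha>\<rfloor> \<le> s else s < \<lfloor>t - \<alpha>\<rfloor>"
      using p unfolding st Qmem by auto
    note b = bnd[of t]
    show ?thesis
    proof (cases "up s t")
      case True
      have G': "G' p = (s + 1, shift_up m t)"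
        unfolding st G'_def using True r by (simp add: shift_up_def)
      have t: "shift_up m t < \<alpha>"
      proof (cases "t < real m - 1")
        case True': True
        then have "t < \<alpha>"
          using True unfolding up_def by auto
        then have "real m + \<lfloor>t - \<alpha>\<rfloor> < real m - 1"
          using s True' r by simp
        then have "real_of_int \<lfloor>t - \<alpha>\<rfloor> < - 1"
          by simp
        then have "\<lfloor>t - \<alpha>\<rfloor> \<le> - 2"
          by linarith
        then show ?thesis
          using b True' unfolding shift_up_def by simp
      next
        case False
        then show ?thesis
          using True \<alpha> unfolding shift_up_def up_def by auto
      qed
      have "real m + \<lfloor>shift_up m t - \<alpha>\<rfloor> \<le> s + 1"
        using True s \<alpha> unfolding up_def shift_up_def by (auto simp: flm)
      then have "G' p \<in> elliptic_region m \<alpha>"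
        unfolding G' elliptic_region_def using r t \<alpha> by (auto simp: shift_up_def)
      then show ?thesis
        using t r unfolding G' by (auto simp: G_def st shift_down_def shift_up_def)
    next
      case False
      have k: "s < \<lfloor>t - \<alpha>\<rfloor>" "\<alpha> \<le> t"
      proof -
        have "s < \<lfloor>t - \<alpha>\<rfloor>" if *: "real m - 1 + \<alpha> \<le> t"
        proof -
          have "int m - 1 \<le> \<lfloor>t - \<alpha>\<rfloor>"
            using * by linarith
          then show ?thesis
            using r by linarith
        qed
        then show "s < \<lfloor>t - \<alpha>\<rfloor>" "\<alpha> \<le> t"
          using False s unfolding up_def by fastforce+
      qed
      \<comment> \<open>This integer exceeds \<open>s \<ge> 0\<close>, so it is at least 1. Hence
        \<open>t - 1\<close> is still at or above \<open>\<alpha>\<close>, in the branch where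
        \<open>G\<close> shifts up.\<close>
      then have "0 < \<lfloor>t - \<alpha>\<rfloor>"
        using r by linarith
      then have t1: "\<alpha> + 1 \<le> t"
        using b by linarith
      have G': "G' p = (shift_down m s, t - 1)"
        unfolding st G'_def shift_down_def using False t1 \<alpha> by simp
      have "G' p \<in> elliptic_region m \<alpha>"
        unfolding G' elliptic_region_def shift_down_def using r t1 k \<alpha> by (auto simp: flm)
      then show ?thesis
        using t1 r unfolding G' by (auto simp: G_def st shift_down_def shift_up_def)
    qed
  qed
  have "bij_betw G (elliptic_region m \<alpha>) Q"
    by (rule bij_betw_byWitness[where f' = G']) (use 1 2 in auto)
  moreover have "{0..<real m} - {0..<real m - 1} = {real m - 1..<real m}"
    using m by auto
  \<comment> \<open>This places \<open>(C - S) \<times> S\<close> in the region: over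
    \<open>t < \<alpha>\<close> the fibre begins at or before \<open>m - 1\<close>.\<close>
  moreover have "of_int \<lfloor>t - \<alpha>\<rfloor> + real m \<le> real m - 1" if "t < \<alpha>" for t
  proof -
    have "\<lfloor>t - \<alpha>\<rfloor> < 0"
      using that by simp
    then show ?thesis
      by linarith
  qed
  ultimately show ?thesis
    unfolding sector_bij_def Q_def elliptic_region_def by (fastforce simp: add.commute)
qed

text \<open>The conjugacy is asked on \<open>D\<close> only: its second coordinates stay in the
  sector, where the partition point decides which side map acts.\<close>

lemma sector_bij_transfer:
  assumes sec: "sector_bij C S G D" and \<phi>: "bij_betw \<phi> C C'" and S: "S \<subseteq> C"
    and F: "\<And>p. p \<in> D \<Longrightarrow> F (map_prod \<phi> \<phi> p) = map_prod \<phi> \<phi> (G p)"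
  shows "sector_bij C' (\<phi> ` S) F (map_prod \<phi> \<phi> ` D)"
proof -
  let ?\<Phi> = "map_prod \<phi> \<phi>" and ?E = "S \<times> (C - S) \<union> D \<inter> S \<times> S"
  have D: "(C - S) \<times> S \<subseteq> D" "D \<subseteq> C \<times> S" and G: "bij_betw G D ?E"
    using sec unfolding sector_bij_def by auto
  have inj: "inj_on \<phi> C" and C': "\<phi> ` C = C'"
    using \<phi> unfolding bij_betw_def by auto
  have inj2: "inj_on ?\<Phi> (C \<times> C)"
    using inj inj by (rule map_prod_inj_on)
  have diff: "\<phi> ` (C - S) = C' - \<phi> ` S"
    using inj_on_image_set_diff[OF inj, of C S] S C' by auto
  have img: "?\<Phi> ` (A \<times> B) = \<phi> ` A \<times> \<phi> ` B" for A B
    by (rule map_prod_surj_on) auto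
  have sub: "D \<subseteq> C \<times> C" "?E \<subseteq> C \<times> C" "S \<times> S \<subseteq> C \<times> C"
    using D S by auto
  have E: "?\<Phi> ` ?E = \<phi> ` S \<times> (C' - \<phi> ` S) \<union> ?\<Phi> ` D \<inter> \<phi> ` S \<times> \<phi> ` S"
    unfolding image_Un inj_on_image_Int[OF inj2 sub(1) sub(3)] img diff by simp
  have "bij_betw (?\<Phi> \<circ> G) D (?\<Phi> ` ?E)"
    using G by (rule bij_betw_trans) (use inj2 sub(2) in \<open>auto simp: bij_betw_def intro: inj_on_subset\<close>)
  then have "bij_betw (F \<circ> ?\<Phi>) D (?\<Phi> ` ?E)"
    by (rule bij_betw_cong[THEN iffD1, rotated]) (simp add: F)
  moreover have "bij_betw ?\<Phi> D (?\<Phi> ` D)"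
    using inj2 sub(1) by (auto simp: bij_betw_def intro: inj_on_subset)
  ultimately have "bij_betw F (?\<Phi> ` D) (?\<Phi> ` ?E)"
    using bij_betw_comp_iff by blast
  moreover have "?\<Phi> ` ((C - S) \<times> S) \<subseteq> ?\<Phi> ` D" "?\<Phi> ` D \<subseteq> ?\<Phi> ` (C \<times> S)"
    using D by (intro image_mono; simp)+
  ultimately show ?thesis
    unfolding sector_bij_def E img diff C' by blast
qed

section \<open>Unions of rectangles\<close>

text \<open>A quadruple \<open>(x, y, z, w)\<close> encodes the rectangle with sides the arcs from \<open>x\<close> to \<open>y\<close> and from \<open>z\<close>
  to \<open>w\<close>, whichever kind of arc is used.\<close>

definition rect_union ::
  "(complex \<Rightarrow> complex \<Rightarrow> complex set) \<Rightarrow> (complex \<times> complex \<times> complex \<times> complex) set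
     \<Rightarrow> (complex \<times> complex) set" where
  "rect_union ar Q = (\<Union>(x, y, z, w)\<in>Q. ar x y \<times> ar z w)"

definition square_rects :: "nat \<Rightarrow> (complex \<times> complex \<times> complex \<times> complex) set" where
  "square_rects l = (let v = vpow l in
     {(v (1/2), 1, 1, v (1/2)), (v 1, v (1/2), v (1/2), v 1),
      (v (3/2), v 1, v 1, v (3/2)), (v 2, v (3/2), v (3/2), v 2)})"

definition two_rects :: "nat \<Rightarrow> (complex \<times> complex \<times> complex \<times> complex) set" where
  "two_rects l = {(vpow l 2, 1, 1, vpow l 2)}"

definition cusp_rects :: "nat \<Rightarrow> (complex \<times> complex \<times> complex \<times> complex) set" where
  "cusp_rects l = {(vpow l 1, 1, 1, vpow l 1), (vpow l 2, vpow l 1, vpow l 1, vpow l 2)}"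

definition elliptic_rects ::
  "nat \<Rightarrow> nat \<Rightarrow> (complex \<Rightarrow> complex) \<Rightarrow> complex \<Rightarrow> (complex \<times> complex \<times> complex \<times> complex) set" where
  "elliptic_rects l m c a =
    (let it = circle_iterate c; v2 = vpow l 2; I = index_I c l m a; J = index_J c l a in
       (\<lambda>i. if i \<le> I then (v2, it (1 - i) 1, it (1 - i) a, it (- i) a)
            else (v2, it (- I) 1, it (- I) a, v2)) ` {1..I + 1}
     \<union> (\<lambda>j. if j \<le> J then (it (j - 1) v2, 1, it j a, it (j - 1) a)
            else (it J v2, 1, 1, it J a)) ` {1..J + 1})"

lemma Omega_square_rects: "Omega_square ar l = rect_union ar (square_rects l)"
  unfolding Omega_square_def square_rects_def rect_union_def Let_def by auto

lemma Omega_two_rects: "Omega_two ar l = rect_union ar (two_rects l)"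
  unfolding Omega_two_def two_rects_def rect_union_def by auto

lemma Omega_cusp_rects: "Omega_cusp ar l = rect_union ar (cusp_rects l)"
  unfolding Omega_cusp_def cusp_rects_def rect_union_def Let_def by auto

lemma Omega_elliptic_rects: "Omega_elliptic ar l m c a = rect_union ar (elliptic_rects l m c a)"
  unfolding Omega_elliptic_def elliptic_rects_def rect_union_def Let_def UN_Un image_image
  by (intro arg_cong2[where f = "(\<union>)"] SUP_cong refl) auto

section \<open>Elliptic sectors\<close>

text \<open>The circle is parametrised by \<open>\<phi>\<close> with period \<open>m\<close> in such a way that \<open>c\<close> becomes \<open>s \<mapsto> s - 1\<close>. Then
  \<open>1\<close>, \<open>v\<^sup>2\<close> and \<open>a\<close> have the parameters \<open>0\<close>, \<open>m - 1\<close> and \<open>\<alpha>\<close>.\<close>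

locale circle_rotation =
  fixes h c :: "complex \<Rightarrow> complex" and m l :: nat and \<phi> :: "real \<Rightarrow> complex"
  assumes h: "circle_auto h" and m: "m \<ge> 2"
    and \<phi>_def: "\<And>s. \<phi> s = h (cis (2 * pi / m * s))"
    and c: "\<And>s::real. c (\<phi> s) = \<phi> (s - 1)"
    and one: "\<phi> 0 = 1" and v2: "\<phi> (- 1) = vpow l 2"
begin

lemma \<phi>_in: "\<phi> s \<in> unit_circle"
  unfolding \<phi>_def by (intro circle_auto_mem[OF h] cis_in_unit_circle)

lemma norm_\<phi> [simp]: "cmod (\<phi> s) = 1"
  using \<phi>_in by simp

lemma \<phi>_period: "\<phi> (s + m * of_int k) = \<phi> s" for s :: real
proof -
  have "2 * pi / m * (s + m * of_int k) = 2 * pi / m * s + 2 * pi * of_int k"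
    using m by (simp add: field_simps)
  then show ?thesis
    unfolding \<phi>_def by (simp flip: cis_mult)
qed

lemma scale:
  fixes x y :: real
  shows "x < y \<Longrightarrow> 2 * pi / m * x < 2 * pi / m * y" "x \<le> y \<Longrightarrow> 2 * pi / m * x \<le> 2 * pi / m * y"
    "y < x + m \<Longrightarrow> 2 * pi / m * y < 2 * pi / m * x + 2 * pi"
proof -
  have k: "0 < 2 * pi / m"
    using m by simp
  show "x < y \<Longrightarrow> 2 * pi / m * x < 2 * pi / m * y" "x \<le> y \<Longrightarrow> 2 * pi / m * x \<le> 2 * pi / m * y"
    using k by (simp_all only: mult_less_cancel_left_pos mult_le_cancel_left_pos)
  assume "y < x + m"
  then have "2 * pi / m * y < 2 * pi / m * (x + m)"
    using k by (simp only: mult_less_cancel_left_pos)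
  also have "\<dots> = 2 * pi / m * x + 2 * pi"
    using m by (simp add: distrib_left)
  finally show "2 * pi / m * y < 2 * pi / m * x + 2 * pi" .
qed

lemma \<phi>_inj:
  fixes s t :: real
  assumes "\<phi> s = \<phi> t" "s < t + m" "t < s + m"
  shows "s = t"
proof -
  have "cis (2 * pi / m * s) = cis (2 * pi / m * t)"
    using assms(1) unfolding \<phi>_def circle_auto_eq_iff[OF h cis_in_unit_circle cis_in_unit_circle] .
  moreover have "2 * pi / m * x < 2 * pi / m * y" "2 * pi / m * y < 2 * pi / m * x + 2 * pi"
    if "x < y" "y < x + m" for x y :: real
    using scale(1)[of x y] scale(3)[of y x] that by auto
  ultimately show ?thesis
    using assms cis_distinct[of "2 * pi / m * s" "2 * pi / m * t"] cis_distinct[of "2 * pi / m * t" "2 * pi / m * s"]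
    by (cases s t rule: linorder_cases) auto
qed

lemma arc_\<phi>:
  fixes s t :: real
  assumes "s \<le> t" "t < s + m"
  shows half_open_arc_\<phi>: "half_open_arc (\<phi> s) (\<phi> t) = \<phi> ` {s..<t}"
    and open_arc_\<phi>: "open_arc (\<phi> s) (\<phi> t) = \<phi> ` {s<..<t}"
proof -
  let ?k = "2 * pi / m"
  have *: "?k * s \<le> ?k * t" "?k * t < ?k * s + 2 * pi"
    using assms scale by auto
  have k: "0 < ?k"
    using m by simp
  have "h ` cis ` {?k * s..<?k * t} = \<phi> ` {s..<t}"
  proof -
    have "(\<lambda>x. ?k * x) ` {s..<t} = {?k * s..<?k * t}"
    proof (intro equalityI subsetI)
      fix x assume "x \<in> {?k * s..<?k * t}"
      then show "x \<in> (\<lambda>x. ?k * x) ` {s..<t}"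
        using k m by (intro image_eqI[of _ _ "x / ?k"]) (auto simp: field_simps)
    qed (use scale in auto)
    then have "h ` cis ` {?k * s..<?k * t} = h ` cis ` (\<lambda>x. ?k * x) ` {s..<t}"
      by (simp only:)
    also have "\<dots> = \<phi> ` {s..<t}"
      by (simp only: image_image \<phi>_def[abs_def])
    finally show ?thesis .
  qed
  then show "half_open_arc (\<phi> s) (\<phi> t) = \<phi> ` {s..<t}"
    unfolding \<phi>_def[of s] \<phi>_def[of t] half_open_arc_cis[OF *, symmetric] circle_auto_arc(2)[OF h cis_in_unit_circle cis_in_unit_circle] .
  have "(\<lambda>x. ?k * x) ` {s<..<t} = {?k * s<..<?k * t}"
  proof (intro equalityI subsetI)
    fix x assume "x \<in> {?k * s<..<?k * t}"
    then show "x \<in> (\<lambda>x. ?k * x) ` {s<..<t}"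
      using k m by (intro image_eqI[of _ _ "x / ?k"]) (auto simp: field_simps)
  qed (use scale in auto)
  then have "h ` cis ` {?k * s<..<?k * t} = h ` cis ` (\<lambda>x. ?k * x) ` {s<..<t}"
    by (simp only:)
  also have "\<dots> = \<phi> ` {s<..<t}"
    by (simp only: image_image \<phi>_def[abs_def])
  finally have "h ` cis ` {?k * s<..<?k * t} = \<phi> ` {s<..<t}" .
  then show "open_arc (\<phi> s) (\<phi> t) = \<phi> ` {s<..<t}"
    unfolding \<phi>_def[of s] \<phi>_def[of t] open_arc_cis[OF *, symmetric] circle_auto_arc(1)[OF h cis_in_unit_circle cis_in_unit_circle] .
qed

lemma v2': "\<phi> (real m - 1) = vpow l 2"
  using \<phi>_period[of "- 1" 1] v2 by (simp add: add.commute)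

lemma bij_\<phi>: "bij_betw \<phi> {0..<real m} unit_circle"
  unfolding bij_betw_def
proof
  show "inj_on \<phi> {0..<real m}"
    by (rule inj_onI) (rule \<phi>_inj, auto)
  have "x \<in> \<phi> ` {0..<real m}" if "x \<in> unit_circle" for x
  proof -
    have "x \<in> h ` unit_circle"
      using that unfolding bij_betw_imp_surj_on[OF circle_auto_bij[OF h]] .
    then obtain y where y: "y \<in> unit_circle" "x = h y"
      by blast
    obtain s where "y = cis s" "0 \<le> s" "s < 2 * pi"
      using y(1) by (rule unit_circleE)
    then show ?thesis
      unfolding \<phi>_def y(2) using m by (intro image_eqI[of _ _ "s * m / (2 * pi)"]) (auto simp: field_simps)
  qed
  then show "\<phi> ` {0..<real m} = unit_circle"
    using \<phi>_in by blast
qed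

text \<open>Two shapes of parameter interval occur. One lies inside \<open>[0, m]\<close>; the other
  starts below 0, and its negative part reappears at the upper end as
  \<open>[s + m, m)\<close>.\<close>

lemma \<phi>_mem:
  fixes r s t :: real
  assumes r: "0 \<le> r" "r < m"
  shows "0 \<le> s \<Longrightarrow> s \<le> t \<Longrightarrow> t \<le> m \<Longrightarrow> t < s + m \<Longrightarrow> \<phi> r \<in> half_open_arc (\<phi> s) (\<phi> t) \<longleftrightarrow> s \<le> r \<and> r < t"
    and "s < 0 \<Longrightarrow> 0 \<le> t \<Longrightarrow> t < s + m \<Longrightarrow> \<phi> r \<in> half_open_arc (\<phi> s) (\<phi> t) \<longleftrightarrow> r < t \<or> s + m \<le> r"
proof -
  assume st: "0 \<le> s" "s \<le> t" "t \<le> m" "t < s + m"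
  have "x = r" if "\<phi> r = \<phi> x" "s \<le> x" "x < t" for x :: real
    using \<phi>_inj[OF that(1)] that st r by auto
  then show "\<phi> r \<in> half_open_arc (\<phi> s) (\<phi> t) \<longleftrightarrow> s \<le> r \<and> r < t"
    unfolding half_open_arc_\<phi>[OF st(2,4)] by auto
next
  assume st: "s < 0" "0 \<le> t" "t < s + m"
  have p: "\<phi> (x + m) = \<phi> x" for x :: real
    using \<phi>_period[of x 1] by simp
  have "r < t \<or> s + m \<le> r" if "\<phi> r = \<phi> x" "s \<le> x" "x < t" for x :: real
  proof (cases "0 \<le> x")
    case True
    then show ?thesis
      using \<phi>_inj[of r x] that st r by auto
  next
    case False
    then show ?thesis
      using \<phi>_inj[of r "x + m"] p[of x] that st r by auto
  qed
  moreover have "\<phi> r \<in> \<phi> ` {s..<t}" if "s + m \<le> r"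
    using that st r p[of "r - m"] by (intro image_eqI[of _ _ "r - m"]) auto
  moreover have "\<phi> r \<in> \<phi> ` {s..<t}" if "r < t"
    using that st r by auto
  moreover have "s \<le> t"
    using st by simp
  ultimately show "\<phi> r \<in> half_open_arc (\<phi> s) (\<phi> t) \<longleftrightarrow> r < t \<or> s + m \<le> r"
    unfolding half_open_arc_\<phi>[OF \<open>s \<le> t\<close> st(3)] by (metis atLeastLessThan_iff imageE)
qed

lemma circle_iterate_\<phi>: "circle_iterate c j (\<phi> s) = \<phi> (s - of_int j)" for s :: real
proof -
  have pos: "(c ^^ n) (\<phi> s) = \<phi> (s - of_nat n)" for n and s :: real
    by (induction n) (auto simp: c algebra_simps)
  have sur: "\<exists>s. x = \<phi> s" if "x \<in> unit_circle" for x
    using bij_\<phi> that unfolding bij_betw_def by blast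
  \<comment> \<open>The \<open>m\<close>-th iterate of \<open>c\<close> is the identity on the
    circle, so \<open>c\<close> is injective and \<open>inv_into\<close>, which supplies the
    negative iterates, is the genuine inverse.\<close>
  have "inj_on c unit_circle"
  proof (rule inj_onI)
    fix x y assume "x \<in> unit_circle" "y \<in> unit_circle" and cxy: "c x = c y"
    then obtain s t where st: "x = \<phi> s" "y = \<phi> t"
      using sur by blast
    then have "(c ^^ (m - 1)) (c x) = \<phi> (s - m)" "(c ^^ (m - 1)) (c y) = \<phi> (t - m)"
      unfolding st c pos using m by (simp_all add: algebra_simps of_nat_diff)
    then have "\<phi> (s - m) = \<phi> (t - m)"
      using cxy by simp
    then show "x = y"
      using \<phi>_period[of s "-1"] \<phi>_period[of t "-1"] st by simp
  qed
  then have "inv_into unit_circle c (\<phi> s) = \<phi> (s + 1)" for s :: real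
    using inv_into_f_f[of c unit_circle "\<phi> (s + 1)"] c[of "s + 1"] by simp
  then have neg: "(inv_into unit_circle c ^^ n) (\<phi> s) = \<phi> (s + of_nat n)" for n and s :: real
    by (induction n) (auto simp: algebra_simps)
  show ?thesis
    unfolding circle_iterate_def by (auto simp: pos neg)
qed

lemma \<phi>_eq_one: "\<phi> s = 1 \<Longrightarrow> s \<in> \<int>" for s :: real
proof -
  assume s: "\<phi> s = 1"
  define k where "k = \<lfloor>s / m\<rfloor>"
  have "of_int k \<le> s / m" "s / m < of_int k + 1"
    unfolding k_def by linarith+
  then have "m * of_int k \<le> s" "s < m * of_int k + m"
    using m by (auto simp: field_simps)
  then have "s + m * of_int (- k) = 0"
    using \<phi>_inj[of "s + m * of_int (- k)" 0] \<phi>_period[of s "- k"] s one by auto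
  then have "s = of_int (int m * k)"
    by simp
  then show ?thesis
    using Ints_of_int by metis
qed

end

locale elliptic_sector = circle_rotation +
  fixes a :: complex and \<alpha> :: real
  assumes a: "a = \<phi> \<alpha>" and \<alpha>: "0 < \<alpha>" "\<alpha> < real m - 1"
begin

text \<open>Every application of \<open>c\<close> lowers the parameter by 1. From an integral
  \<open>\<alpha>\<close> the orbit first meets the parameter 0 of the point 1 after
  \<open>\<alpha>\<close> steps. From any other \<open>\<alpha>\<close> it stays in
  \<open>(0, m - 1)\<close> for floor \<open>\<alpha>\<close> steps and then falls into
  \<open>(-1, 0)\<close>, outside the sector.\<close>

lemma index_J: "index_J c l a = \<lfloor>\<alpha>\<rfloor>"
proof (cases "\<alpha> \<in> \<int>")
  case True
  then obtain n where n: "\<alpha> = of_int n"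
    by (rule Ints_cases)
  then have \<alpha>': "\<lfloor>\<alpha>\<rfloor> = n" and pos: "0 < n"
    using \<alpha> by auto
  have "\<exists>j. circle_iterate c j a = 1"
    unfolding a circle_iterate_\<phi> using n one by (intro exI[of _ n]) simp
  moreover have "(LEAST j::nat. 0 < j \<and> circle_iterate c (int j) a = 1) = nat n"
  proof (rule Least_equality)
    show "0 < nat n \<and> circle_iterate c (int (nat n)) a = 1"
      unfolding a circle_iterate_\<phi> using n one pos by simp
    fix j :: nat assume j: "0 < j \<and> circle_iterate c (int j) a = 1"
    show "nat n \<le> j"
    proof (rule ccontr)
      assume "\<not> nat n \<le> j"
      then have "real j < \<alpha>"
        using n pos by linarith
      then show False
        using \<phi>_inj[of "\<alpha> - j" 0] j \<alpha> one unfolding a circle_iterate_\<phi> by auto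
    qed
  qed
  ultimately show ?thesis
    unfolding index_J_def \<alpha>' using pos by simp
next
  case False
  have fl: "of_int \<lfloor>\<alpha>\<rfloor> < \<alpha>" "\<alpha> < of_int \<lfloor>\<alpha>\<rfloor> + 1" "0 \<le> \<lfloor>\<alpha>\<rfloor>"
  proof -
    have "of_int \<lfloor>\<alpha>\<rfloor> \<noteq> \<alpha>"
      using False Ints_of_int[of "\<lfloor>\<alpha>\<rfloor>"] by auto
    then show "of_int \<lfloor>\<alpha>\<rfloor> < \<alpha>" "\<alpha> < of_int \<lfloor>\<alpha>\<rfloor> + 1" "0 \<le> \<lfloor>\<alpha>\<rfloor>"
      using \<alpha> by linarith+
  qed
  have "\<not> (\<exists>j. circle_iterate c j a = 1)"
    unfolding a circle_iterate_\<phi> using \<phi>_eq_one False by (metis Ints_add Ints_of_int diff_add_cancel)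
  moreover have arc: "open_arc 1 (vpow l 2) = \<phi> ` {0<..<real m - 1}"
    unfolding one[symmetric] v2'[symmetric] using m by (intro open_arc_\<phi>) auto
  have "(LEAST J::nat. circle_iterate c (int J + 1) a \<notin> open_arc 1 (vpow l 2)) = nat \<lfloor>\<alpha>\<rfloor>"
  proof (rule Least_equality)
    have "\<phi> (\<alpha> - (1 + of_int \<lfloor>\<alpha>\<rfloor>)) \<notin> \<phi> ` {0<..<real m - 1}"
    proof
      assume "\<phi> (\<alpha> - (1 + of_int \<lfloor>\<alpha>\<rfloor>)) \<in> \<phi> ` {0<..<real m - 1}"
      then obtain s where "\<phi> (\<alpha> - (1 + of_int \<lfloor>\<alpha>\<rfloor>)) = \<phi> s" "0 < s" "s < real m - 1"
        by auto
      then show False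
        using \<phi>_inj[of "\<alpha> - (1 + of_int \<lfloor>\<alpha>\<rfloor>)" s] fl by auto
    qed
    then show "circle_iterate c (int (nat \<lfloor>\<alpha>\<rfloor>) + 1) a \<notin> open_arc 1 (vpow l 2)"
      unfolding a circle_iterate_\<phi> arc using fl by (simp add: add.commute)
    fix j :: nat assume j: "circle_iterate c (int j + 1) a \<notin> open_arc 1 (vpow l 2)"
    show "nat \<lfloor>\<alpha>\<rfloor> \<le> j"
    proof (rule ccontr)
      assume "\<not> nat \<lfloor>\<alpha>\<rfloor> \<le> j"
      then have "real j + 1 \<le> of_int \<lfloor>\<alpha>\<rfloor>"
        by linarith
      then have "\<alpha> - (real j + 1) \<in> {0<..<real m - 1}"
        using fl \<alpha> by auto
      then show False
        using j unfolding a circle_iterate_\<phi> arc by auto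
    qed
  qed
  ultimately show ?thesis
    unfolding index_J_def using fl by simp
qed

lemma index_I: "index_I c l m a = int m - \<lfloor>\<alpha>\<rfloor> - 2"
  unfolding index_I_def index_J by simp

text \<open>The point \<open>vpow l 2\<close> receives two parameters: \<open>- 1\<close> where it
  starts an arc running outside the sector towards 1, and \<open>m - 1\<close> where it closes the
  sector.\<close>

lemma elliptic_rects_\<phi>:
  defines "J \<equiv> \<lfloor>\<alpha>\<rfloor>"
  defines "I \<equiv> int m - J - 2"
  shows "elliptic_rects l m c a =
     (\<lambda>i. if i \<le> I then (\<phi> (- 1), \<phi> (of_int i - 1), \<phi> (\<alpha> + of_int i - 1), \<phi> (\<alpha> + of_int i))
          else (\<phi> (- 1), \<phi> (of_int I), \<phi> (\<alpha> + of_int I), \<phi> (real m - 1))) ` {1..I + 1}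
   \<union> (\<lambda>j. if j \<le> J then (\<phi> (- of_int j), \<phi> 0, \<phi> (\<alpha> - of_int j), \<phi> (\<alpha> - of_int j + 1))
          else (\<phi> (- 1 - of_int J), \<phi> 0, \<phi> 0, \<phi> (\<alpha> - of_int J))) ` {1..J + 1}"
proof -
  have it1: "circle_iterate c j 1 = \<phi> (- of_int j)" for j
    unfolding one[symmetric] circle_iterate_\<phi> by simp
  have itv: "circle_iterate c j (vpow l 2) = \<phi> (- 1 - of_int j)" for j
    unfolding v2[symmetric] circle_iterate_\<phi> by simp
  show ?thesis
    unfolding elliptic_rects_def Let_def index_I index_J it1 itv J_def[symmetric] I_def[symmetric]
    unfolding a circle_iterate_\<phi> one v2 v2'
    by (intro arg_cong2[where f = "(\<union>)"] image_cong refl) (auto simp: algebra_simps)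
qed

lemma floor_bounds: "0 \<le> \<lfloor>\<alpha>\<rfloor>" "\<lfloor>\<alpha>\<rfloor> \<le> int m - 2" "of_int \<lfloor>\<alpha>\<rfloor> \<le> \<alpha>" "\<alpha> < of_int \<lfloor>\<alpha>\<rfloor> + 1"
proof -
  have "\<lfloor>\<alpha>\<rfloor> < int m - 1"
    using \<alpha> by linarith
  then show "\<lfloor>\<alpha>\<rfloor> \<le> int m - 2"
    by simp
qed (use \<alpha> in linarith)+

lemma elliptic_rects_nondegenerate:
  assumes "(x, y, z, w) \<in> elliptic_rects l m c a"
  shows "x \<in> unit_circle" "y \<in> unit_circle" "z \<in> unit_circle" "w \<in> unit_circle"
    and "x \<noteq> y \<and> z \<noteq> w \<or> z = 1 \<and> w = 1"
proof -
  define J where "J = \<lfloor>\<alpha>\<rfloor>"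
  have fl: "0 \<le> real_of_int J" "real_of_int J \<le> real m - 2" "of_int J \<le> \<alpha>" "\<alpha> < of_int J + 1"
    using floor_bounds unfolding J_def by linarith+
  have ne: "\<phi> s \<noteq> \<phi> t" if "s < t" "t < s + m" for s t :: real
    using \<phi>_inj[of s t] that by auto
  have ne': "\<phi> t \<noteq> \<phi> s" if "s < t" "t < s + m" for s t :: real
    using \<phi>_inj[of s t] that by auto
  have "x \<in> unit_circle \<and> y \<in> unit_circle \<and> z \<in> unit_circle \<and> w \<in> unit_circle"
    using assms unfolding elliptic_rects_\<phi> J_def[symmetric] by (auto split: if_splits)
  then show "x \<in> unit_circle" "y \<in> unit_circle" "z \<in> unit_circle" "w \<in> unit_circle"
    by auto
  consider (U) i where "1 \<le> i" "i \<le> int m - J - 2"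
      "(x, y, z, w) = (\<phi> (- 1), \<phi> (of_int i - 1), \<phi> (\<alpha> + of_int i - 1), \<phi> (\<alpha> + of_int i))"
    | (U1) "(x, y, z, w) = (\<phi> (- 1), \<phi> (of_int (int m - J - 2)), \<phi> (\<alpha> + of_int (int m - J - 2)), \<phi> (real m - 1))"
    | (L) j where "1 \<le> j" "j \<le> J"
      "(x, y, z, w) = (\<phi> (- of_int j), \<phi> 0, \<phi> (\<alpha> - of_int j), \<phi> (\<alpha> - of_int j + 1))"
    | (L1) "(x, y, z, w) = (\<phi> (- 1 - of_int J), \<phi> 0, \<phi> 0, \<phi> (\<alpha> - of_int J))"
    using assms unfolding elliptic_rects_\<phi> J_def[symmetric] by (auto split: if_splits)
  then show "x \<noteq> y \<and> z \<noteq> w \<or> z = 1 \<and> w = 1"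
  proof cases
    case U
    then have "real_of_int i \<le> real m - 2" "1 \<le> real_of_int i"
      using fl by linarith+
    then have "x \<noteq> y" "z \<noteq> w"
      using U(3) m ne[of "- 1" "of_int i - 1"] ne[of "\<alpha> + of_int i - 1" "\<alpha> + of_int i"] by auto
    then show ?thesis by blast
  next
    case U1
    have "x \<noteq> y"
      using U1 fl m ne[of "- 1" "of_int (int m - J - 2)"] by simp
    moreover have "z \<noteq> w"
      using U1 fl m ne[of "\<alpha> + of_int (int m - J - 2)" "real m - 1"] by simp
    ultimately show ?thesis by blast
  next
    case L
    then have "real_of_int j \<le> real m - 2" "1 \<le> real_of_int j"
      using fl by linarith+
    then have "x \<noteq> y" "z \<noteq> w"
      using L(3) m ne[of "- of_int j" 0] ne[of "\<alpha> - of_int j" "\<alpha> - of_int j + 1"] by auto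
    then show ?thesis by blast
  next
    case L1
    have "x \<noteq> y"
      using L1 fl m ne[of "- 1 - of_int J" 0] by simp
    \<comment> \<open>The second factor runs from parameter 0 to \<open>\<alpha> - J\<close>; it
      shrinks to the point 1 exactly when \<open>\<alpha>\<close> is an integer.\<close>
    moreover have "z \<noteq> w" if "of_int J \<noteq> \<alpha>"
      using that L1 fl m ne[of 0 "\<alpha> - of_int J"] by simp
    ultimately show ?thesis
      using L1 one by auto
  qed
qed

lemma finite_elliptic_rects: "finite (elliptic_rects l m c a)"
  unfolding elliptic_rects_def Let_def by simp

text \<open>The rectangles are the strips on which \<open>k\<close>, the floor of
  \<open>t - \<alpha>\<close>, is constant: the \<open>i\<close>-th upper one has
  \<open>k = i - 1\<close>, the \<open>j\<close>-th lower one \<open>k = - j\<close>. The two last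
  ones, \<open>k = I\<close> and \<open>k = - 1 - J\<close>, are cut off by the ends of the
  sector.\<close>

lemma rect_union_elliptic_mem:
  fixes s t :: real
  assumes s: "0 \<le> s" "s < m" and t: "0 \<le> t" "t < m"
  shows "(\<phi> s, \<phi> t) \<in> rect_union half_open_arc (elliptic_rects l m c a) \<longleftrightarrow> (s, t) \<in> elliptic_region m \<alpha>"
proof -
  define J where "J = \<lfloor>\<alpha>\<rfloor>"
  define I where "I = int m - J - 2"
  note fl = floor_bounds[folded J_def]
  have I: "real_of_int I = real m - of_int J - 2" "0 \<le> I"
    unfolding I_def using fl by auto
  define k where "k = \<lfloor>t - \<alpha>\<rfloor>"
  have k: "of_int k \<le> t - \<alpha>" "t - \<alpha> < of_int k + 1"
    unfolding k_def by linarith+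
  have U: "\<phi> s \<in> half_open_arc (\<phi> (- 1)) (\<phi> (of_int i - 1)) \<and> \<phi> t \<in> half_open_arc (\<phi> (\<alpha> + of_int i - 1)) (\<phi> (\<alpha> + of_int i))
      \<longleftrightarrow> (s < of_int i - 1 \<or> real m - 1 \<le> s) \<and> k = i - 1" if i: "1 \<le> i" "i \<le> I" for i
  proof -
    have i': "1 \<le> real_of_int i" "real_of_int i \<le> real m - of_int J - 2"
      using i I by linarith+
    have "\<alpha> + real_of_int i - 1 \<le> t \<and> t < \<alpha> + real_of_int i \<longleftrightarrow> k = i - 1"
      unfolding k_def floor_eq_iff by auto
    then show ?thesis
      using \<phi>_mem(2)[OF s, of "- 1" "of_int i - 1"] \<phi>_mem(1)[OF t, of "\<alpha> + of_int i - 1" "\<alpha> + of_int i"] i' fl \<alpha> m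
      by auto
  qed
  have U1: "\<phi> s \<in> half_open_arc (\<phi> (- 1)) (\<phi> (of_int I)) \<and> \<phi> t \<in> half_open_arc (\<phi> (\<alpha> + of_int I)) (\<phi> (real m - 1))
      \<longleftrightarrow> (s < of_int I \<or> real m - 1 \<le> s) \<and> k = I \<and> t < real m - 1"
  proof -
    have "\<alpha> + real_of_int I \<le> t \<and> t < real m - 1 \<longleftrightarrow> k = I \<and> t < real m - 1"
      unfolding k_def floor_eq_iff using I fl by auto
    then show ?thesis
      using \<phi>_mem(2)[OF s, of "- 1" "of_int I"] \<phi>_mem(1)[OF t, of "\<alpha> + of_int I" "real m - 1"] I fl \<alpha> m
      by auto
  qed
  have L: "\<phi> s \<in> half_open_arc (\<phi> (- of_int j)) (\<phi> 0) \<and> \<phi> t \<in> half_open_arc (\<phi> (\<alpha> - of_int j)) (\<phi> (\<alpha> - of_int j + 1))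
      \<longleftrightarrow> real m + of_int k \<le> s \<and> k = - j" if j: "1 \<le> j" "j \<le> J" for j
  proof -
    have j': "1 \<le> real_of_int j" "real_of_int j \<le> of_int J"
      using j by linarith+
    have "\<alpha> - real_of_int j \<le> t \<and> t < \<alpha> - real_of_int j + 1 \<longleftrightarrow> k = - j"
      unfolding k_def floor_eq_iff by auto
    then show ?thesis
      using \<phi>_mem(2)[OF s, of "- of_int j" 0] \<phi>_mem(1)[OF t, of "\<alpha> - of_int j" "\<alpha> - of_int j + 1"] j' fl \<alpha> m s
      by auto
  qed
  have L1: "\<phi> s \<in> half_open_arc (\<phi> (- 1 - of_int J)) (\<phi> 0) \<and> \<phi> t \<in> half_open_arc (\<phi> 0) (\<phi> (\<alpha> - of_int J))
      \<longleftrightarrow> real m + of_int k \<le> s \<and> k = - 1 - J"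
  proof -
    have "t < \<alpha> - of_int J \<longleftrightarrow> k = - 1 - J"
      unfolding k_def floor_eq_iff using t fl by auto
    then show ?thesis
      using \<phi>_mem(2)[OF s, of "- 1 - of_int J" 0] \<phi>_mem(1)[OF t, of 0 "\<alpha> - of_int J"] fl \<alpha> m s t
      by auto
  qed
  have kI: "k \<le> I" if "t < real m - 1"
  proof -
    have "real_of_int k < real_of_int (I + 1)"
      using k that fl I by simp
    then show ?thesis
      by linarith
  qed
  have kt: "t < real m - 1" if "k < I"
  proof -
    have "real_of_int k + 1 \<le> real_of_int I"
      using that by linarith
    then show ?thesis
      using k fl I by linarith
  qed
  have kJ: "- 1 - J \<le> k"
  proof -
    have "real_of_int (- 2 - J) < real_of_int k"
      using k t fl by simp
    then show ?thesis
      by linarith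
  qed
  have k0: "t < \<alpha> \<longleftrightarrow> k < 0"
    unfolding k_def by (simp add: floor_less_iff)
  have tm: "t < real m - 1" if "k < 0"
    using that k0 \<alpha> by linarith
  have "(\<phi> s, \<phi> t) \<in> rect_union half_open_arc (elliptic_rects l m c a) \<longleftrightarrow>
      (\<exists>i\<in>{1..I + 1}. if i \<le> I then (s < of_int i - 1 \<or> real m - 1 \<le> s) \<and> k = i - 1
         else (s < of_int I \<or> real m - 1 \<le> s) \<and> k = I \<and> t < real m - 1) \<or>
      (\<exists>j\<in>{1..J + 1}. if j \<le> J then real m + of_int k \<le> s \<and> k = - j
         else real m + of_int k \<le> s \<and> k = - 1 - J)"
    unfolding rect_union_def elliptic_rects_\<phi> J_def[symmetric] I_def[symmetric] UN_Un Un_iff image_image UN_iff bex_simps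
    by (intro arg_cong2[where f = "(\<or>)"] bex_cong refl) (use U U1 L L1 in \<open>simp_all\<close>)
  also have "\<dots> \<longleftrightarrow> (0 \<le> k \<and> t < real m - 1 \<and> (s < of_int k \<or> real m - 1 \<le> s)) \<or> (k < 0 \<and> real m + of_int k \<le> s)"
  proof (intro arg_cong2[where f = "(\<or>)"])
    show "(\<exists>i\<in>{1..I + 1}. if i \<le> I then (s < of_int i - 1 \<or> real m - 1 \<le> s) \<and> k = i - 1
         else (s < of_int I \<or> real m - 1 \<le> s) \<and> k = I \<and> t < real m - 1)
       \<longleftrightarrow> (0 \<le> k \<and> t < real m - 1 \<and> (s < of_int k \<or> real m - 1 \<le> s))" (is "?l = ?r")
    proof
      assume ?l
      then show ?r
        using kt I by (auto split: if_splits)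
    next
      assume ?r
      then show ?l
        using kI by (intro bexI[of _ "k + 1"]) auto
    qed
    show "(\<exists>j\<in>{1..J + 1}. if j \<le> J then real m + of_int k \<le> s \<and> k = - j
         else real m + of_int k \<le> s \<and> k = - 1 - J) \<longleftrightarrow> (k < 0 \<and> real m + of_int k \<le> s)" (is "?l = ?r")
    proof
      assume ?l
      then show ?r
        using fl by (auto split: if_splits)
    next
      assume ?r
      then show ?l
        using kJ by (intro bexI[of _ "- k"]) auto
    qed
  qed
  also have "\<dots> \<longleftrightarrow> (s, t) \<in> elliptic_region m \<alpha>"
    unfolding elliptic_region_def using s t k0 tm by (auto simp flip: k_def)
  finally show ?thesis .
qed

lemma rect_union_elliptic:
  "rect_union half_open_arc (elliptic_rects l m c a) = map_prod \<phi> \<phi> ` elliptic_region m \<alpha>"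
proof (intro equalityI subsetI)
  fix p assume p: "p \<in> rect_union half_open_arc (elliptic_rects l m c a)"
  then obtain x y z w where xyzw: "(x, y, z, w) \<in> elliptic_rects l m c a"
      and p': "fst p \<in> half_open_arc x y" "snd p \<in> half_open_arc z w"
    unfolding rect_union_def by auto
  have "fst p \<in> unit_circle" "snd p \<in> unit_circle"
    using elliptic_rects_nondegenerate(1,3)[OF xyzw] p' arc_subset_unit_circle(2) by blast+
  then obtain s t where "fst p = \<phi> s" "snd p = \<phi> t" "s \<in> {0..<real m}" "t \<in> {0..<real m}"
    using bij_betw_imp_surj_on[OF bij_\<phi>] by (metis imageE)
  then show "p \<in> map_prod \<phi> \<phi> ` elliptic_region m \<alpha>"
    using p rect_union_elliptic_mem[of s t] by (cases p) auto
next
  fix p assume "p \<in> map_prod \<phi> \<phi> ` elliptic_region m \<alpha>"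
  then show "p \<in> rect_union half_open_arc (elliptic_rects l m c a)"
    using rect_union_elliptic_mem by (auto simp: elliptic_region_def)
qed

text \<open>For order 2 the floor of \<open>t - \<alpha>\<close> is -1 or 0, and both fibres are
  \<open>[1, 2)\<close>. So the separate rectangle given for order 2 is the elliptic region for
  every choice of the partition point.\<close>

lemma rect_union_two:
  assumes "m = 2"
  shows "rect_union half_open_arc (two_rects l) = map_prod \<phi> \<phi> ` elliptic_region m \<alpha>"
proof -
  have "elliptic_region m \<alpha> = {1..<2} \<times> {0..<1}"
  proof -
    have "\<lfloor>t - \<alpha>\<rfloor> = (if t < \<alpha> then - 1 else 0)" if "0 \<le> t" "t < 1" for t
      using that \<alpha> assms by (auto simp: floor_eq_iff)
    then show ?thesis
      unfolding elliptic_region_def using assms by auto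
  qed
  moreover have "half_open_arc (\<phi> 1) (\<phi> 2) = \<phi> ` {1..<2}" "half_open_arc (\<phi> 0) (\<phi> 1) = \<phi> ` {0..<1}"
    using assms by (intro half_open_arc_\<phi>; simp)+
  moreover have "\<phi> 1 = vpow l 2" "\<phi> 2 = 1"
    using v2' \<phi>_period[of 0 1] assms one by simp_all
  ultimately show ?thesis
    unfolding two_rects_def rect_union_def by (simp add: one map_prod_surj_on)
qed

end

section \<open>Conjugating to a rotation and locating the cusps\<close>

lemma su11_map_comp:
  assumes "su11 \<alpha>' \<beta>'" "cmod z \<le> 1"
  shows "su11_map \<alpha> \<beta> (su11_map \<alpha>' \<beta>' z) = su11_map (\<alpha> * \<alpha>' + \<beta> * cnj \<beta>') (\<alpha> * \<beta>' + \<beta> * cnj \<alpha>') z"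
proof -
  have "cnj \<beta>' * z + cnj \<alpha>' \<noteq> 0"
    using su11_denom_nz[OF assms] unfolding su11_denom_def .
  then have "su11_map \<alpha> \<beta> (su11_map \<alpha>' \<beta>' z)
      = (\<alpha> * (\<alpha>' * z + \<beta>') + \<beta> * (cnj \<beta>' * z + cnj \<alpha>'))
        / (cnj \<beta> * (\<alpha>' * z + \<beta>') + cnj \<alpha> * (cnj \<beta>' * z + cnj \<alpha>'))"
    unfolding su11_map_def by (simp add: add_frac_eq divide_simps)
  then show ?thesis
    unfolding su11_map_def by (simp add: algebra_simps)
qed

lemma su11_comp:
  assumes "su11 \<alpha> \<beta>" "su11 \<alpha>' \<beta>'"
  shows "su11 (\<alpha> * \<alpha>' + \<beta> * cnj \<beta>') (\<alpha> * \<beta>' + \<beta> * cnj \<alpha>')"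
proof -
  let ?a = "\<alpha> * \<alpha>' + \<beta> * cnj \<beta>'" and ?b = "\<alpha> * \<beta>' + \<beta> * cnj \<alpha>'"
  have "?a * cnj ?a - ?b * cnj ?b = (\<alpha> * cnj \<alpha> - \<beta> * cnj \<beta>) * (\<alpha>' * cnj \<alpha>' - \<beta>' * cnj \<beta>')"
    by (simp add: algebra_simps)
  then have "complex_of_real ((cmod ?a)\<^sup>2 - (cmod ?b)\<^sup>2) = 1"
    unfolding su11_det[OF assms(1)] su11_det[OF assms(2)] of_real_diff complex_norm_square by simp
  then show ?thesis
    unfolding su11_def by (simp only: of_real_eq_1_iff)
qed

text \<open>Conjugation by \<open>f\<close> makes the fixed point 0, and a disk isometry fixing 0
  has \<open>\<beta> = 0\<close>, hence is a rotation. It takes \<open>cis \<theta>\<close> to 1, so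
  it turns by \<open>- \<theta>\<close>: the interior angle of the polygon determines the
  rotation.\<close>

lemma rotation_conjugate:
  assumes iso: "disk_isometry \<gamma>" and ang: "has_interior_angle x p y \<theta>" and p: "\<gamma> p = p" and x: "\<gamma> x = y"
  obtains f where "disk_isometry f" "f 1 = y" "f (cis \<theta>) = x"
    "\<And>z. z \<in> unit_circle \<Longrightarrow> \<gamma> (f z) = f (cis (- \<theta>) * z)"
proof -
  obtain \<alpha> \<beta> where \<gamma>: "su11 \<alpha> \<beta>" "\<gamma> = su11_map \<alpha> \<beta>"
    using iso unfolding disk_isometry_def by blast
  obtain f where f: "disk_isometry f" "f 0 = p" "f 1 = y" "f (cis \<theta>) = x"
    using ang unfolding has_interior_angle_def by blast
  then obtain a b where ab: "su11 a b" "f = su11_map a b"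
    unfolding disk_isometry_def by blast
  define f' where "f' = su11_map (cnj a) (- b)"
  have f'f: "f' (f z) = z" if "cmod z \<le> 1" for z
    using su11_map_inverse[OF ab(1) that] ab(2) unfolding f'_def by simp
  have ff': "f (f' z) = z" if "cmod z \<le> 1" for z
    using su11_map_inverse[OF su11_inverse[OF ab(1)] that] ab(2) unfolding f'_def by simp
  define \<alpha>1 \<beta>1 where "\<alpha>1 = \<alpha> * a + \<beta> * cnj b" and "\<beta>1 = \<alpha> * b + \<beta> * cnj a"
  have su1: "su11 \<alpha>1 \<beta>1"
    unfolding \<alpha>1_def \<beta>1_def using \<gamma>(1) ab(1) by (rule su11_comp)
  define \<alpha>2 \<beta>2 where "\<alpha>2 = cnj a * \<alpha>1 - b * cnj \<beta>1" and "\<beta>2 = cnj a * \<beta>1 - b * cnj \<alpha>1"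
  have su2: "su11 \<alpha>2 \<beta>2"
    unfolding \<alpha>2_def \<beta>2_def using su11_comp[OF su11_inverse[OF ab(1)] su1] by simp
  have h: "f' (\<gamma> (f z)) = su11_map \<alpha>2 \<beta>2 z" if "cmod z \<le> 1" for z
    unfolding \<gamma>(2) ab(2) su11_map_comp[OF ab(1) that] \<alpha>1_def[symmetric] \<beta>1_def[symmetric] f'_def
      su11_map_comp[OF su1 that] by (simp add: \<alpha>2_def \<beta>2_def)
  have "su11_map \<alpha>2 \<beta>2 0 = 0"
    using h[of 0] f'f[of 0] f(2) p by simp
  then have \<beta>2: "\<beta>2 = 0"
    using su11_denom_nz[OF su2, of 0] by (simp add: su11_map_def su11_denom_def)
  have lin: "su11_map \<alpha>2 \<beta>2 z = \<alpha>2 / cnj \<alpha>2 * z" for z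
    by (simp add: su11_map_def \<beta>2)
  have "\<alpha>2 / cnj \<alpha>2 * cis \<theta> = 1"
    using h[of "cis \<theta>"] f'f[of 1] f(3,4) x unfolding lin by simp
  then have "\<alpha>2 / cnj \<alpha>2 * cis \<theta> * cis (- \<theta>) = cis (- \<theta>)"
    by simp
  then have k: "\<alpha>2 / cnj \<alpha>2 = cis (- \<theta>)"
    by (simp add: mult.assoc cis_mult)
  have "\<gamma> (f z) = f (cis (- \<theta>) * z)" if "z \<in> unit_circle" for z
  proof -
    have "\<gamma> (f z) \<in> unit_circle"
      using circle_auto_mem circle_auto_disk_isometry iso f(1) that by metis
    then have "f (f' (\<gamma> (f z))) = \<gamma> (f z)"
      using ff' by simp
    then show ?thesis
      using h[of z] that unfolding lin k by simp
  qed
  then show thesis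
    using that f by blast
qed

section \<open>Isometric circles, half-planes and the position of a cusp\<close>

lemma isometric_circle_denom:
  assumes "su11 \<alpha> \<beta>" "z \<in> unit_circle" "z \<in> isometric_circle (su11_map \<alpha> \<beta>)"
  shows "cmod (su11_denom \<alpha> \<beta> z) = 1"
proof -
  have nz: "cnj \<beta> * z + cnj \<alpha> \<noteq> 0"
    using su11_denom_nz[OF assms(1), of z] assms(2) unfolding su11_denom_def by simp
  have eq: "\<alpha> * (cnj \<beta> * z + cnj \<alpha>) - (\<alpha> * z + \<beta>) * cnj \<beta> = 1"
    using su11_det[OF assms(1)] by (simp add: algebra_simps)
  have "(su11_map \<alpha> \<beta> has_field_derivative
      (\<alpha> * (cnj \<beta> * z + cnj \<alpha>) - (\<alpha> * z + \<beta>) * cnj \<beta>) / ((cnj \<beta> * z + cnj \<alpha>) * (cnj \<beta> * z + cnj \<alpha>))) (at z)"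
    unfolding su11_map_def[abs_def] using nz by (auto intro!: derivative_eq_intros)
  then have "deriv (su11_map \<alpha> \<beta>) z = 1 / (su11_denom \<alpha> \<beta> z * su11_denom \<alpha> \<beta> z)"
    unfolding eq su11_denom_def by (rule DERIV_imp_deriv)
  then have "cmod (su11_denom \<alpha> \<beta> z) * cmod (su11_denom \<alpha> \<beta> z) = 1"
    using assms(3) unfolding isometric_circle_def by (simp add: norm_divide norm_mult divide_eq_1_iff)
  then show ?thesis
    using norm_ge_zero[of "su11_denom \<alpha> \<beta> z"] by (auto simp: square_eq_1_iff)
qed

text \<open>In the two-point formula both denominators have modulus 1 on the isometric circle, so
  the distance from the fixed point is kept.\<close>

lemma isometric_circle_fixpoint_dist:
  assumes iso: "disk_isometry \<gamma>" and C: "x \<in> unit_circle" "p \<in> unit_circle"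
    and fixp: "\<gamma> p = p" and isom: "x \<in> isometric_circle \<gamma>" "p \<in> isometric_circle \<gamma>"
  shows "cmod (\<gamma> x - p) = cmod (x - p)"
proof -
  obtain \<alpha> \<beta> where \<gamma>: "su11 \<alpha> \<beta>" "\<gamma> = su11_map \<alpha> \<beta>"
    using iso unfolding disk_isometry_def by blast
  have "\<gamma> x - p = (x - p) / (su11_denom \<alpha> \<beta> x * su11_denom \<alpha> \<beta> p)"
    using su11_map_diff[OF \<gamma>(1), of x p] C fixp \<gamma>(2) by simp
  then show ?thesis
    using isometric_circle_denom[OF \<gamma>(1)] C isom \<gamma>(2) by (simp add: norm_divide norm_mult)
qed

text \<open>Equal chords give equal cosines of the two partial arcs, and the cosine is injective on
  \<open>[0, pi]\<close>. The condition on \<open>orient\<close> excludes the midpoint of the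
  opposite arc.\<close>

lemma equidistant_between:
  assumes "p \<in> unit_circle" "0 < \<delta>" "\<delta> \<le> pi" "orient (cis a) p (cis (a + \<delta>)) > 0"
    and "cmod (cis (a + \<delta>) - p) = cmod (cis a - p)"
  shows "p = cis (a + \<delta> / 2)"
proof -
  obtain s where s: "p = cis s" "a \<le> s" "s < a + 2 * pi"
    using assms(1) by (rule unit_circle_cis_from)
  have as: "a < s" "s < a + \<delta>"
    using orient_cis_pos_iff[of a s "a + \<delta>"] s assms by auto
  have sq: "(cmod (cis u - cis v))\<^sup>2 = 2 - 2 * cos (u - v)" for u v
    unfolding cmod_power2 cos_diff using sin_cos_squared_add[of u] sin_cos_squared_add[of v]
    by (simp add: power2_eq_square algebra_simps)
  have "cos (a + \<delta> - s) = cos (a - s)"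
    using sq[of "a + \<delta>" s] sq[of a s] assms(5) s(1) by simp
  also have "\<dots> = cos (s - a)"
    by (metis cos_minus minus_diff_eq)
  finally have c: "cos (a + \<delta> - s) = cos (s - a)" .
  have "a + \<delta> - s = s - a"
    by (rule cos_inj_pi[OF _ _ _ _ c]) (use as assms(3) in linarith)+
  then have "s = a + \<delta> / 2"
    by (simp add: field_simps)
  then show ?thesis
    using s(1) by simp
qed

text \<open>Preimages of circle points lie on the circle, which forces \<open>p = - 1\<close> and
  \<open>q = 1\<close>. The claim is then read off from \<open>- 1\<close>, \<open>1\<close> and a
  point of the upper half circle, and carried over by \<open>f\<close>.\<close>

lemma left_half_plane_orient:
  assumes C: "x \<in> unit_circle" "y \<in> unit_circle" "z \<in> unit_circle" and ne: "z \<noteq> x" "z \<noteq> y"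
    and z: "z \<in> left_half_plane x y"
  shows "orient x y z > 0"
proof -
  obtain f p q \<zeta> where f: "disk_isometry f" and pq: "-1 \<le> p" "p < q" "q \<le> 1"
    and fx: "f (complex_of_real p) = x" and fy: "f (complex_of_real q) = y"
    and \<zeta>: "cmod \<zeta> \<le> 1" "Im \<zeta> \<ge> 0" and fz: "z = f \<zeta>"
    using z unfolding left_half_plane_def by blast
  obtain \<alpha> \<beta> where \<alpha>\<beta>: "su11 \<alpha> \<beta>" "f = su11_map \<alpha> \<beta>"
    using f unfolding disk_isometry_def by blast
  have on_circle: "w \<in> unit_circle" if "cmod w \<le> 1" "f w \<in> unit_circle" for w
    using su11_map_unit_circle[OF su11_inverse[OF \<alpha>\<beta>(1)] that(2)] su11_map_inverse[OF \<alpha>\<beta>(1) that(1)] \<alpha>\<beta>(2)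
    by simp
  have "\<bar>p\<bar> = 1" "\<bar>q\<bar> = 1"
    using on_circle[of "complex_of_real p"] on_circle[of "complex_of_real q"] C pq fx fy by auto
  then have pq': "p = - 1" "q = 1"
    using pq by auto
  have \<zeta>C: "\<zeta> \<in> unit_circle"
    using on_circle[of \<zeta>] \<zeta> C fz by simp
  have "Im \<zeta> \<noteq> 0"
  proof
    assume *: "Im \<zeta> = 0"
    then have "\<bar>Re \<zeta>\<bar> = 1"
      using \<zeta>C by (simp add: cmod_def)
    then have "\<zeta> = 1 \<or> \<zeta> = - 1"
      using * by (auto simp: complex_eq_iff)
    then show False
      using ne fx fy fz pq' by auto
  qed
  then have "orient (- 1) 1 \<zeta> > 0"
    using \<zeta> unfolding orient_def by simp
  then have "orient (f (- 1)) (f 1) (f \<zeta>) > 0"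
    using circle_auto_disk_isometry[OF f] \<zeta>C unfolding circle_auto_def by simp
  then show ?thesis
    using fx fy fz pq' by simp
qed

text \<open>A segment is empty unless some isometry brings \<open>x\<close> and \<open>y\<close>
  into standard position; a point of the half-plane supplies such an isometry.\<close>

lemma geodesic_segment_ends:
  assumes "left_half_plane x y \<noteq> {}"
  shows "x \<in> geodesic_segment x y" "y \<in> geodesic_segment x y"
proof -
  obtain f p q where f: "disk_isometry f" and pq: "-1 \<le> p" "p < q" "q \<le> 1"
    and fx: "f (complex_of_real p) = x" and fy: "f (complex_of_real q) = y"
    using assms unfolding left_half_plane_def by blast
  show "x \<in> geodesic_segment x y"
    unfolding geodesic_segment_def mem_Collect_eq
    by (intro exI[of _ f] exI[of _ p] exI[of _ q] exI[of _ p]) (use f pq fx fy in auto)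
  show "y \<in> geodesic_segment x y"
    unfolding geodesic_segment_def mem_Collect_eq
    by (intro exI[of _ f] exI[of _ p] exI[of _ q] exI[of _ q]) (use f pq fx fy in auto)
qed

section \<open>Closure and interior of unions of arc rectangles\<close>

text \<open>A half-open arc consists of the points which can be moved a little counter-clockwise inside the
  closed arc. This recovers the half-open rectangles from the interior of the closed ones.\<close>

lemma eventually_closed_arc_iff:
  assumes "x \<in> unit_circle" "y \<in> unit_circle" "u \<in> unit_circle"
  shows "\<forall>\<^sub>F e in at_right 0. u * cis e \<in> closed_arc x y \<longleftrightarrow> u \<in> half_open_arc x y"
proof -
  obtain a where a: "x = cis a" using assms(1) by (rule unit_circleE)
  obtain b where b: "y = cis b" "a \<le> b" "b < a + 2 * pi" using assms(2) by (rule unit_circle_cis_from)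
  obtain s where s: "u = cis s" "a \<le> s" "s < a + 2 * pi" using assms(3) by (rule unit_circle_cis_from)
  have mem: "cis r \<in> cis ` X \<longleftrightarrow> r \<in> X" if "a \<le> r" "r < a + 2 * pi" "X \<subseteq> {a..<a + 2 * pi}" for r X
    using that by (intro inj_on_image_mem_iff[OF inj_on_cis]) auto
  have "u \<in> half_open_arc x y \<longleftrightarrow> s < b"
    unfolding s(1) a b(1) half_open_arc_cis[OF b(2,3)] using mem[of s "{a..<b}"] s b by auto
  moreover have "u * cis e \<in> closed_arc x y \<longleftrightarrow> s + e \<le> b" if "0 < e" "s + e < a + 2 * pi" for e
  proof -
    have sub: "{a..b} \<subseteq> {a..<a + 2 * pi}"
      using b by auto
    show ?thesis
      unfolding s(1) a b(1) closed_arc_cis[OF b(2,3)] cis_mult using mem[OF _ that(2) sub] s b that by simp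
  qed
  \<comment> \<open>For \<open>s < b\<close> the moved point stays in the arc until it reaches
    \<open>b\<close>. Otherwise it is outside until it has come round to \<open>a\<close>; this
    includes \<open>s = b\<close>, the end point that the half-open arc omits.\<close>
  ultimately have "u * cis e \<in> closed_arc x y \<longleftrightarrow> u \<in> half_open_arc x y"
    if "0 < e" "e < (if s < b then b - s else a + 2 * pi - s)" for e
    using that b by (auto split: if_splits)
  then show ?thesis
    by (intro eventually_at_rightI[of 0 "if s < b then b - s else a + 2 * pi - s"]) (use s in auto)
qed

lemma closed_arc_subset_closure:
  assumes "x \<in> unit_circle" "y \<in> unit_circle" "x \<noteq> y"
  shows "closed_arc x y \<subseteq> closure (half_open_arc x y)"
proof -
  obtain a where a: "x = cis a" using assms(1) by (rule unit_circleE)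
  obtain b where b: "y = cis b" "a \<le> b" "b < a + 2 * pi" using assms(2) by (rule unit_circle_cis_from)
  have "a < b"
    using assms(3) a b by (cases "a = b") auto
  then have "{a..b} = closure {a..<b}"
    by simp
  moreover have "cis ` closure {a..<b} \<subseteq> closure (cis ` {a..<b})"
    by (intro image_closure_subset closure_subset continuous_intros closed_closure) 
  ultimately show ?thesis
    unfolding a b(1) closed_arc_cis[OF b(2,3)] half_open_arc_cis[OF b(2,3)] by simp
qed

lemma rect_union_closed_closure:
  assumes "(x, y, z, w) \<in> Q" "x \<in> unit_circle" "y \<in> unit_circle" "z \<in> unit_circle" "w \<in> unit_circle"
    and "x \<noteq> y" "z \<noteq> w"
  shows "closed_arc x y \<times> closed_arc z w \<subseteq> closure (rect_union half_open_arc Q)"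
proof -
  have "closed_arc x y \<times> closed_arc z w \<subseteq> closure (half_open_arc x y \<times> half_open_arc z w)"
    unfolding closure_Times using closed_arc_subset_closure assms by (intro Sigma_mono) auto
  also have "\<dots> \<subseteq> closure (rect_union half_open_arc Q)"
    unfolding rect_union_def using assms(1) by (intro closure_mono) auto
  finally show ?thesis .
qed

lemma rect_union_half_open_subset: "rect_union half_open_arc Q \<subseteq> rect_union closed_arc Q"
  unfolding rect_union_def by (intro UN_mono) (auto intro: subsetD[OF half_open_subset_closed_arc])

lemma interior_rect_union_closed:
  assumes fin: "finite Q"
    and Q: "\<And>x y z w. (x, y, z, w) \<in> Q \<Longrightarrow>
      x \<in> unit_circle \<and> y \<in> unit_circle \<and> z \<in> unit_circle \<and> w \<in> unit_circle"
  shows "(top_of_set (unit_circle \<times> unit_circle)) interior_of (rect_union closed_arc Q)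
    \<subseteq> rect_union half_open_arc Q"
proof
  fix p assume "p \<in> (top_of_set (unit_circle \<times> unit_circle)) interior_of (rect_union closed_arc Q)"
  then obtain U where U: "openin (top_of_set (unit_circle \<times> unit_circle)) U" "p \<in> U"
    "U \<subseteq> rect_union closed_arc Q"
    unfolding interior_of_def by blast
  obtain W where W: "open W" "U = (unit_circle \<times> unit_circle) \<inter> W"
    using U(1) unfolding openin_open by blast
  obtain u w where p: "p = (u, w)"
    by force
  have uw: "u \<in> unit_circle" "w \<in> unit_circle"
    using U(2) unfolding W(2) p by auto
  have "((\<lambda>e. (u * cis e, w * cis e)) \<longlongrightarrow> (u * cis 0, w * cis 0)) (at_right 0)"
    by (intro tendsto_intros)
  then have "\<forall>\<^sub>F e in at_right 0. (u * cis e, w * cis e) \<in> W"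
    using W U(2) p by (intro topological_tendstoD) auto
  then have "\<forall>\<^sub>F e in at_right 0. (u * cis e, w * cis e) \<in> rect_union closed_arc Q"
    by (rule eventually_mono) (use U(3) uw in \<open>auto simp: W(2) norm_mult\<close>)
  \<comment> \<open>Both coordinates are moved by the same \<open>e\<close>; finiteness of
    \<open>Q\<close> lets one small \<open>e\<close> serve all rectangles at once.\<close>
  moreover have "\<forall>\<^sub>F e in at_right 0. \<forall>(x, y, z, v)\<in>Q.
      (u * cis e \<in> closed_arc x y \<longleftrightarrow> u \<in> half_open_arc x y)
      \<and> (w * cis e \<in> closed_arc z v \<longleftrightarrow> w \<in> half_open_arc z v)"
  proof (rule eventually_ball_finite[OF fin], rule ballI)
    fix q assume "q \<in> Q"
    moreover obtain x y z v where "q = (x, y, z, v)"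
      by (cases q)
    ultimately show "\<forall>\<^sub>F e in at_right 0. case q of (x, y, z, v) \<Rightarrow>
      (u * cis e \<in> closed_arc x y \<longleftrightarrow> u \<in> half_open_arc x y)
      \<and> (w * cis e \<in> closed_arc z v \<longleftrightarrow> w \<in> half_open_arc z v)"
      using Q uw eventually_closed_arc_iff by (auto intro!: eventually_conj simp del: mem_sphere_0)
  qed
  ultimately have "\<forall>\<^sub>F e::real in at_right 0. p \<in> rect_union half_open_arc Q"
  proof eventually_elim
    case (elim e)
    then obtain x y z v where q: "(x, y, z, v) \<in> Q" "u * cis e \<in> closed_arc x y" "w * cis e \<in> closed_arc z v"
      unfolding rect_union_def by auto
    then have "u \<in> half_open_arc x y" "w \<in> half_open_arc z v"
      using bspec[OF elim(2) q(1)] by auto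
    then show ?case
      unfolding rect_union_def p using q(1) by (intro UN_I[of "(x, y, z, v)"]) auto
  qed
  then show "p \<in> rect_union half_open_arc Q"
    by simp
qed

definition map_quad :: "(complex \<Rightarrow> complex) \<Rightarrow> complex \<times> complex \<times> complex \<times> complex
    \<Rightarrow> complex \<times> complex \<times> complex \<times> complex" where
  "map_quad h = map_prod h (map_prod h (map_prod h h))"

lemma rect_union_image:
  assumes h: "circle_auto h"
    and Q: "\<And>x y z w. (x, y, z, w) \<in> Q \<Longrightarrow>
      x \<in> unit_circle \<and> y \<in> unit_circle \<and> z \<in> unit_circle \<and> w \<in> unit_circle"
    and ar: "ar = closed_arc \<or> ar = half_open_arc"
  shows "map_prod h h ` rect_union ar Q = rect_union ar (map_quad h ` Q)"
proof -
  have *: "map_prod h h ` (ar x y \<times> ar z w) = ar (h x) (h y) \<times> ar (h z) (h w)" if "(x, y, z, w) \<in> Q" for x y z w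
  proof (rule map_prod_surj_on)
    show "h ` ar x y = ar (h x) (h y)"
      using ar circle_auto_arc(2,3)[OF h, of x y] Q[OF that] by (elim disjE) simp_all
    show "h ` ar z w = ar (h z) (h w)"
      using ar circle_auto_arc(2,3)[OF h, of z w] Q[OF that] by (elim disjE) simp_all
  qed
  show ?thesis
    unfolding rect_union_def map_quad_def image_UN image_image
  proof (rule SUP_cong[OF refl])
    fix q assume "q \<in> Q"
    moreover obtain x y z w where "q = (x, y, z, w)"
      by (cases q)
    ultimately show "map_prod h h ` (case q of (x, y, z, w) \<Rightarrow> ar x y \<times> ar z w)
        = (case map_prod h (map_prod h (map_prod h h)) q of (x, y, z, w) \<Rightarrow> ar x y \<times> ar z w)"
      using * by simp
  qed
qed

lemma map_quad_unit_circle: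
  assumes h: "circle_auto h"
    and Q: "\<And>x y z w. (x, y, z, w) \<in> Q \<Longrightarrow>
      x \<in> unit_circle \<and> y \<in> unit_circle \<and> z \<in> unit_circle \<and> w \<in> unit_circle"
    and "(x, y, z, w) \<in> map_quad h ` Q"
  shows "x \<in> unit_circle \<and> y \<in> unit_circle \<and> z \<in> unit_circle \<and> w \<in> unit_circle"
proof -
  obtain x' y' z' w' where *: "(x', y', z', w') \<in> Q" "x = h x'" "y = h y'" "z = h z'" "w = h w'"
    using assms(3) unfolding map_quad_def by auto
  show ?thesis
    using Q[OF *(1)] circle_auto_mem[OF h] unfolding *(2-5) by blast
qed

section \<open>The sectors of the canonical polygon\<close>

definition sector_rects ::
  "nat \<Rightarrow> nat list \<Rightarrow> nat \<Rightarrow> (nat \<Rightarrow> complex) \<Rightarrow> (nat \<Rightarrow> complex \<Rightarrow> complex) \<Rightarrow> nat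
     \<Rightarrow> (complex \<times> complex \<times> complex \<times> complex) set" where
  "sector_rects g ms t A \<gamma> n =
    (let l = num_sectors g ms t in
     if n \<le> g then square_rects l
     else if n \<le> g + length ms then
       (let m = ms ! (n - g - 1); k = 4 * g + 2 * (n - g) - 1 in
        if m = 2 then two_rects l
        else elliptic_rects l m (rot_inv l n \<circ> \<gamma> k \<circ> rot l n) (rot_inv l n (A k)))
     else cusp_rects l)"

lemma Omega_sector_rects:
  "Omega_sector ar g ms t A \<gamma> n = rect_union ar (sector_rects g ms t A \<gamma> n)"
  unfolding Omega_sector_def sector_rects_def Let_def
  by (simp add: Omega_square_rects Omega_two_rects Omega_cusp_rects Omega_elliptic_rects)

lemma circle_auto_rot: "circle_auto (rot l n)"
  unfolding rot_def[abs_def] by (rule circle_auto_mult) simp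

lemma circle_auto_rot_inv: "circle_auto (rot_inv l n)"
  unfolding rot_inv_def[abs_def] by (rule circle_auto_mult) simp

lemma rot_rot_inv [simp]: "rot l n (rot_inv l n z) = z" "rot_inv l n (rot l n z) = z"
  unfolding rot_def rot_inv_def by (simp_all add: cis_mult flip: mult.assoc)

lemma rot_cis: "rot l n (cis s) = cis (2 * pi / l * (real n - 1) + s)"
  by (simp add: rot_def cis_mult)

section \<open>The polygon: sectors, vertices and side maps\<close>

locale polygon =
  fixes g t :: nat and ms :: "nat list" and V A :: "nat \<Rightarrow> complex" and \<gamma> :: "nat \<Rightarrow> complex \<Rightarrow> complex"
  assumes sig: "signature g ms t" and t: "t \<ge> 1"
    and poly: "canonical_polygon g ms t V \<gamma>"
    and adm: "admissible_partition (num_sides g ms t) V A"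
begin

definition "l = num_sectors g ms t"
definition "N = num_sides g ms t"
definition "\<delta> = 2 * pi / real l"

text \<open>Angles are used instead of \<open>half_open_arc\<close> between the end vertices: for
  \<open>l = 1\<close> these coincide and the arc would be empty, while the sector is the whole
  circle.\<close>

definition sector :: "nat \<Rightarrow> complex set" where
  "sector n = cis ` {\<delta> * (real n - 1)..<\<delta> * real n}"

lemma l_eq: "l = g + (length ms + (t - 1))" and N_eq: "N = 4 * g + 2 * (l - g)"
  using t unfolding l_def N_def num_sectors_def num_sides_def by auto

text \<open>The excluded signatures violate the positivity condition: without any sector its left
  side is -1, and with a single sector that is elliptic or a cusp it is \<open>- 1 / m\<close> or 0.
  Hence an elliptic or cusp sector has angle at most \<open>pi\<close>.\<close>

lemma l_pos: "1 \<le> l" and l_ge_2: "g < l \<Longrightarrow> 2 \<le> l"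
proof -
  have sum1: "2 * real g - 2 + (\<Sum>m\<leftarrow>ms. 1 - 1 / real m) + real t > 0"
    using sig unfolding signature_def by blast
  show "1 \<le> l"
  proof (rule ccontr)
    assume "\<not> 1 \<le> l"
    then have "g = 0 \<and> length ms = 0 \<and> t = 1"
      using l_eq t by linarith
    then show False
      using sum1 by simp
  qed
  show "2 \<le> l" if "g < l"
  proof (rule ccontr)
    assume "\<not> 2 \<le> l"
    then have "g = 0 \<and> (length ms = 1 \<and> t = 1 \<or> length ms = 0 \<and> t = 2)"
      using l_eq t that by linarith
    then show False
      using sum1 by (auto simp: length_Suc_conv)
  qed
qed

lemma \<delta>: "0 < \<delta>" "\<delta> * real l = 2 * pi" "g < l \<Longrightarrow> \<delta> \<le> pi"
proof -
  show "0 < \<delta>" "\<delta> * real l = 2 * pi"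
    using l_pos by (auto simp: \<delta>_def)
  assume "g < l"
  then have "2 \<le> real l"
    using l_ge_2 by simp
  then show "\<delta> \<le> pi"
    unfolding \<delta>_def by (simp add: field_simps)
qed

lemma vpow_eq: "vpow l \<alpha> = cis (\<delta> * \<alpha> / 2)"
  by (simp add: vpow_def \<delta>_def mult_ac)

lemma rot_eq: "rot l n (cis s) = cis (\<delta> * (real n - 1) + s)"
  by (simp add: rot_cis \<delta>_def)

lemma V_0: "V 0 = 1" and V_N: "V N = V 0"
  using poly unfolding canonical_polygon_def convex_polygon_def Let_def N_def by blast+

lemma V_square: "k < g \<Longrightarrow> i \<le> 4 \<Longrightarrow> V (4 * k + i) = cis (\<delta> * (real k + real i / 4))"
  using poly unfolding canonical_polygon_def Let_def \<delta>_def l_def by blast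

lemma V_even: "j \<le> l - g \<Longrightarrow> V (4 * g + 2 * j) = cis (\<delta> * real (g + j))"
proof -
  assume j: "j \<le> l - g"
  have "\<forall>k\<le>g. V (4 * k) = cis (2 * pi / real (num_sectors g ms t) * real k)"
    and *: "\<forall>j\<in>{1..length ms + t - 1}. V (4 * g + 2 * j) = cis (2 * pi / real (num_sectors g ms t) * real (g + j))"
    using poly unfolding canonical_polygon_def Let_def by blast+
  then have "V (4 * g) = cis (\<delta> * real g)"
    unfolding \<delta>_def l_def by blast
  moreover have "V (4 * g + 2 * j) = cis (\<delta> * real (g + j))" if "j \<noteq> 0"
    using bspec[OF *, of j] that j l_eq t unfolding \<delta>_def l_def by auto
  ultimately show ?thesis
    by (cases "j = 0") auto
qed

lemma square_sides:
  assumes "n \<in> {1..g}"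
  defines "q \<equiv> 4 * n - 4"
  shows "disk_isometry (\<gamma> (q + 1))" "disk_isometry (\<gamma> (q + 2))" "disk_isometry (\<gamma> (q + 3))" "disk_isometry (\<gamma> (q + 4))"
    and "\<gamma> (q + 1) (V q) = V (q + 3)" "\<gamma> (q + 1) (V (q + 1)) = V (q + 2)"
    and "\<gamma> (q + 4) (V (q + 3)) = V (q + 2)" "\<gamma> (q + 4) (V (q + 4)) = V (q + 1)"
    and "inverse_on_disk (\<gamma> (q + 3)) (\<gamma> (q + 1))" "inverse_on_disk (\<gamma> (q + 2)) (\<gamma> (q + 4))"
proof -
  have "\<forall>k\<in>{1..g}. let q = 4 * k - 4 in
          hyperbolic (\<gamma> (q + 1)) \<and> \<gamma> (q + 1) (V q) = V (q + 3) \<and> \<gamma> (q + 1) (V (q + 1)) = V (q + 2)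
        \<and> hyperbolic (\<gamma> (q + 4)) \<and> \<gamma> (q + 4) (V (q + 3)) = V (q + 2) \<and> \<gamma> (q + 4) (V (q + 4)) = V (q + 1)
        \<and> disk_isometry (\<gamma> (q + 3)) \<and> inverse_on_disk (\<gamma> (q + 3)) (\<gamma> (q + 1))
        \<and> disk_isometry (\<gamma> (q + 2)) \<and> inverse_on_disk (\<gamma> (q + 2)) (\<gamma> (q + 4))"
    using poly unfolding canonical_polygon_def Let_def by blast
  note * = bspec[OF this assms(1), unfolded Let_def, folded q_def]
  show "disk_isometry (\<gamma> (q + 1))" "disk_isometry (\<gamma> (q + 4))"
    using * unfolding hyperbolic_def disk_isometry_def by blast+
  show "disk_isometry (\<gamma> (q + 2))" "disk_isometry (\<gamma> (q + 3))"
    "\<gamma> (q + 1) (V q) = V (q + 3)" "\<gamma> (q + 1) (V (q + 1)) = V (q + 2)"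
    "\<gamma> (q + 4) (V (q + 3)) = V (q + 2)" "\<gamma> (q + 4) (V (q + 4)) = V (q + 1)"
    "inverse_on_disk (\<gamma> (q + 3)) (\<gamma> (q + 1))" "inverse_on_disk (\<gamma> (q + 2)) (\<gamma> (q + 4))"
    using * by blast+
qed

text \<open>The two sides of the \<open>j\<close>-th pair after the quadruples lie in sector \<open>g + j\<close>; \<open>mid j\<close> is the index of
  their common vertex.\<close>

definition "mid j = 4 * g + 2 * j - 1"

lemma mid: "1 \<le> j \<Longrightarrow> mid j = 4 * g + 2 * (j - 1) + 1" "1 \<le> j \<Longrightarrow> mid j - 1 = 4 * g + 2 * (j - 1)"
  "1 \<le> j \<Longrightarrow> mid j + 1 = 4 * g + 2 * j"
  unfolding mid_def by auto

lemma V_mid: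
  assumes "1 \<le> j" "j \<le> l - g"
  shows "V (mid j - 1) = cis (\<delta> * (real (g + j) - 1))" "V (mid j + 1) = cis (\<delta> * real (g + j))"
  using V_even[of "j - 1"] V_even[of j] assms mid(2,3)[of j] by (simp_all add: of_nat_diff)

lemma elliptic_sides:
  assumes "i \<in> {1..length ms}"
  shows "V (mid i) \<in> ball 0 1"
    "has_interior_angle (V (mid i - 1)) (V (mid i)) (V (mid i + 1)) (2 * pi / real (ms ! (i - 1)))"
    "disk_isometry (\<gamma> (mid i))" "\<gamma> (mid i) (V (mid i)) = V (mid i)"
    "\<gamma> (mid i) (V (mid i - 1)) = V (mid i + 1)"
    "disk_isometry (\<gamma> (mid i + 1))" "inverse_on_disk (\<gamma> (mid i + 1)) (\<gamma> (mid i))"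
proof -
  have "\<forall>i\<in>{1..length ms}. let k = 4 * g + 2 * i - 1 in
          V k \<in> ball 0 1
        \<and> has_interior_angle (V (k - 1)) (V k) (V (k + 1)) (2 * pi / real (ms ! (i - 1)))
        \<and> elliptic (\<gamma> k) \<and> \<gamma> k (V k) = V k \<and> \<gamma> k (V (k - 1)) = V (k + 1)
        \<and> disk_isometry (\<gamma> (k + 1)) \<and> inverse_on_disk (\<gamma> (k + 1)) (\<gamma> k)"
    using poly unfolding canonical_polygon_def Let_def by blast
  note * = bspec[OF this assms(1), unfolded Let_def, folded mid_def]
  show "disk_isometry (\<gamma> (mid i))"
    using * unfolding elliptic_def disk_isometry_def by blast
  show "V (mid i) \<in> ball 0 1"
    "has_interior_angle (V (mid i - 1)) (V (mid i)) (V (mid i + 1)) (2 * pi / real (ms ! (i - 1)))"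
    "\<gamma> (mid i) (V (mid i)) = V (mid i)"
    "\<gamma> (mid i) (V (mid i - 1)) = V (mid i + 1)"
    "disk_isometry (\<gamma> (mid i + 1))" "inverse_on_disk (\<gamma> (mid i + 1)) (\<gamma> (mid i))"
    using * by blast+
qed

lemma cusp_sides:
  assumes "length ms < j" "j \<le> l - g"
  shows "V (mid j) \<in> unit_circle" "disk_isometry (\<gamma> (mid j))" "\<gamma> (mid j) (V (mid j)) = V (mid j)"
    "\<gamma> (mid j) (V (mid j - 1)) = V (mid j + 1)"
    "disk_isometry (\<gamma> (mid j + 1))" "inverse_on_disk (\<gamma> (mid j + 1)) (\<gamma> (mid j))"
proof -
  have "\<forall>j\<in>{1..t - 1}. let k = 4 * g + 2 * length ms + 2 * j - 1 in
          V k \<in> sphere 0 1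
        \<and> parabolic (\<gamma> k) \<and> \<gamma> k (V k) = V k \<and> \<gamma> k (V (k - 1)) = V (k + 1)
        \<and> disk_isometry (\<gamma> (k + 1)) \<and> inverse_on_disk (\<gamma> (k + 1)) (\<gamma> k)"
    using poly unfolding canonical_polygon_def Let_def by blast
  moreover have "j - length ms \<in> {1..t - 1}"
    using assms l_eq by auto
  moreover have "4 * g + 2 * length ms + 2 * (j - length ms) - 1 = mid j"
    using assms unfolding mid_def by auto
  ultimately have *: "V (mid j) \<in> sphere 0 1
        \<and> parabolic (\<gamma> (mid j)) \<and> \<gamma> (mid j) (V (mid j)) = V (mid j) \<and> \<gamma> (mid j) (V (mid j - 1)) = V (mid j + 1)
        \<and> disk_isometry (\<gamma> (mid j + 1)) \<and> inverse_on_disk (\<gamma> (mid j + 1)) (\<gamma> (mid j))"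
    unfolding Let_def by metis
  show "disk_isometry (\<gamma> (mid j))"
    using * unfolding parabolic_def disk_isometry_def by blast
  show "V (mid j) \<in> unit_circle" "\<gamma> (mid j) (V (mid j)) = V (mid j)"
    "\<gamma> (mid j) (V (mid j - 1)) = V (mid j + 1)"
    "disk_isometry (\<gamma> (mid j + 1))" "inverse_on_disk (\<gamma> (mid j + 1)) (\<gamma> (mid j))"
    using * by blast+
qed

lemma V_cusp:
  assumes j: "length ms < j" "j \<le> l - g"
  shows "V (mid j) = cis (\<delta> * (real (g + j) - 1) + \<delta> / 2)"
proof -
  let ?k = "mid j"
  let ?a = "\<delta> * (real (g + j) - 1)"
  note cusp = cusp_sides[OF j]
  have gl: "g < l"
    using j by auto
  have Vk: "V (?k - 1) = cis ?a" "V (?k + 1) = cis (?a + \<delta>)"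
    using V_mid[of j] j by (simp_all add: algebra_simps)
  have kN: "?k \<in> {1..N}" "?k + 1 \<le> N" "1 \<le> j"
    using j N_eq unfolding mid_def by auto
  have half_planes: "\<forall>k\<in>{1..N}. \<forall>j\<in>{0..N}. V j \<in> left_half_plane (V (k - 1)) (V k)"
    using poly unfolding canonical_polygon_def convex_polygon_def Let_def N_def by blast
  have V_side: "V (?k - 1) \<in> geodesic_segment (V (?k - 1)) (V ?k)" "V ?k \<in> geodesic_segment (V (?k - 1)) (V ?k)"
    using geodesic_segment_ends half_planes kN by fastforce+
  have "\<forall>k\<in>{1..N}.
          (l = 2 \<and> (\<exists>i\<in>{1..length ms}. ms ! (i - 1) = 2 \<and> k \<in> {4 * g + 2 * i - 1, 4 * g + 2 * i}))
        \<or> (\<gamma> k 0 \<noteq> 0 \<and> geodesic_segment (V (k - 1)) (V k) \<subseteq> isometric_circle (\<gamma> k))"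
    using poly unfolding canonical_polygon_def Let_def N_def l_def by blast
  note circles = bspec[OF this kN(1)]
  \<comment> \<open>The pairs on a diameter have indices \<open>i \<le> length ms\<close>; a cusp
    pair comes after all of them, so the isometric circle alternative applies.\<close>
  have "?k \<notin> {4 * g + 2 * i - 1, 4 * g + 2 * i}" if "i \<in> {1..length ms}" for i
    using that j(1) unfolding mid_def by auto
  then have isom: "geodesic_segment (V (?k - 1)) (V ?k) \<subseteq> isometric_circle (\<gamma> ?k)"
    using circles by (elim disjE conjE bexE) blast+
  have dist: "cmod (V (?k + 1) - V ?k) = cmod (V (?k - 1) - V ?k)"
  proof -
    have "V (?k - 1) \<in> unit_circle"
      by (simp only: Vk cis_in_unit_circle)
    then show ?thesis
      using isometric_circle_fixpoint_dist[OF cusp(2) _ cusp(1,3)] subsetD[OF isom V_side(1)] subsetD[OF isom V_side(2)]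
      unfolding cusp(4)[symmetric] by blast
  qed
  have ne: "V (?k - 1) \<noteq> V (?k + 1)"
    unfolding Vk using cis_distinct[of ?a "?a + \<delta>"] \<delta>(1) \<delta>(3)[OF gl] by auto
  \<comment> \<open>If the cusp coincided with this neighbour, equidistance would make it coincide
    with the other one too.\<close>
  then have "V (?k + 1) \<noteq> V ?k"
    using dist by auto
  moreover have "V (?k + 1) \<in> left_half_plane (V (?k - 1)) (V ?k)"
    using bspec[OF bspec[OF half_planes kN(1)], of "?k + 1"] kN(2) by simp
  moreover have "V (?k - 1) \<in> unit_circle" "V (?k + 1) \<in> unit_circle"
    by (simp_all only: Vk cis_in_unit_circle)
  \<comment> \<open>Two points of the circle are equidistant from both neighbours; convexity selects
    the one between them inside the sector.\<close>
  ultimately have "orient (V (?k - 1)) (V ?k) (V (?k + 1)) > 0"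
    using ne cusp(1) left_half_plane_orient by metis
  then show ?thesis
    using equidistant_between[OF cusp(1) \<delta>(1) \<delta>(3)[OF gl]] dist unfolding Vk by blast
qed

lemma N_ge_2: "2 \<le> N"
  using N_eq l_pos by linarith

lemma A_ideal: "k \<le> N \<Longrightarrow> V k \<in> unit_circle \<Longrightarrow> A k = V k"
proof -
  assume k: "k \<le> N" "V k \<in> unit_circle"
  have *: "A 0 = A N" "\<forall>k\<in>{1..N}. V k \<in> unit_circle \<longrightarrow> A k = V k"
    using adm unfolding admissible_partition_def N_def[symmetric] by blast+
  have "A N = V N"
    using bspec[OF *(2), of N] N_ge_2 V_N V_0 by simp
  then show ?thesis
    using * k V_N by (cases "k = 0") auto
qed

lemma A_mid:
  assumes "1 \<le> j" "j \<le> l - g"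
  shows "A (mid j) \<in> open_arc (V (mid j - 1)) (V (mid j + 1))"
proof (cases "j \<le> length ms")
  case True
  have "mid j \<in> {1..N}"
    using assms N_eq unfolding mid_def by auto
  then show ?thesis
    using adm elliptic_sides(1)[of j] assms True unfolding admissible_partition_def N_def[symmetric] by auto
next
  case False
  then have "V (mid j) = cis (\<delta> * (real (g + j) - 1) + \<delta> / 2)"
    using V_cusp assms by simp
  moreover have "mid j \<le> N"
    using assms N_eq unfolding mid_def by auto
  ultimately have "A (mid j) = cis (\<delta> * (real (g + j) - 1) + \<delta> / 2)"
    using A_ideal by simp
  moreover have "\<delta> * real (g + j) = \<delta> * (real (g + j) - 1) + \<delta>"
    by (simp add: algebra_simps)
  moreover have "\<delta> \<le> pi"
    using \<delta>(3) assms by simp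
  ultimately show ?thesis
    unfolding V_mid[OF assms] using \<delta>(1) by (subst open_arc_cis) auto
qed

lemma A_even: "j \<le> l - g \<Longrightarrow> A (4 * g + 2 * j) = V (4 * g + 2 * j)"
  using A_ideal[of "4 * g + 2 * j"] V_even[of j] N_eq by simp

lemma A_square:
  assumes "k < g" "i \<le> 4"
  shows "A (4 * k + i) = V (4 * k + i)"
  using A_ideal[of "4 * k + i"] V_square[OF assms] N_eq assms by simp

section \<open>The partition points as increasing angles\<close>

text \<open>A lift of the partition points to \<open>[0, 2 * pi]\<close> in which
  \<open>A 0 = A N\<close> has the angle 0 as first point and \<open>2 * pi\<close> as last one. Odd
  indices beyond the quadruples belong to elliptic vertices and cusps, where the angle is read off
  from \<open>A\<close>.\<close>

definition angle :: "nat \<Rightarrow> real" where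
  "angle k = (if k \<le> 4 * g then \<delta> * (real k / 4)
     else if even k then \<delta> * (real g + real (k - 4 * g) / 2) else Arg2pi (A k))"

lemma angle_square: "k \<le> 4 * g \<Longrightarrow> A k = cis (angle k)"
proof -
  assume k: "k \<le> 4 * g"
  show ?thesis
  proof (cases "k = 4 * g")
    case True
    then show ?thesis
      using A_even[of 0] V_even[of 0] by (simp add: angle_def)
  next
    case False
    then have "k div 4 < g" "k mod 4 \<le> 4"
      using k by auto
    moreover have "real k = 4 * real (k div 4) + real (k mod 4)"
      by (metis mult_div_mod_eq of_nat_add of_nat_mult of_nat_numeral)
    ultimately show ?thesis
      using A_square[of "k div 4" "k mod 4"] V_square[of "k div 4" "k mod 4"] k
      by (simp add: angle_def add_divide_distrib)
  qed
qed

lemma angle_even: "j \<le> l - g \<Longrightarrow> angle (4 * g + 2 * j) = \<delta> * real (g + j)"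
  by (cases "j = 0") (auto simp: angle_def)

lemma angle_mid:
  assumes "1 \<le> j" "j \<le> l - g"
  shows "A (mid j) = cis (angle (mid j))"
    and "\<delta> * (real (g + j) - 1) < angle (mid j)" "angle (mid j) < \<delta> * real (g + j)"
proof -
  let ?a = "\<delta> * (real (g + j) - 1)" and ?b = "\<delta> * real (g + j)"
  have ab: "?a \<le> ?b" "?b < ?a + 2 * pi"
  proof -
    have "\<delta> \<le> pi"
      using \<delta>(3) assms by simp
    then have "\<delta> < 2 * pi"
      using pi_gt_zero by linarith
    then show "?a \<le> ?b" "?b < ?a + 2 * pi"
      using \<delta>(1) by (auto simp: algebra_simps)
  qed
  have "A (mid j) \<in> cis ` {?a<..<?b}"
    using A_mid[OF assms] unfolding V_mid[OF assms] open_arc_cis[OF ab] .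
  then obtain s where s: "A (mid j) = cis s" "?a < s" "s < ?b"
    by auto
  have "0 \<le> ?a"
    using \<delta>(1) assms by simp
  moreover have "?b \<le> 2 * pi"
    unfolding \<delta>(2)[symmetric] using \<delta>(1) assms by simp
  ultimately have "angle (mid j) = s"
    using s assms Arg2pi_cis[of s] unfolding angle_def mid_def by auto
  then show "A (mid j) = cis (angle (mid j))" "?a < angle (mid j)" "angle (mid j) < ?b"
    using s by auto
qed

lemma side_cases:
  assumes "k \<in> {1..N}"
  obtains (square) "k \<le> 4 * g"
    | (left) j where "1 \<le> j" "j \<le> l - g" "k = mid j"
    | (right) j where "1 \<le> j" "j \<le> l - g" "k = mid j + 1"
proof (cases "k \<le> 4 * g")
  case False
  define j where "j = (k - 4 * g + 1) div 2"
  have "1 \<le> j" "j \<le> l - g" "k = mid j \<or> k = mid j + 1"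
    using False assms N_eq unfolding j_def mid_def by auto
  then show thesis
    using that by blast
qed (rule that(1))

lemma angle_step: "k \<in> {1..N} \<Longrightarrow> angle (k - 1) < angle k"
proof -
  assume "k \<in> {1..N}"
  then show ?thesis
  proof (cases rule: side_cases)
    case square
    then show ?thesis
      using \<open>k \<in> {1..N}\<close> \<delta>(1) by (auto simp: angle_def)
  next
    case (left j)
    then show ?thesis
      using angle_mid(2)[of j] angle_even[of "j - 1"] mid(2)[of j] by (simp add: of_nat_diff)
  next
    case (right j)
    then show ?thesis
      using angle_mid(3)[of j] angle_even[of j] mid(3)[of j] by (metis add_diff_cancel_right')
  qed
qed

lemma A_angle: "k \<le> N \<Longrightarrow> A k = cis (angle k)"
proof (cases "k = 0")
  case True
  then show ?thesis
    using angle_square[of 0] by simp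
next
  case False
  assume "k \<le> N"
  then have "k \<in> {1..N}"
    using False by simp
  then show ?thesis
  proof (cases rule: side_cases)
    case square
    then show ?thesis by (rule angle_square)
  next
    case (left j)
    then show ?thesis
      using angle_mid(1) by simp
  next
    case (right j)
    then show ?thesis
      using angle_even[of j] A_even[of j] V_even[of j] mid(3)[of j] by simp
  qed
qed

lemma angle_mono: "i \<le> j \<Longrightarrow> j \<le> N \<Longrightarrow> angle i \<le> angle j"
proof (induction j rule: dec_induct)
  case (step j)
  then show ?case
    using angle_step[of "Suc j"] by simp
qed simp

lemma angle_0: "angle 0 = 0" and angle_N: "angle N = 2 * pi"
proof -
  have "g + (l - g) = l"
    using l_eq by simp
  then show "angle N = 2 * pi"
    unfolding N_eq angle_even[OF order_refl] \<delta>(2)[symmetric] by simp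
qed (simp add: angle_def)

lemma side_arc:
  assumes "k \<in> {1..N}"
  shows "half_open_arc (A (k - 1)) (A k) = cis ` {angle (k - 1)..<angle k}"
proof -
  \<comment> \<open>An arc of a full turn would be read as empty. With at least two sides, the last
    side starts at a positive angle and every other side ends before \<open>2 * pi\<close>.\<close>
  have "angle k < angle (k - 1) + 2 * pi"
  proof (cases "k = N")
    case True
    have "1 \<le> N - 1" "1 \<in> {1..N}"
      using N_ge_2 by auto
    then have "0 < angle (k - 1)"
      using angle_step[of 1] angle_mono[of 1 "N - 1"] True angle_0 by simp
    then show ?thesis
      using True angle_N by simp
  next
    case False
    then have "angle k < 2 * pi"
      using angle_step[of "Suc k"] angle_mono[of "Suc k" N] assms angle_N by simp
    then show ?thesis
      using angle_mono[of 0 "k - 1"] assms angle_0 by fastforce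
  qed
  then show ?thesis
    using A_angle[of k] A_angle[of "k - 1"] angle_step[OF assms] assms half_open_arc_cis[of "angle (k - 1)" "angle k"]
    by (metis atLeastAtMost_iff diff_le_self le_trans less_imp_le)
qed

lemma side_unique:
  assumes k: "k \<in> {1..N}" "k' \<in> {1..N}"
    and w: "w \<in> half_open_arc (A (k - 1)) (A k)" "w \<in> half_open_arc (A (k' - 1)) (A k')"
  shows "k = k'"
proof (rule ccontr)
  have N: "k - 1 \<le> N" "k' - 1 \<le> N" "k \<le> N" "k' \<le> N"
    using k by auto
  obtain s where s: "w = cis s" "angle (k - 1) \<le> s" "s < angle k"
    using w(1) unfolding side_arc[OF k(1)] by auto
  obtain s' where s': "w = cis s'" "angle (k' - 1) \<le> s'" "s' < angle k'"
    using w(2) unfolding side_arc[OF k(2)] by auto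
  have "0 \<le> s" "s < 2 * pi" "0 \<le> s'" "s' < 2 * pi"
    using N s s' angle_mono[of 0 "k - 1"] angle_mono[of 0 "k' - 1"] angle_mono[of k N] angle_mono[of k' N]
      angle_0 angle_N by linarith+
  then have ss: "s = s'"
    using Arg2pi_cis[of s] Arg2pi_cis[of s'] s(1) s'(1) by simp
  assume "k \<noteq> k'"
  then consider "k' \<le> k - 1" | "k \<le> k' - 1"
    by linarith
  then show False
  proof cases
    case 1
    show False
      using angle_mono[OF 1 N(1)] ss s s' by simp
  next
    case 2
    show False
      using angle_mono[OF 2 N(2)] ss s s' by simp
  qed
qed

lemma nat_ext_side:
  assumes k: "k \<in> {1..N}" and w: "w \<in> half_open_arc (A (k - 1)) (A k)"
  shows "nat_ext N A \<gamma> (u, w) = (\<gamma> k u, \<gamma> k w)"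
proof -
  have "(THE k. 1 \<le> k \<and> k \<le> N \<and> w \<in> half_open_arc (A (k - 1)) (A k)) = k"
    using k w side_unique[OF _ k] by (intro the_equality) auto
  then show ?thesis
    unfolding nat_ext_def Let_def by simp
qed

end

text \<open>For \<open>t < \<alpha>\<close> one has \<open>s > m + t - \<alpha> - 1\<close>, which
  exceeds \<open>t\<close> because \<open>\<alpha> < m - 1\<close>. Otherwise \<open>s\<close> is
  below \<open>t - \<alpha>\<close> or at least \<open>m - 1 > t\<close>.\<close>

lemma elliptic_region_off_diagonal:
  assumes "(s, t) \<in> elliptic_region m \<alpha>" "0 < \<alpha>" "\<alpha> < real m - 1"
  shows "s \<noteq> t"
proof -
  have fl: "of_int \<lfloor>t - \<alpha>\<rfloor> \<le> t - \<alpha>" "t - \<alpha> < of_int \<lfloor>t - \<alpha>\<rfloor> + 1"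
    by linarith+
  have "0 \<le> t \<and> t < real m - 1 \<and> (if t < \<alpha> then real m + \<lfloor>t - \<alpha>\<rfloor> \<le> s else s < \<lfloor>t - \<alpha>\<rfloor> \<or> real m - 1 \<le> s)"
    using assms(1) unfolding elliptic_region_def mem_Collect_eq prod.case by blast
  then consider "t < \<alpha>" "0 \<le> t" "real m + \<lfloor>t - \<alpha>\<rfloor> \<le> s" | "s < \<lfloor>t - \<alpha>\<rfloor>" | "t < real m - 1" "real m - 1 \<le> s"
    by argo
  then show ?thesis
    using fl assms(2,3) by cases linarith+
qed

text \<open>The alternative \<open>z = w = 1\<close> occurs when \<open>c\<^sup>j(a) = 1\<close>: then the last rectangle \<open>L\<^sub>J\<^sub>+\<^sub>1\<close> degenerates.\<close>

definition good_rects :: "nat \<Rightarrow> (complex \<times> complex \<times> complex \<times> complex) set \<Rightarrow> bool" where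
  "good_rects l Q \<longleftrightarrow> finite Q \<and> (\<forall>(x, y, z, w)\<in>Q. x \<in> unit_circle \<and> y \<in> unit_circle \<and> z \<in> unit_circle
     \<and> w \<in> unit_circle \<and> (x \<noteq> y \<and> z \<noteq> w \<or> z = 1 \<and> w = 1 \<and> 2 \<le> l))"

lemma good_rectsD:
  assumes "good_rects l Q" "(x, y, z, w) \<in> Q"
  shows "x \<in> unit_circle \<and> y \<in> unit_circle \<and> z \<in> unit_circle \<and> w \<in> unit_circle"
    and "x \<noteq> y \<and> z \<noteq> w \<or> z = 1 \<and> w = 1 \<and> 2 \<le> l"
  using assms unfolding good_rects_def Ball_def split_paired_All prod.case by blast+

lemma good_rectsI:
  assumes "finite Q"
    and "\<And>x y z w. (x, y, z, w) \<in> Q \<Longrightarrow> x \<in> unit_circle \<and> y \<in> unit_circle \<and> z \<in> unit_circle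
      \<and> w \<in> unit_circle \<and> (x \<noteq> y \<and> z \<noteq> w \<or> z = 1 \<and> w = 1 \<and> 2 \<le> l)"
  shows "good_rects l Q"
  using assms unfolding good_rects_def Ball_def split_paired_All prod.case by blast

lemma rect_union_UN: "rect_union ar (\<Union>n\<in>I. Q n) = (\<Union>n\<in>I. rect_union ar (Q n))"
  unfolding rect_union_def by (rule UN_UN_flatten)

section \<open>Bijectivity for each kind of sector\<close>

context polygon
begin

definition sector_domain :: "nat \<Rightarrow> (complex \<times> complex) set" where
  "sector_domain n = rect_union half_open_arc (map_quad (rot l n) ` sector_rects g ms t A \<gamma> n)"

definition good_sector :: "nat \<Rightarrow> bool" where
  "good_sector n \<longleftrightarrow> good_rects l (sector_rects g ms t A \<gamma> n)
     \<and> sector_bij unit_circle (sector n) (nat_ext N A \<gamma>) (sector_domain n)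
     \<and> (\<forall>(u, w)\<in>sector_domain n. u \<noteq> w)"

lemma rot_one: "rot l n 1 = cis (\<delta> * (real n - 1))"
  using rot_eq[of n 0] by simp

lemma A_in: "k \<le> N \<Longrightarrow> A k \<in> unit_circle"
  using A_angle by simp

lemma side_ends: "k \<in> {1..N} \<Longrightarrow> A (k - 1) \<noteq> A k"
proof
  assume k: "k \<in> {1..N}" and eq: "A (k - 1) = A k"
  have "half_open_arc (A (k - 1)) (A k) = {}"
    unfolding eq using k A_in[of k] half_open_arc_eq[of "A k" "A k"] by simp
  then show False
    unfolding side_arc[OF k] using angle_step[OF k] by simp
qed

text \<open>Gluing interchanges starting and end points of paired sides. An orientation preserving
  map therefore takes the arc of side \<open>k\<close> to the arc from \<open>A (\<sigma> k)\<close>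
  round to \<open>A (\<sigma> k - 1)\<close>, the complement of the paired arc.\<close>

lemma sector_bij_sides:
  assumes I: "I \<subseteq> {1..N}" and \<sigma>: "bij_betw \<sigma> I I"
    and iso: "\<And>k. k \<in> I \<Longrightarrow> disk_isometry (\<gamma> k)"
    and glue: "\<And>k. k \<in> I \<Longrightarrow> \<gamma> k (A (k - 1)) = A (\<sigma> k)" "\<And>k. k \<in> I \<Longrightarrow> \<gamma> k (A k) = A (\<sigma> k - 1)"
  defines "D \<equiv> rect_union half_open_arc ((\<lambda>k. (A k, A (k - 1), A (k - 1), A k)) ` I)"
  shows "sector_bij unit_circle (\<Union>k\<in>I. half_open_arc (A (k - 1)) (A k)) (nat_ext N A \<gamma>) D"
    and "\<forall>(u, w)\<in>D. u \<noteq> w"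
proof -
  let ?B = "\<lambda>k. half_open_arc (A (k - 1)) (A k)"
  have IN: "k \<in> {1..N}" "A (k - 1) \<in> unit_circle" "A k \<in> unit_circle" if "k \<in> I" for k
    using I that A_in[of k] A_in[of "k - 1"] by fastforce+
  have compl: "half_open_arc (A k) (A (k - 1)) = unit_circle - ?B k" if "k \<in> I" for k
    using IN[OF that] side_ends by (intro half_open_arc_compl) auto
  have "D = (\<Union>k\<in>I. half_open_arc (A k) (A (k - 1)) \<times> ?B k)"
    unfolding D_def rect_union_def by simp
  also have "\<dots> = (\<Union>k\<in>I. (unit_circle - ?B k) \<times> ?B k)"
    by (intro SUP_cong refl) (simp only: compl)
  finally have D: "D = (\<Union>k\<in>I. (unit_circle - ?B k) \<times> ?B k)" .
  have \<sigma>I: "\<sigma> k \<in> I" if "k \<in> I" for k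
    using \<sigma> that bij_betwE by blast
  show "sector_bij unit_circle (\<Union>k\<in>I. ?B k) (nat_ext N A \<gamma>) D"
    unfolding D
  proof (rule sector_bij_pairing[OF _ _ \<sigma>])
    show "disjoint_family_on ?B I"
      unfolding disjoint_family_on_def using side_unique IN(1) by blast
    fix k assume k: "k \<in> I"
    show "?B k \<subseteq> unit_circle"
      using IN[OF k] arc_subset_unit_circle by blast
    have auto: "circle_auto (\<gamma> k)"
      using iso[OF k] by (rule circle_auto_disk_isometry)
    then show "bij_betw (\<gamma> k) unit_circle unit_circle"
      by (rule circle_auto_bij)
    have "\<gamma> k ` ?B k = half_open_arc (A (\<sigma> k)) (A (\<sigma> k - 1))"
      using circle_auto_arc(2)[OF auto IN(2,3)[OF k]] glue k by simp
    then show "\<gamma> k ` ?B k = unit_circle - ?B (\<sigma> k)"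
      using compl[OF \<sigma>I[OF k]] by simp
    show "nat_ext N A \<gamma> (u, w) = (\<gamma> k u, \<gamma> k w)" if "w \<in> ?B k" for u w
      using nat_ext_side[OF IN(1)[OF k] that] .
  qed
  show "\<forall>(u, w)\<in>D. u \<noteq> w"
    unfolding D by auto
qed

lemma side_arcs_Union:
  assumes "i \<le> j" "j \<le> N"
  shows "(\<Union>k\<in>{i<..j}. half_open_arc (A (k - 1)) (A k)) = cis ` {angle i..<angle j}"
  using assms
proof (induction j rule: dec_induct)
  case (step j)
  have "{i<..Suc j} = insert (Suc j) {i<..j}"
    using step.hyps by auto
  moreover have "{angle i..<angle j} \<union> {angle j..<angle (Suc j)} = {angle i..<angle (Suc j)}"
    using angle_mono[of i j] angle_mono[of j "Suc j"] step by (intro ivl_disj_un_two) auto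
  ultimately show ?case
    using step side_arc[of "Suc j"] by (simp add: Un_commute flip: image_Un)
qed simp

lemma good_sector_square:
  assumes n: "n \<in> {1..g}"
  shows "good_sector n"
proof -
  define q where "q = 4 * n - 4"
  note sides = square_sides[OF n, folded q_def]
  have q: "q = 4 * (n - 1)" "n - 1 < g" "1 \<le> n" "real (n - 1) = real n - 1"
    using n unfolding q_def by auto
  have Vq: "V (q + i) = cis (\<delta> * (real n - 1 + real i / 4))" if "i \<le> 4" for i
    using V_square[OF q(2) that] unfolding q by simp
  have AV: "A (q + i) = V (q + i)" if "i \<le> 4" for i
    using A_square[OF q(2) that] unfolding q by simp
  have AV0: "A q = V q"
    using AV[of 0] by simp
  have rv: "rot l n (vpow l (i / 2)) = cis (\<delta> * (real n - 1 + i / 4))" for i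
    unfolding vpow_eq rot_eq by (simp add: algebra_simps)
  have r: "rot l n 1 = A q" "rot l n (vpow l (1/2)) = A (q + 1)" "rot l n (vpow l 1) = A (q + 2)"
    "rot l n (vpow l (3/2)) = A (q + 3)" "rot l n (vpow l 2) = A (q + 4)"
    using rv[of 0] rv[of 1] rv[of 2] rv[of 3] rv[of 4] Vq[of 0] Vq[of 1] Vq[of 2] Vq[of 3] Vq[of 4]
      AV0 AV[of 1] AV[of 2] AV[of 3] AV[of 4]
    by (simp_all add: vpow_def)
  have Q: "sector_rects g ms t A \<gamma> n = square_rects l"
    using n unfolding sector_rects_def l_def Let_def by simp
  let ?I = "{q<..q + 4}"
  have I: "?I = {q + 1, q + 2, q + 3, q + 4}"
    by auto
  \<comment> \<open>The first side is paired with the third and the second with the fourth.\<close>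
  define \<sigma> where "\<sigma> k = (if k = q + 1 then q + 3 else if k = q + 2 then q + 4 else if k = q + 3 then q + 1 else q + 2)" for k
  have \<sigma>: "bij_betw \<sigma> ?I ?I"
    unfolding I by (rule bij_betw_byWitness[where f' = \<sigma>]) (auto simp: \<sigma>_def)
  have dom: "sector_domain n = rect_union half_open_arc ((\<lambda>k. (A k, A (k - 1), A (k - 1), A k)) ` ?I)"
    unfolding sector_domain_def Q I square_rects_def Let_def map_quad_def by (simp add: r numeral_eq_Suc)
  have VC: "V (q + i) \<in> cball 0 1" if "i \<le> 4" for i
    using Vq[OF that] by simp
  have inv: "\<gamma> (q + 3) (V (q + 3)) = V q" "\<gamma> (q + 3) (V (q + 2)) = V (q + 1)"
    "\<gamma> (q + 2) (V (q + 2)) = V (q + 3)" "\<gamma> (q + 2) (V (q + 1)) = V (q + 4)"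
    using sides(5-10) VC[of 0] VC[of 1] VC[of 3] VC[of 4] unfolding inverse_on_disk_def by fastforce+
  have IN: "?I \<subseteq> {1..N}" and qN: "q + 4 \<le> N"
    using n N_eq unfolding q_def by auto
  have glue: "disk_isometry (\<gamma> k)" "\<gamma> k (A (k - 1)) = A (\<sigma> k)" "\<gamma> k (A k) = A (\<sigma> k - 1)" if "k \<in> ?I" for k
    using that sides(1-8) inv AV[of 1] AV[of 2] AV[of 3] AV[of 4] AV0 unfolding I
    by (auto simp: \<sigma>_def numeral_eq_Suc)
  have "(\<Union>k\<in>?I. half_open_arc (A (k - 1)) (A k)) = sector n"
  proof -
    have "q \<le> 4 * g" "q + 4 \<le> 4 * g" and *: "real q / 4 = real n - 1" "real (q + 4) / 4 = real n"
      using n unfolding q_def by (auto simp: of_nat_diff field_simps)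
    then have "angle q = \<delta> * (real q / 4)" "angle (q + 4) = \<delta> * (real (q + 4) / 4)"
      unfolding angle_def by (simp_all only: if_True)
    then show ?thesis
      unfolding sector_def * using side_arcs_Union[of q "q + 4"] qN by simp
  qed
  then have "sector_bij unit_circle (sector n) (nat_ext N A \<gamma>) (sector_domain n)" "\<forall>(u, w)\<in>sector_domain n. u \<noteq> w"
    using sector_bij_sides[OF IN \<sigma> glue] unfolding dom by auto
  moreover have "good_rects l (square_rects l)"
  proof -
    have "\<delta> \<le> 2 * pi"
      unfolding \<delta>_def using l_pos by (simp add: field_simps)
    \<comment> \<open>Here \<open>l = 1\<close> is possible, and then \<open>vpow l 2 = 1\<close>.
      So only points less than half a sector apart are compared; this covers neighbouring
      vertices.\<close>
    then have ne: "cis (\<delta> * x / 2) \<noteq> cis (\<delta> * y / 2)" if "x < y" "y < x + 1" for x y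
    proof -
      have "\<delta> * (y - x) < 2 * pi * 1"
        using \<open>\<delta> \<le> 2 * pi\<close> that \<delta>(1) by (intro mult_le_less_imp_less) auto
      then have "\<delta> * y < \<delta> * x + 2 * pi"
        by (simp add: right_diff_distrib)
      moreover have "\<delta> * x < \<delta> * y"
        using that \<delta>(1) by simp
      ultimately show ?thesis
        using pi_gt_zero by (intro cis_distinct) linarith+
    qed
    have "vpow l (1/2) \<noteq> 1" "vpow l (1/2) \<noteq> vpow l 1" "vpow l 1 \<noteq> vpow l (3/2)" "vpow l (3/2) \<noteq> vpow l 2"
      using ne[of 0 "1/2"] ne[of "1/2" 1] ne[of 1 "3/2"] ne[of "3/2" 2] unfolding vpow_eq by auto
    then show ?thesis
      unfolding good_rects_def square_rects_def Let_def by (auto simp: vpow_def)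
  qed
  ultimately show ?thesis
    unfolding good_sector_def Q by blast
qed

lemma \<delta>_less: "g < l \<Longrightarrow> \<delta> < 2 * pi"
  using \<delta>(3) pi_gt_zero by linarith

lemma good_sector_cusp:
  assumes j: "length ms < j" "j \<le> l - g"
  shows "good_sector (g + j)"
proof -
  let ?n = "g + j" and ?k = "mid j"
  note sides = cusp_sides[OF j]
  have j': "1 \<le> j" "j \<le> l - g" and gl: "g < l"
    using j by auto
  have k: "?k - 1 = 4 * g + 2 * (j - 1)" "?k + 1 = 4 * g + 2 * j" "?k + 1 \<le> N" "?k - 1 + 2 = ?k + 1"
    using mid(2,3)[OF j'(1)] N_eq j' by auto
  have A: "A (?k - 1) = V (?k - 1)" "A ?k = V ?k" "A (?k + 1) = V (?k + 1)"
    using A_even[of "j - 1"] A_even[of j] A_ideal[of ?k] sides(1) k j' by auto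
  have Vc: "V (?k - 1) = cis (\<delta> * (real ?n - 1))" "V ?k = cis (\<delta> * (real ?n - 1) + \<delta> / 2)" "V (?k + 1) = cis (\<delta> * real ?n)"
    using V_mid[OF j'] V_cusp[OF j] by auto
  \<comment> \<open>The middle equation is where \<open>V_cusp\<close> enters: the cusp is the image
    of the midpoint \<open>vpow l 1\<close>, which makes the cusp rectangles those of the two side
    arcs.\<close>
  have r: "rot l ?n 1 = A (?k - 1)" "rot l ?n (vpow l 1) = A ?k" "rot l ?n (vpow l 2) = A (?k + 1)"
    unfolding vpow_eq rot_eq rot_one A Vc by (simp_all add: algebra_simps)
  have Q: "sector_rects g ms t A \<gamma> ?n = cusp_rects l"
    using j unfolding sector_rects_def l_def Let_def by simp
  let ?I = "{?k - 1<..?k + 1}"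
  have I: "?I = {?k, ?k + 1}"
    using j' unfolding mid_def by auto
  define \<sigma> where "\<sigma> i = (if i = ?k then ?k + 1 else ?k)" for i
  have \<sigma>: "bij_betw \<sigma> ?I ?I"
    unfolding I by (rule bij_betw_byWitness[where f' = \<sigma>]) (auto simp: \<sigma>_def)
  have dom: "sector_domain ?n = rect_union half_open_arc ((\<lambda>k. (A k, A (k - 1), A (k - 1), A k)) ` ?I)"
    unfolding sector_domain_def Q I cusp_rects_def map_quad_def by (simp add: r)
  have "V (?k - 1) \<in> cball 0 1" "V ?k \<in> cball 0 1"
    unfolding Vc by auto
  then have inv: "\<gamma> (?k + 1) (V (?k + 1)) = V (?k - 1)" "\<gamma> (?k + 1) (V ?k) = V ?k"
    using sides(3,4,6) unfolding inverse_on_disk_def by metis+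
  have IN: "?I \<subseteq> {1..N}"
    using k by auto
  have glue: "disk_isometry (\<gamma> i)" "\<gamma> i (A (i - 1)) = A (\<sigma> i)" "\<gamma> i (A i) = A (\<sigma> i - 1)" if "i \<in> ?I" for i
    using that sides inv A unfolding I by (auto simp: \<sigma>_def)
  have "(\<Union>k\<in>?I. half_open_arc (A (k - 1)) (A k)) = sector ?n"
  proof -
    have "j - 1 \<le> l - g" "real (g + (j - 1)) = real ?n - 1"
      using j' by (auto simp: of_nat_diff)
    then have "angle (?k - 1) = \<delta> * (real ?n - 1)" "angle (?k + 1) = \<delta> * real ?n"
      using angle_even[of "j - 1"] angle_even[OF j'(2)] unfolding k(1,2) by simp_all
    moreover have "?k - 1 \<le> ?k + 1"
      by simp
    ultimately show ?thesis
      unfolding sector_def using side_arcs_Union[OF _ k(3)] by metis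
  qed
  then have "sector_bij unit_circle (sector ?n) (nat_ext N A \<gamma>) (sector_domain ?n)" "\<forall>(u, w)\<in>sector_domain ?n. u \<noteq> w"
    using sector_bij_sides[OF IN \<sigma> glue] unfolding dom by auto
  moreover have "good_rects l (cusp_rects l)"
  proof -
    have "cis 0 \<noteq> cis (\<delta> / 2)" "cis (\<delta> / 2) \<noteq> cis \<delta>"
      using \<delta>(1) \<delta>_less[OF gl] by (intro cis_distinct; simp)+
    then have "vpow l 1 \<noteq> 1" "vpow l 1 \<noteq> vpow l 2"
      unfolding vpow_eq by auto
    then show ?thesis
      unfolding good_rects_def cusp_rects_def by (auto simp: vpow_def)
  qed
  ultimately show ?thesis
    unfolding good_sector_def Q by blast
qed

lemma good_sector_elliptic:
  assumes i: "i \<in> {1..length ms}"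
  shows "good_sector (g + i)"
proof -
  let ?n = "g + i" and ?k = "mid i"
  define m where "m = ms ! (i - 1)"
  note sides = elliptic_sides[OF i, folded m_def]
  have i': "1 \<le> i" "i \<le> l - g" and gl: "g < l"
    using i l_eq by auto
  have m: "2 \<le> m"
    using sig i unfolding signature_def m_def by (auto simp: nth_mem)
  have k: "?k - 1 = 4 * g + 2 * (i - 1)" "?k + 1 = 4 * g + 2 * i" "?k \<in> {1..N}" "?k + 1 \<in> {1..N}" "?k + 1 - 1 = ?k"
    using mid(2,3)[OF i'(1)] N_eq i' unfolding mid_def by auto
  have A: "A (?k - 1) = V (?k - 1)" "A (?k + 1) = V (?k + 1)"
    using A_even[of "i - 1"] A_even[of i] k i' by auto
  have Ve: "V (?k - 1) = cis (\<delta> * (real ?n - 1))" "V (?k + 1) = cis (\<delta> * real ?n)"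
    using V_mid[OF i'] by auto
  let ?r = "rot l ?n" and ?r' = "rot_inv l ?n"
  have r: "?r 1 = V (?k - 1)" "?r (vpow l 2) = V (?k + 1)"
    unfolding vpow_eq rot_eq rot_one Ve by (simp_all add: algebra_simps)
  then have r': "?r' (V (?k - 1)) = 1" "?r' (V (?k + 1)) = vpow l 2"
    by (metis rot_rot_inv(2))+
  obtain f where f: "disk_isometry f" "f 1 = V (?k + 1)" "f (cis (2 * pi / m)) = V (?k - 1)"
    and \<gamma>f: "\<And>z. z \<in> unit_circle \<Longrightarrow> \<gamma> ?k (f z) = f (cis (- (2 * pi / m)) * z)"
    using rotation_conjugate[OF sides(3,2,4,5)] by blast
  \<comment> \<open>\<open>f\<close> sends 1 to the end of the sector and
    \<open>cis (2 * pi / m)\<close> to its start. The extra rotation gives the start parameter 0 and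
    the end parameter -1, as \<open>circle_rotation\<close> demands.\<close>
  define h where "h = ?r' \<circ> (f \<circ> (*) (cis (2 * pi / m)))"
  define \<phi> where "\<phi> s = h (cis (2 * pi / m * s))" for s :: real
  define c where "c = ?r' \<circ> \<gamma> ?k \<circ> ?r"
  have \<phi>: "\<phi> s = ?r' (f (cis (2 * pi / m * (s + 1))))" for s
    unfolding \<phi>_def h_def by (simp add: cis_mult algebra_simps add_divide_distrib)
  interpret circle_rotation h c m l \<phi>
  proof
    show "circle_auto h"
      unfolding h_def using f(1) by (intro circle_auto_comp circle_auto_rot_inv circle_auto_disk_isometry circle_auto_mult) auto
    show "c (\<phi> s) = \<phi> (s - 1)" for s :: real
    proof -
      have "- (2 * pi / m) + 2 * pi / m * (s + 1) = 2 * pi / m * (s - 1 + 1)"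
        using m by (simp add: field_simps)
      then show ?thesis
        unfolding \<phi> c_def by (simp only: o_apply rot_rot_inv \<gamma>f[OF cis_in_unit_circle] cis_mult)
    qed
    show "\<phi> 0 = 1" "\<phi> (- 1) = vpow l 2"
      unfolding \<phi> using f r' by simp_all
  qed (use m \<phi>_def in auto)
  have Vk_circle: "V (?k - 1) \<in> unit_circle" "V (?k + 1) \<in> unit_circle"
    unfolding Ve by auto
  have "?r' (A ?k) \<in> open_arc 1 (vpow l 2)"
    using A_mid[OF i'] circle_auto_arc(1)[OF circle_auto_rot_inv Vk_circle, of l ?n] unfolding r' by blast
  then have "?r' (A ?k) \<in> \<phi> ` {0<..<real m - 1}"
    using open_arc_\<phi>[of 0 "real m - 1"] m unfolding one v2' by simp
  then obtain \<alpha> where \<alpha>_def: "?r' (A ?k) = \<phi> \<alpha>" "0 < \<alpha>" "\<alpha> < real m - 1"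
    by auto
  interpret elliptic_sector h c m l \<phi> "?r' (A ?k)" \<alpha>
    by unfold_locales (use \<alpha>_def in auto)
  let ?Q = "sector_rects g ms t A \<gamma> ?n"
  have Q: "?Q = (if m = 2 then two_rects l else elliptic_rects l m c (?r' (A ?k)))"
    using i unfolding sector_rects_def l_def[symmetric] Let_def m_def c_def mid_def by simp
  have good: "good_rects l ?Q"
  proof (cases "m = 2")
    case True
    have "vpow l 2 \<noteq> 1"
      unfolding vpow_eq using cis_distinct[of 0 \<delta>] \<delta>(1) \<delta>_less[OF gl] by auto
    then show ?thesis
      unfolding Q good_rects_def two_rects_def using True by (auto simp: vpow_def)
  next
    case False
    have "good_rects l (elliptic_rects l m c (?r' (A ?k)))"
      by (rule good_rectsI[OF finite_elliptic_rects]) (use elliptic_rects_nondegenerate l_ge_2[OF gl] in blast)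
    then show ?thesis
      unfolding Q using False by simp
  qed
  have dom': "rect_union half_open_arc ?Q = map_prod \<phi> \<phi> ` elliptic_region m \<alpha>"
    unfolding Q using rect_union_elliptic rect_union_two by simp
  define \<psi> where "\<psi> = ?r \<circ> \<phi>"
  have dom: "sector_domain ?n = map_prod \<psi> \<psi> ` elliptic_region m \<alpha>"
  proof -
    have "sector_domain ?n = map_prod ?r ?r ` rect_union half_open_arc ?Q"
      unfolding sector_domain_def using good
      by (intro rect_union_image[OF circle_auto_rot, symmetric]) (auto simp: good_rects_def)
    then show ?thesis
      unfolding dom' \<psi>_def by (simp add: image_image map_prod_def case_prod_unfold)
  qed
  have bij: "bij_betw \<psi> {0..<real m} unit_circle"
    unfolding \<psi>_def using bij_\<phi> circle_auto_bij[OF circle_auto_rot] by (rule bij_betw_trans)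
  have \<psi>_shift: "\<psi> (shift_down m s) = \<psi> (s - 1)" "\<psi> (shift_up m s) = \<psi> (s + 1)" for s
    using \<phi>_period[of "s - 1" 1] \<phi>_period[of "s + 1" "- 1"] unfolding \<psi>_def shift_down_def shift_up_def by simp_all
  have \<psi>_circle: "\<psi> s \<in> unit_circle" for s
    unfolding \<psi>_def o_def using circle_auto_mem[OF circle_auto_rot \<phi>_in] .
  have \<gamma>1: "\<gamma> ?k (\<psi> s) = \<psi> (s - 1)" for s
    unfolding \<psi>_def using c[of s] unfolding c_def by (metis comp_apply rot_rot_inv(1))
  have \<gamma>2: "\<gamma> (?k + 1) (\<psi> s) = \<psi> (s + 1)" for s
  proof -
    have "\<psi> (s + 1) \<in> cball 0 1"
      using \<psi>_circle[of "s + 1"] by simp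
    then show ?thesis
      using sides(7) \<gamma>1[of "s + 1"] unfolding inverse_on_disk_def by (metis add_diff_cancel_right')
  qed
  have arc_\<psi>: "half_open_arc (\<psi> s) (\<psi> s') = \<psi> ` {s..<s'}" if "s \<le> s'" "s' < s + m" for s s' :: real
    unfolding \<psi>_def o_def using circle_auto_arc(2)[OF circle_auto_rot \<phi>_in \<phi>_in] half_open_arc_\<phi>[OF that]
    by (metis image_image)
  have \<psi>A: "\<psi> 0 = A (?k - 1)" "\<psi> \<alpha> = A ?k" "\<psi> (real m - 1) = A (?k + 1)"
    unfolding \<psi>_def using \<alpha>_def(1)[symmetric] one v2' r A by simp_all
  have S: "\<psi> ` {0..<real m - 1} = sector ?n"
  proof -
    have "\<psi> ` {0..<real m - 1} = half_open_arc (V (?k - 1)) (V (?k + 1))"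
      using arc_\<psi>[of 0 "real m - 1"] \<psi>A A m by simp
    also have "\<dots> = sector ?n"
      unfolding Ve sector_def using \<delta>(1) \<delta>_less[OF gl] by (intro half_open_arc_cis) (auto simp: algebra_simps)
    finally show ?thesis .
  qed
  have "sector_bij unit_circle (\<psi> ` {0..<real m - 1}) (nat_ext N A \<gamma>) (sector_domain ?n)"
    unfolding dom
  proof (rule sector_bij_transfer[OF sector_bij_shift[OF m \<alpha>] bij])
    fix p assume "p \<in> elliptic_region m \<alpha>"
    then obtain s t' where p: "p = (s, t')" "0 \<le> t'" "t' < real m - 1"
      unfolding elliptic_region_def by auto
    show "nat_ext N A \<gamma> (map_prod \<psi> \<psi> p) = map_prod \<psi> \<psi> ((\<lambda>(s, t). if t < \<alpha>
        then (shift_down m s, shift_down m t) else (shift_up m s, shift_up m t)) p)"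
    proof (cases "t' < \<alpha>")
      case True
      have "\<psi> t' \<in> half_open_arc (A (?k - 1)) (A ?k)"
        unfolding \<psi>A[symmetric] using arc_\<psi>[of 0 \<alpha>] \<alpha> p True by auto
      then show ?thesis
        using nat_ext_side[OF k(3)] True by (simp add: p \<psi>_shift \<gamma>1)
    next
      case False
      have "\<psi> t' \<in> half_open_arc (A (?k + 1 - 1)) (A (?k + 1))"
        unfolding k(5) \<psi>A[symmetric] using arc_\<psi>[of \<alpha> "real m - 1"] \<alpha> p False by auto
      then show ?thesis
        using nat_ext_side[OF k(4)] False \<gamma>2 by (simp add: p \<psi>_shift)
    qed
  qed (use m in auto)
  moreover have "\<forall>(u, w)\<in>sector_domain ?n. u \<noteq> w"
  proof -
    have "\<psi> s \<noteq> \<psi> t'" if "(s, t') \<in> elliptic_region m \<alpha>" for s t'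
    proof -
      have "s \<in> {0..<real m}" "t' \<in> {0..<real m}"
        using that unfolding elliptic_region_def by auto
      then show ?thesis
        using bij_betw_imp_inj_on[OF bij] elliptic_region_off_diagonal[OF that \<alpha>] inj_onD by metis
    qed
    then show ?thesis
      unfolding dom by fastforce
  qed
  ultimately show ?thesis
    unfolding good_sector_def S using good by blast
qed

lemma good_sectors: "n \<in> {1..l} \<Longrightarrow> good_sector n"
proof -
  assume n: "n \<in> {1..l}"
  consider "n \<in> {1..g}" | "n - g \<in> {1..length ms}" "n = g + (n - g)"
    | "length ms < n - g" "n - g \<le> l - g" "n = g + (n - g)"
    using n by fastforce
  then show ?thesis
    by cases (metis good_sector_square good_sector_elliptic good_sector_cusp)+
qed

section \<open>Assembling the sectors\<close>

lemma sector_index_unique: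
  assumes "n \<in> {1..l}" "n' \<in> {1..l}" "w \<in> sector n" "w \<in> sector n'"
  shows "n = n'"
proof -
  have bound: "0 \<le> s \<and> s < 2 * pi" if "\<delta> * (real k - 1) \<le> s" "s < \<delta> * real k" "k \<in> {1..l}" for s k
  proof -
    have "0 \<le> \<delta> * (real k - 1)" "\<delta> * real k \<le> \<delta> * real l"
      using that(3) \<delta>(1) by auto
    then show ?thesis
      using that \<delta>(2) by linarith
  qed
  obtain s where s: "w = cis s" "\<delta> * (real n - 1) \<le> s" "s < \<delta> * real n"
    using assms(3) unfolding sector_def by auto
  obtain s' where s': "w = cis s'" "\<delta> * (real n' - 1) \<le> s'" "s' < \<delta> * real n'"
    using assms(4) unfolding sector_def by auto
  have "s = s'"
    using Arg2pi_cis[of s] Arg2pi_cis[of s'] bound[OF s(2,3) assms(1)] bound[OF s'(2,3) assms(2)] s(1) s'(1) by simp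
  then have "\<delta> * (real n - 1) < \<delta> * real n'" "\<delta> * (real n' - 1) < \<delta> * real n"
    using s s' by linarith+
  then have "real n - 1 < real n'" "real n' - 1 < real n"
    using \<delta>(1) by simp_all
  then show ?thesis
    by linarith
qed

lemma sector_exists:
  assumes "w \<in> unit_circle"
  obtains n where "n \<in> {1..l}" "w \<in> sector n"
proof -
  obtain s where s: "w = cis s" "0 \<le> s" "s < 2 * pi"
    using assms by (rule unit_circleE)
  define n where "n = nat \<lfloor>s / \<delta>\<rfloor> + 1"
  have "0 \<le> s / \<delta>"
    using s \<delta>(1) by simp
  then have "real n - 1 \<le> s / \<delta>" "s / \<delta> < real n"
    unfolding n_def by linarith+
  then have n: "\<delta> * (real n - 1) \<le> s" "s < \<delta> * real n"
    using \<delta>(1) by (simp_all add: field_simps)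
  have "\<delta> * (real n - 1) < \<delta> * real l"
    using n s \<delta>(2) by linarith
  then have "n \<in> {1..l}"
    using \<delta>(1) unfolding n_def by simp
  then show thesis
    using that n s unfolding sector_def by auto
qed

lemma sector_subset: "sector n \<subseteq> unit_circle"
  unfolding sector_def by auto

definition rects :: "(complex \<times> complex \<times> complex \<times> complex) set" where
  "rects = (\<Union>n\<in>{1..l}. map_quad (rot l n) ` sector_rects g ms t A \<gamma> n)"

lemma good_sector_rects: "n \<in> {1..l} \<Longrightarrow> good_rects l (sector_rects g ms t A \<gamma> n)"
  using good_sectors unfolding good_sector_def by blast

lemma sector_rects_unit_circle:
  assumes "n \<in> {1..l}" "(x, y, z, w) \<in> sector_rects g ms t A \<gamma> n"
  shows "x \<in> unit_circle \<and> y \<in> unit_circle \<and> z \<in> unit_circle \<and> w \<in> unit_circle"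
  using good_rectsD[OF good_sector_rects[OF assms(1)] assms(2)] by blast

lemma Omega_eq_rect_union:
  assumes "ar = closed_arc \<or> ar = half_open_arc"
  shows "Omega ar g ms t A \<gamma> = rect_union ar rects"
proof -
  have "Omega ar g ms t A \<gamma> = (\<Union>n\<in>{1..l}. map_prod (rot l n) (rot l n) ` rect_union ar (sector_rects g ms t A \<gamma> n))"
    unfolding Omega_def Let_def Omega_sector_rects l_def ..
  also have "\<dots> = (\<Union>n\<in>{1..l}. rect_union ar (map_quad (rot l n) ` sector_rects g ms t A \<gamma> n))"
    using sector_rects_unit_circle by (intro SUP_cong refl rect_union_image[OF circle_auto_rot _ assms])
  also have "\<dots> = rect_union ar rects"
    unfolding rects_def rect_union_UN ..
  finally show ?thesis .
qed

lemma rect_union_sectors: "rect_union half_open_arc rects = (\<Union>n\<in>{1..l}. sector_domain n)"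
  unfolding rects_def sector_domain_def rect_union_UN ..

lemma rects_unit_circle:
  assumes "(x, y, z, w) \<in> rects"
  shows "x \<in> unit_circle \<and> y \<in> unit_circle \<and> z \<in> unit_circle \<and> w \<in> unit_circle"
proof -
  obtain n where n: "n \<in> {1..l}" "(x, y, z, w) \<in> map_quad (rot l n) ` sector_rects g ms t A \<gamma> n"
    using assms unfolding rects_def by (rule UN_E)
  show ?thesis
    by (rule map_quad_unit_circle[OF circle_auto_rot sector_rects_unit_circle[OF n(1)] n(2)])
qed

lemma finite_rects: "finite rects"
  unfolding rects_def using good_sector_rects unfolding good_rects_def by (intro finite_UN_I finite_imageI) auto

lemma off_sector_in_domain:
  assumes "n \<in> {1..l}" "w \<in> sector n" "u \<in> unit_circle" "u \<notin> sector n"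
  shows "(u, w) \<in> rect_union half_open_arc rects"
proof -
  have "(unit_circle - sector n) \<times> sector n \<subseteq> sector_domain n"
    using good_sectors[OF assms(1)] unfolding good_sector_def sector_bij_def by blast
  then show ?thesis
    unfolding rect_union_sectors using assms by blast
qed

text \<open>Approaching a sector from the preceding one, every first coordinate of the sector is available.\<close>

lemma sector_start_closure:
  assumes n: "n \<in> {1..l}" and u: "u \<in> unit_circle" and l2: "2 \<le> l"
  shows "(u, rot l n 1) \<in> closure (rect_union half_open_arc rects)"
proof -
  show ?thesis
  proof (cases "u \<in> sector n")
    case False
    have "rot l n 1 \<in> sector n"
      unfolding rot_one sector_def using \<delta>(1) by (intro imageI) simp
    then show ?thesis
      using off_sector_in_domain[OF n _ u False] closure_subset by blast
  next
    case True
    \<comment> \<open>The cyclic predecessor of \<open>n\<close>; it differs from \<open>n\<close>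
      because there are at least two sectors.\<close>
    define p where "p = (if n = 1 then l else n - 1)"
    have p: "p \<in> {1..l}" "p \<noteq> n"
      using n l2 unfolding p_def by auto
    have before: "cis (\<delta> * (real n - 1) - e) \<in> sector p" if "0 < e" "e < \<delta>" for e
    proof (cases "n = 1")
      case True
      have "cis (\<delta> * (real n - 1) - e) = cis (\<delta> * real l - e)"
        unfolding \<delta>(2) using True cis_mult[of "2 * pi" "- e"] by simp
      then show ?thesis
        using that True unfolding sector_def p_def by (auto simp: algebra_simps)
    next
      case False
      then have p_eq: "real p = real n - 1"
        using n unfolding p_def by (simp add: of_nat_diff)
      show ?thesis
        using that unfolding sector_def p_eq by (intro imageI) (auto simp: algebra_simps)
    qed
    have "u \<notin> sector p"
      using sector_index_unique[OF p(1) n _ True] p(2) by blast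
    then have mem: "(u, cis (\<delta> * (real n - 1) - e)) \<in> rect_union half_open_arc rects" if "0 < e" "e < \<delta>" for e
      using off_sector_in_domain[OF p(1) before[OF that] u] by blast
    have lim: "((\<lambda>e. (u, cis (\<delta> * (real n - 1) - e))) \<longlongrightarrow> (u, cis (\<delta> * (real n - 1) - 0))) (at_right 0)"
      by (intro tendsto_intros)
    have "\<forall>\<^sub>F e in at_right 0. (u, cis (\<delta> * (real n - 1) - e)) \<in> closure (rect_union half_open_arc rects)"
      using mem closure_subset \<delta>(1) by (intro eventually_at_rightI[of 0 \<delta>]) auto
    from Lim_in_closed_set[OF closed_closure this trivial_limit_at_right_real lim] show ?thesis
      unfolding rot_one by simp
  qed
qed

text \<open>A nondegenerate closed rectangle is in the closure of its own half-open version. A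
  degenerate one has an empty half-open version, so its points are approached through the
  neighbouring sector by \<open>sector_start_closure\<close>.\<close>

lemma rects_closure: "rect_union closed_arc rects \<subseteq> closure (rect_union half_open_arc rects)"
proof -
  have "closed_arc x y \<times> closed_arc z w \<subseteq> closure (rect_union half_open_arc rects)" if q: "(x, y, z, w) \<in> rects" for x y z w
  proof -
    note C = rects_unit_circle[OF q]
    obtain n x' y' z' w' where n: "n \<in> {1..l}" and q': "(x', y', z', w') \<in> sector_rects g ms t A \<gamma> n"
      and eq: "x = rot l n x'" "y = rot l n y'" "z = rot l n z'" "w = rot l n w'"
      using q unfolding rects_def map_quad_def by auto
    have "x' \<noteq> y' \<and> z' \<noteq> w' \<or> z' = 1 \<and> w' = 1 \<and> 2 \<le> l"
      using good_rectsD(2)[OF good_sector_rects[OF n] q'] .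
    then consider "x \<noteq> y" "z \<noteq> w" | "z = rot l n 1" "w = rot l n 1" "2 \<le> l"
      using eq by (metis rot_rot_inv(2))
    then show ?thesis
    proof cases
      case 1
      then show ?thesis
        using C by (intro rect_union_closed_closure[OF q]) auto
    next
      case 2
      have "closed_arc z w = {rot l n 1}"
        unfolding 2(1,2) rot_one using closed_arc_cis[of "\<delta> * (real n - 1)" "\<delta> * (real n - 1)"] by simp
      moreover have "closed_arc x y \<subseteq> unit_circle"
        using C arc_subset_unit_circle(1) by blast
      ultimately show ?thesis
        using sector_start_closure[OF n _ 2(3)] by auto
    qed
  qed
  then show ?thesis
    unfolding rect_union_def[of closed_arc] by blast
qed

lemma Omega_bijection:
  shows "Omega closed_arc g ms t A \<gamma> \<subseteq> unit_circle \<times> unit_circle"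
    and "Omega half_open_arc g ms t A \<gamma> \<subseteq> Omega closed_arc g ms t A \<gamma>"
    and "\<forall>(u, w)\<in>Omega half_open_arc g ms t A \<gamma>. u \<noteq> w"
    and "(top_of_set (unit_circle \<times> unit_circle)) interior_of (Omega closed_arc g ms t A \<gamma>)
      \<subseteq> Omega half_open_arc g ms t A \<gamma>"
    and "Omega closed_arc g ms t A \<gamma> \<subseteq> closure (Omega half_open_arc g ms t A \<gamma>)"
    and "bij_betw (nat_ext N A \<gamma>) (Omega half_open_arc g ms t A \<gamma>) (Omega half_open_arc g ms t A \<gamma>)"
proof -
  have \<Omega>: "Omega closed_arc g ms t A \<gamma> = rect_union closed_arc rects"
    "Omega half_open_arc g ms t A \<gamma> = rect_union half_open_arc rects"
    using Omega_eq_rect_union by auto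
  show "Omega closed_arc g ms t A \<gamma> \<subseteq> unit_circle \<times> unit_circle"
  proof -
    have "closed_arc x y \<times> closed_arc z w \<subseteq> unit_circle \<times> unit_circle" if "(x, y, z, w) \<in> rects" for x y z w
      using rects_unit_circle[OF that] by (intro Sigma_mono arc_subset_unit_circle(1)) auto
    then show ?thesis
      unfolding \<Omega> rect_union_def by (intro UN_least) (simp only: split_paired_all prod.case)
  qed
  show "Omega half_open_arc g ms t A \<gamma> \<subseteq> Omega closed_arc g ms t A \<gamma>"
    unfolding \<Omega> by (rule rect_union_half_open_subset)
  show "\<forall>(u, w)\<in>Omega half_open_arc g ms t A \<gamma>. u \<noteq> w"
    unfolding \<Omega> rect_union_sectors using good_sectors unfolding good_sector_def by blast
  show "(top_of_set (unit_circle \<times> unit_circle)) interior_of (Omega closed_arc g ms t A \<gamma>)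
      \<subseteq> Omega half_open_arc g ms t A \<gamma>"
    unfolding \<Omega> by (intro interior_rect_union_closed finite_rects rects_unit_circle)
  show "Omega closed_arc g ms t A \<gamma> \<subseteq> closure (Omega half_open_arc g ms t A \<gamma>)"
    unfolding \<Omega> by (rule rects_closure)
  show "bij_betw (nat_ext N A \<gamma>) (Omega half_open_arc g ms t A \<gamma>) (Omega half_open_arc g ms t A \<gamma>)"
    unfolding \<Omega> rect_union_sectors
  proof (rule bij_betw_Union_sectors)
    show "disjoint_family_on sector {1..l}"
      unfolding disjoint_family_on_def using sector_index_unique by blast
    show "(\<Union>n\<in>{1..l}. sector n) = unit_circle"
    proof (intro equalityI UN_least sector_subset subsetI)
      fix w assume "w \<in> unit_circle"
      then obtain n where "n \<in> {1..l}" "w \<in> sector n"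
        by (rule sector_exists)
      then show "w \<in> (\<Union>n\<in>{1..l}. sector n)"
        by (rule UN_I)
    qed
    show "sector_bij unit_circle (sector n) (nat_ext N A \<gamma>) (sector_domain n)" if "n \<in> {1..l}" for n
      using good_sectors[OF that] unfolding good_sector_def by blast
  qed
qed

end

theorem theorem5p2:
  fixes g t :: nat and ms :: "nat list"
    and V A :: "nat \<Rightarrow> complex" and \<gamma> :: "nat \<Rightarrow> complex \<Rightarrow> complex"
  assumes "signature g ms t" and "t \<ge> 1"
    and "canonical_polygon g ms t V \<gamma>"
    and "admissible_partition (num_sides g ms t) V A"
  shows "let T = sphere (0::complex) 1 \<times> sphere (0::complex) 1;
             F = nat_ext (num_sides g ms t) A \<gamma>;
             \<Omega> = Omega closed_arc g ms t A \<gamma>;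
             \<Omega>' = Omega half_open_arc g ms t A \<gamma>
         in \<Omega> \<subseteq> T
          \<and> \<Omega>' \<subseteq> \<Omega> \<and> (\<forall>(u, w)\<in>\<Omega>'. u \<noteq> w)
          \<and> (top_of_set T) interior_of \<Omega> \<subseteq> \<Omega>'
          \<and> \<Omega> \<subseteq> closure \<Omega>'
          \<and> bij_betw F \<Omega>' \<Omega>'"
proof -
  interpret polygon g t ms V A \<gamma>
    by unfold_locales (fact assms)+
  show ?thesis
    unfolding Let_def N_def[symmetric] using Omega_bijection by blast
qed

end
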